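(* Let $\Omega\subset E_k$ be a domain and let $\Phi:\Omega\to\mathbb{A}_n^m$ be a monogenic function in $\Omega$. Let $\Sigma$ be a piecewise smooth surface in $\Omega$ whose edge $\gamma$ is a rectifiable Jordan curve. Then $$\int_{\gamma}\Phi(\zeta)\,d\zeta=0.$$
   Context: Algebra. Let $m\le n$ be natural numbers. $\mathbb{A}_n^m$ is an arbitrary $n$-dimensional commutative associative algebra with unit over $\mathbb{C}$, having a basis $\{I_r\}_{r=1}^n$ with the multiplication rules (such a basis exists by a theorem of E. Cartan): (1) for $r,s\in\{1,\dots,m\}$, $I_rI_s=0$ if $r\ne s$ and $I_rI_r=I_r$; (2) for $r,s\in\{m+1,\dots,n\}$, $I_rI_s=\sum_{p=\max\{r,s\}+1}^n\Upsilon_{r,p}^{s}I_p$ with structure constants $\Upsilon_{r,p}^s\in\mathbb{C}$; (3) for every $s\in\{m+1,\dots,n\}$ there is a unique $u_s\in\{1,\dots,m\}$ such that for all $r\in\{1,\dots,m\}$, $I_rI_s=I_s$ if $r=u_s$ and $I_rI_s=0$ if $r\neq u_s$. The unit is $1=\sum_{u=1}^m I_u$. For $u=1,\dots,m$ the functional $f_u:\mathbb{A}_n^m\to\mathbb{C}$ is the $\mathbb{C}$-linear (multiplicative) functional with $f_u(I_u)=1$ and $f_u(I_r)=0$ for all $r\neq u$. The subspace $E_k$. Let $2\le k\le 2n$ and let $e_1=1,e_2,\dots,e_k\in\mathbb{A}_n^m$ be linearly independent over $\mathbb{R}$. Put $E_k=\{\zeta=\sum_{j=1}^k x_je_j:\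 x_j\in\mathbb{R}\}$. Standing assumption: $f_u(E_k)=\mathbb{C}$ for all $u=1,\dots,m$. $E_k$ is identified with $\mathbb{R}^k$ through the coordinates $(x_1,\dots,x_k)$; all topological and metric notions for subsets of $E_k$ (domain, rectifiability, smoothness, homotopy, etc.) are those of the corresponding subsets of $\mathbb{R}^k$; for $Q\subset E_k$ the corresponding subset of $\mathbb{R}^k$ is $Q_{\mathbb{R}}$. A domain is a nonempty open connected set. Monogenic functions. A continuous function $\Phi:\Omega\to\mathbb{A}_n^m$ is monogenic in the domain $\Omega\subset E_k$ if for every $\zeta\in\Omega$ there is an element $\Phi'(\zeta)\in\mathbb{A}_n^m$ such that $\lim_{\varepsilon\to0+0}\left(\Phi(\zeta+\varepsilon h)-\Phi(\zeta)\right)\varepsilon^{-1}=h\Phi'(\zeta)$ for all $h\in E_k$. Integral. For a Jordan rectifiable curve $\gamma\subset E_k$ and a continuous $\Psi=\sum_{r=1}^n (U_r+iV_r)I_r:\gamma\to\mathbb{A}_n^m$ with real-valued functions $U_r,V_r$ of $(x_1,\dots,x_k)\in\gamma_{\mathbb{R}}$, $$\int_\gamma\Psi(\zeta)\,d\zeta:=\sum_{j=1}^k e_j\sum_{r=1}^n I_r\int_{\gamma_{\mathbb{R}}}U_r\,dx_j+i\sum_{j=1}^k e_j\sum_{r=1}^n I_r\int_{\gamma_{\mathbb{R}}}V_r\,dx_j .$$ Surfaces. A piecewise smooth surface is here a compact two-dimensional oriented piecewise smooth surface with boundary, to which the classical Stokes formula applies; its edge is its boundary curve. *)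

theory Defs
  imports "HOL-Analysis.Analysis"
begin

section \<open>The algebra\<close>

text \<open>
  The class \<^class>\<open>real_normed_vector\<close> only supplies the topology: the algebra is finite-dimensional,
  so all norms on it are equivalent, and no compatibility of the norm with the multiplication
  is required.  Basis elements are indexed from 1, so only the values \<open>I 1, \<dots>, I n\<close> matter.
\<close>

locale cartan_algebra = vector_space cscale
  for cscale :: "complex \<Rightarrow> 'a \<Rightarrow> 'a::{comm_ring_1, real_normed_vector}" +
  fixes m n :: nat
    and I :: "nat \<Rightarrow> 'a"
    and \<Upsilon> :: "nat \<Rightarrow> nat \<Rightarrow> nat \<Rightarrow> complex"
  assumes scale_mult_left: "cscale c (x * y) = cscale c x * y"
    and scaleR_eq_scale: "t *\<^sub>R x = cscale (of_real t) x"
    and m_pos: "1 \<le> m" and m_le_n: "m \<le> n"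
    and basis_inj: "inj_on I {1..n}"
    and basis_independent: "module.independent cscale (I ` {1..n})"
    and basis_span: "module.span cscale (I ` {1..n}) = UNIV"
    and idempotents:
      "\<lbrakk>r \<in> {1..m}; s \<in> {1..m}\<rbrakk> \<Longrightarrow> I r * I s = (if r = s then I r else 0)"
    and nilpotents:
      "\<lbrakk>r \<in> {m+1..n}; s \<in> {m+1..n}\<rbrakk> \<Longrightarrow>
         I r * I s = (\<Sum>p = max r s + 1..n. cscale (\<Upsilon> r s p) (I p))"
    and mixed:
      "s \<in> {m+1..n} \<Longrightarrow>
         \<exists>!u. u \<in> {1..m} \<and> (\<forall>r\<in>{1..m}. I r * I s = (if r = u then I s else 0))"
    and unit_eq: "1 = (\<Sum>u = 1..m. I u)"

definition basis_coord ::
    "(complex \<Rightarrow> 'a \<Rightarrow> 'a::{comm_ring_1, real_normed_vector}) \<Rightarrow> nat \<Rightarrow> (nat \<Rightarrow> 'a) \<Rightarrow> nat \<Rightarrow> 'a \<Rightarrow> complex"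
  where "basis_coord cscale n I r a = module.representation cscale (I ` {1..n}) a (I r)"

text \<open>
  The functional \<open>f\<^sub>u\<close> is the \<open>u\<close>-th coordinate; the lemma \<open>f_functional_unique\<close> below says that this
  is the linear functional determined by its values on the basis.
\<close>

definition f_functional ::
    "(complex \<Rightarrow> 'a \<Rightarrow> 'a::{comm_ring_1, real_normed_vector}) \<Rightarrow> nat \<Rightarrow> (nat \<Rightarrow> 'a) \<Rightarrow> nat \<Rightarrow> 'a \<Rightarrow> complex"
  where "f_functional cscale n I u = basis_coord cscale n I u"

lemma (in cartan_algebra) f_functional_linear:
  "Vector_Spaces.linear cscale (*) (f_functional cscale n I u)"
proof -
  interpret vs: vector_space_pair cscale "(*) :: complex \<Rightarrow> complex \<Rightarrow> complex"
    by unfold_locales (auto simp: algebra_simps)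
  show ?thesis
    unfolding f_functional_def basis_coord_def Vector_Spaces.linear_iff
    using vector_space_axioms vs.vector_space_pair_axioms basis_independent basis_span
    by (auto simp: representation_add representation_scale vector_space_pair_def)
qed

lemma (in cartan_algebra) f_functional_basis:
  assumes "u \<in> {1..n}" "r \<in> {1..n}"
  shows "f_functional cscale n I u (I r) = (if r = u then 1 else 0)"
  using assms basis_inj basis_independent
  by (auto simp: f_functional_def basis_coord_def representation_basis inj_on_eq_iff)

lemma (in cartan_algebra) f_functional_unique:
  assumes "u \<in> {1..n}" and lin: "Vector_Spaces.linear cscale (*) g"
    and "\<And>r. r \<in> {1..n} \<Longrightarrow> g (I r) = (if r = u then 1 else 0)"
  shows "g = f_functional cscale n I u"
proof
  fix a
  interpret vs: vector_space_pair cscale "(*) :: complex \<Rightarrow> complex \<Rightarrow> complex"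
    by unfold_locales (auto simp: algebra_simps)
  show "g a = f_functional cscale n I u a"
  proof (rule vs.linear_eq_on[OF lin f_functional_linear])
    show "a \<in> span (I ` {1..n})" unfolding basis_span by (rule UNIV_I)
    show "g b = f_functional cscale n I u b" if "b \<in> I ` {1..n}" for b
      using that assms f_functional_basis by auto
  qed
qed


section \<open>The subspace \<open>E\<^sub>k\<close>, its coordinates, and monogenic functions\<close>

definition E_point :: "('k::finite \<Rightarrow> 'a::real_normed_vector) \<Rightarrow> real ^ 'k \<Rightarrow> 'a"
  where "E_point e x = (\<Sum>j\<in>UNIV. x $ j *\<^sub>R e j)"

definition E_space :: "('k::finite \<Rightarrow> 'a::real_normed_vector) \<Rightarrow> 'a set"
  where "E_space e = range (E_point e)"

text \<open>For linearly independent \<open>e\<close> this is the inverse of \<open>E_point e\<close> on \<open>E_space e\<close>, so that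
  \<open>E_coord e ` Q\<close> is \<open>Q\<^sub>\<real>\<close>.\<close>

definition E_coord :: "('k::finite \<Rightarrow> 'a::real_normed_vector) \<Rightarrow> 'a \<Rightarrow> real ^ 'k"
  where "E_coord e = inv (E_point e)"

definition E_domain :: "('k::finite \<Rightarrow> 'a::real_normed_vector) \<Rightarrow> 'a set \<Rightarrow> bool"
  where "E_domain e \<Omega> \<longleftrightarrow>
    \<Omega> \<subseteq> E_space e \<and> \<Omega> \<noteq> {} \<and> open (E_coord e ` \<Omega>) \<and> connected (E_coord e ` \<Omega>)"

definition monogenic_on ::
    "('k::finite \<Rightarrow> 'a::{comm_ring_1, real_normed_vector}) \<Rightarrow> 'a set \<Rightarrow> ('a \<Rightarrow> 'a) \<Rightarrow> bool"
  where "monogenic_on e \<Omega> \<Phi> \<longleftrightarrow>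
    continuous_on \<Omega> \<Phi> \<and>
    (\<forall>\<zeta>\<in>\<Omega>. \<exists>\<Phi>'. \<forall>h\<in>E_space e.
       ((\<lambda>\<epsilon>::real. (1 / \<epsilon>) *\<^sub>R (\<Phi> (\<zeta> + \<epsilon> *\<^sub>R h) - \<Phi> \<zeta>)) \<longlongrightarrow> h * \<Phi>') (at_right 0))"


section \<open>Integrals along rectifiable curves\<close>

definition rectifiable :: "(real \<Rightarrow> 'b::real_normed_vector) \<Rightarrow> bool"
  where "rectifiable g \<longleftrightarrow>
    path g \<and>
    (\<exists>L. \<forall>d. d division_of {0..1} \<longrightarrow> (\<Sum>K\<in>d. norm (g (Sup K) - g (Inf K))) \<le> L)"

definition jordan_curve :: "(real \<Rightarrow> 'b::topological_space) \<Rightarrow> bool"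
  where "jordan_curve g \<longleftrightarrow> simple_path g \<and> pathfinish g = pathstart g"

text \<open>The Riemann--Stieltjes integral, as limit of Riemann--Stieltjes sums when the mesh tends to 0.\<close>

definition has_RS_integral :: "(real \<Rightarrow> real) \<Rightarrow> (real \<Rightarrow> real) \<Rightarrow> real \<Rightarrow> bool"
  where "has_RS_integral f g J \<longleftrightarrow>
    (\<forall>\<epsilon>>0. \<exists>\<delta>>0. \<forall>p. p tagged_division_of {0..1} \<and> (\<forall>(t, K)\<in>p. diameter K < \<delta>) \<longrightarrow>
       \<bar>(\<Sum>(t, K)\<in>p. f t * (g (Sup K) - g (Inf K))) - J\<bar> < \<epsilon>)"

definition line_integral :: "(real ^ 'k::finite \<Rightarrow> real) \<Rightarrow> (real \<Rightarrow> real ^ 'k) \<Rightarrow> 'k \<Rightarrow> real"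
  where "line_integral U g j = (THE J. has_RS_integral (\<lambda>t. U (g t)) (\<lambda>t. g t $ j) J)"

definition curve_integral ::
    "(complex \<Rightarrow> 'a \<Rightarrow> 'a::{comm_ring_1, real_normed_vector}) \<Rightarrow> nat \<Rightarrow> (nat \<Rightarrow> 'a) \<Rightarrow>
     ('k::finite \<Rightarrow> 'a) \<Rightarrow> (real \<Rightarrow> 'a) \<Rightarrow> ('a \<Rightarrow> 'a) \<Rightarrow> 'a"
  where "curve_integral cscale n I e \<gamma> \<Psi> =
    (let \<gamma>R = E_coord e \<circ> \<gamma>;
         U = (\<lambda>r x. Re (basis_coord cscale n I r (\<Psi> (E_point e x))));
         V = (\<lambda>r x. Im (basis_coord cscale n I r (\<Psi> (E_point e x))))
     in (\<Sum>j\<in>UNIV. e j * (\<Sum>r = 1..n. line_integral (U r) \<gamma>R j *\<^sub>R I r)) +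
        cscale \<i> (\<Sum>j\<in>UNIV. e j * (\<Sum>r = 1..n. line_integral (V r) \<gamma>R j *\<^sub>R I r)))"


section \<open>Piecewise smooth surfaces\<close>

definition C1_on :: "('b::euclidean_space \<Rightarrow> 'c::real_normed_vector) \<Rightarrow> 'b set \<Rightarrow> bool"
  where "C1_on f U \<longleftrightarrow>
    open U \<and> f differentiable_on U \<and>
    (\<forall>v. continuous_on U (\<lambda>x. frechet_derivative f (at x) v))"

text \<open>
  A smooth piece is a map \<open>\<phi>\<close> on a closed plane region \<open>D\<close> bounded by a rectifiable Jordan curve.
  Regularity is required in the interior only, so that, for example, polar coordinates may be used
  near the apex of a cone.  The orientation of the piece is the one given by the coordinates
  \<open>(s, t)\<close> of the parameter plane.
\<close>

definition smooth_piece :: "(real \<times> real \<Rightarrow> real ^ 'k::finite) \<Rightarrow> (real \<times> real) set \<Rightarrow> bool"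
  where "smooth_piece \<phi> D \<longleftrightarrow>
    (\<exists>c. jordan_curve c \<and> rectifiable c \<and> D = path_image c \<union> inside (path_image c)) \<and>
    (\<exists>U. D \<subseteq> U \<and> C1_on \<phi> U) \<and>
    (\<forall>z\<in>interior D. inj (frechet_derivative \<phi> (at z)))"

definition surface_interior :: "'b::topological_space set \<Rightarrow> 'b set"
  where "surface_interior S =
    {x\<in>S. \<exists>U (V :: (real \<times> real) set).
       openin (top_of_set S) U \<and> x \<in> U \<and> open V \<and> U homeomorphic V}"

definition surface_boundary :: "'b::topological_space set \<Rightarrow> 'b set"
  where "surface_boundary S = S - surface_interior S"

definition surface_with_boundary :: "'b::topological_space set \<Rightarrow> bool"
  where "surface_with_boundary S \<longleftrightarrow>
    (\<forall>x\<in>S. \<exists>U V. openin (top_of_set S) U \<and> x \<in> U \<and>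
       openin (top_of_set {z :: real \<times> real. 0 \<le> fst z}) V \<and> U homeomorphic V)"

text \<open>
  For the 1-form \<open>\<omega> = \<Sum>\<^sub>j P\<^sub>j dx\<^sub>j\<close>, the integral of \<open>d\<omega> = \<Sum>\<^sub>j dP\<^sub>j \<and> dx\<^sub>j\<close> over the piece \<open>(\<phi>, D)\<close>,
  that is, of \<open>d\<omega>(v, w) = DP(v) \<bullet> w - DP(w) \<bullet> v\<close> at \<open>v = \<partial>\<phi>/\<partial>s\<close>, \<open>w = \<partial>\<phi>/\<partial>t\<close>.
\<close>

definition piece_integral_d ::
    "(real ^ 'k \<Rightarrow> real ^ 'k) \<Rightarrow> (real \<times> real \<Rightarrow> real ^ 'k::finite) \<Rightarrow> (real \<times> real) set \<Rightarrow> real"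
  where "piece_integral_d P \<phi> D =
    integral D (\<lambda>z.
      let v = frechet_derivative \<phi> (at z) (1, 0);
          w = frechet_derivative \<phi> (at z) (0, 1);
          DP = frechet_derivative P (at (\<phi> z))
      in DP v \<bullet> w - DP w \<bullet> v)"

definition stokes_formula ::
    "((real \<times> real \<Rightarrow> real ^ 'k::finite) \<times> (real \<times> real) set) set \<Rightarrow>
     (real \<Rightarrow> real ^ 'k) \<Rightarrow> (real ^ 'k \<Rightarrow> real ^ 'k) \<Rightarrow> bool"
  where "stokes_formula pieces g P \<longleftrightarrow>
    (\<Sum>j\<in>UNIV. line_integral (\<lambda>x. P x $ j) g j) =
    (\<Sum>(\<phi>, D)\<in>pieces. piece_integral_d P \<phi> D)"

text \<open>
  A compact oriented piecewise smooth surface \<open>S\<close> with boundary curve \<open>g\<close>, to which the classical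
  Stokes formula applies.  The fourth clause says that each piece is injectively parametrised in its
  interior and that the pieces overlap only along their boundaries.  The last clause is the
  Stokes formula for all \<open>C\<^sup>1\<close> 1-forms defined near \<open>S\<close>; it also forces the orientations of
  the pieces to be coherent and \<open>g\<close> to carry the induced orientation, because otherwise the
  boundaries of the pieces would not cancel off \<open>g\<close>.
\<close>

definition piecewise_smooth_surface_with_edge :: "(real ^ 'k::finite) set \<Rightarrow> (real \<Rightarrow> real ^ 'k) \<Rightarrow> bool"
  where "piecewise_smooth_surface_with_edge S g \<longleftrightarrow>
    (\<exists>pieces.
       finite pieces \<and>
       (\<forall>(\<phi>, D)\<in>pieces. smooth_piece \<phi> D) \<and>
       S = (\<Union>(\<phi>, D)\<in>pieces. \<phi> ` D) \<and>
       (\<forall>(\<phi>, D)\<in>pieces. \<forall>(\<psi>, D')\<in>pieces. \<forall>z\<in>interior D. \<forall>z'\<in>D'.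
          \<phi> z = \<psi> z' \<longrightarrow> (\<phi>, D) = (\<psi>, D') \<and> z = z') \<and>
       surface_with_boundary S \<and>
       surface_boundary S = path_image g \<and>
       (\<forall>W P. S \<subseteq> W \<and> C1_on P W \<longrightarrow> stokes_formula pieces g P))"

end

theory Submission
  imports Defs
begin

text \<open>
  Let \<open>L\<close> be a real-linear functional on the algebra.  Applied to \<open>\<Phi> d\<zeta>\<close> it gives the real 1-form with
  coefficients \<open>P\<^sub>j = L (e\<^sub>j \<Phi>)\<close>.  Monogenicity says that \<open>\<partial>\<^sub>i \<Phi> = e\<^sub>i \<Phi>'\<close>, so
  \<open>\<partial>\<^sub>i P\<^sub>j = L (e\<^sub>j e\<^sub>i \<Phi>')\<close>, which is symmetric in \<open>i\<close> and \<open>j\<close> because the algebra is commutative.  The form is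
  therefore closed, at least formally, and the Stokes formula should show that its integral over the edge
  of the surface vanishes.  Since the functionals \<open>L\<close> separate points, this is the claim.

  The obstacle is regularity.  Monogenicity is a condition on limits along rays: it gives partial
  derivatives at every point, but neither their continuity nor their boundedness nor the
  differentiability of \<open>\<Phi>\<close> as a function of several variables, whereas the Stokes formula is for forms of
  class \<open>C\<^sup>1\<close>.  Two steps bridge the gap.

  First, in each coordinate plane, \<open>circulation_eq_0\<close> shows that a continuous form \<open>u ds + v dt\<close> whose
  partial derivatives exist at every point and satisfy \<open>\<partial>u/\<partial>t = \<partial>v/\<partial>s\<close> has integral 0 along the
  boundary of every rectangle.  This is a theorem of Looman--Menchoff type.  By Baire's theorem the form
  is uniformly almost affine along some piece of the set of points where the assertion fails locally;
  the contribution of this piece is estimated by enclosing it in rectangles that it touches on all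
  sides (\<open>circulation_le_of_bad_portion\<close>).

  Second, the form is averaged over small cubes.  The averages are of class \<open>C\<^sup>1\<close>, and closed because
  the integral of the original form around coordinate squares vanishes
  (\<open>averages_partials_symmetric\<close>, \<open>average_rectangle\<close>).  The Stokes formula applies to them, and
  when the cubes shrink the line integrals converge, because the curve is rectifiable and the averages
  converge uniformly on it (\<open>line_integral_closed_form\<close>).
\<close>


section \<open>Riemann--Stieltjes integrals along rectifiable curves\<close>

definition variation_le :: "(real \<Rightarrow> real) \<Rightarrow> real \<Rightarrow> bool"
  where "variation_le g L \<longleftrightarrow>
    (\<forall>d. d division_of {0..1} \<longrightarrow> (\<Sum>K\<in>d. \<bar>g (Sup K) - g (Inf K)\<bar>) \<le> L)"

definition RS_sum :: "(real \<Rightarrow> real) \<Rightarrow> (real \<Rightarrow> real) \<Rightarrow> (real \<times> real set) set \<Rightarrow> real"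
  where "RS_sum f g p = (\<Sum>(t, K)\<in>p. f t * (g (Sup K) - g (Inf K)))"

lemma has_RS_integral_iff:
  "has_RS_integral f g J \<longleftrightarrow>
    (\<forall>\<epsilon>>0. \<exists>\<delta>>0. \<forall>p. p tagged_division_of {0..1} \<and> (\<forall>(t, K)\<in>p. diameter K < \<delta>) \<longrightarrow>
       \<bar>RS_sum f g p - J\<bar> < \<epsilon>)"
  by (simp add: has_RS_integral_def RS_sum_def)

lemma tagged_interval_real:
  fixes p :: "(real \<times> real set) set"
  assumes "p tagged_division_of {0..1}" "(t, K) \<in> p"
  obtains a b where "K = {a..b}" "a \<le> t" "t \<le> b" "0 \<le> a" "b \<le> 1" "Inf K = a" "Sup K = b"
proof -
  obtain a b where K: "K = cbox a b" using tagged_division_ofD(4)[OF assms] by blast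
  have "t \<in> K" "K \<subseteq> {0..1}" using tagged_division_ofD(2,3)[OF assms] by auto
  then have *: "K = {a..b}" "a \<le> t" "t \<le> b" using K by auto
  then have "0 \<le> a" "b \<le> 1" using \<open>K \<subseteq> {0..1}\<close> by auto
  then show thesis using that[OF *] * by simp
qed

lemma exists_tagged_division_diameter:
  assumes "0 < \<delta>"
  obtains p where "p tagged_division_of {0..1::real}" "\<forall>(t, K)\<in>p. diameter K < \<delta>"
proof -
  have "gauge (\<lambda>x::real. ball x (\<delta> / 3))" using assms by (intro gauge_ball) simp
  then obtain p where p: "p tagged_division_of {0..1::real}" "(\<lambda>x. ball x (\<delta> / 3)) fine p"
    using fine_division_exists_real by blast
  have "diameter K < \<delta>" if "(t, K) \<in> p" for t K
  proof -
    have "K \<subseteq> ball t (\<delta> / 3)" using p(2) that by (auto simp: fine_def)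
    then have "diameter K \<le> diameter (ball t (\<delta> / 3))" by (rule diameter_subset) simp
    then show ?thesis using assms by (simp add: diameter_ball split: if_splits)
  qed
  then show thesis using that p(1) by blast
qed

lemma sum_tagged_variation_le:
  assumes "variation_le g L" "p tagged_division_of {0..1}"
  shows "(\<Sum>(t, K)\<in>p. \<bar>g (Sup K) - g (Inf K)\<bar>) \<le> L"
proof -
  define v where "v K = (if K = {} then 0 else \<bar>g (Sup K) - g (Inf K)\<bar>)" for K
  have "(\<Sum>(t, K)\<in>p. \<bar>g (Sup K) - g (Inf K)\<bar>) = (\<Sum>(t, K)\<in>p. v K)"
  proof (rule sum.cong[OF refl], safe)
    fix t K assume "(t, K) \<in> p"
    then have "K \<noteq> {}" using tagged_division_ofD(2)[OF assms(2)] by blast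
    then show "\<bar>g (Sup K) - g (Inf K)\<bar> = v K" by (simp add: v_def)
  qed
  also have "\<dots> = (\<Sum>K\<in>snd ` p. v K)"
  proof (rule sum.over_tagged_division_lemma[OF assms(2)])
    fix a b :: real assume "box a b = {}"
    then have "{a..b} = {} \<or> a = b" by auto
    then show "v (cbox a b) = 0" by (auto simp: v_def)
  qed
  also have "\<dots> \<le> (\<Sum>K\<in>snd ` p. \<bar>g (Sup K) - g (Inf K)\<bar>)"
    by (rule sum_mono) (simp add: v_def)
  also have "\<dots> \<le> L"
    using assms(1) division_of_tagged_division[OF assms(2)] unfolding variation_le_def by blast
  finally show ?thesis .
qed

lemma variation_nonneg:
  assumes "variation_le g L"
  shows "0 \<le> L"
proof -
  have "{cbox 0 (1::real)} division_of cbox 0 1" by (rule division_of_self) simp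
  then have "{{0..1::real}} division_of {0..1}" by simp
  then have "(\<Sum>K\<in>{{0..1::real}}. \<bar>g (Sup K) - g (Inf K)\<bar>) \<le> L" using assms unfolding variation_le_def by blast
  then show ?thesis by simp
qed

text \<open>
  Bounded variation makes the Riemann--Stieltjes sums Lipschitz in the integrand for the supremum
  norm.  This one estimate yields uniqueness and existence of the integral, and later the convergence
  of line integrals.
\<close>

lemma RS_sum_close:
  assumes "variation_le g L" "p tagged_division_of {0..1}" "\<And>t. t \<in> {0..1} \<Longrightarrow> \<bar>f t - f' t\<bar> \<le> \<omega>"
  shows "\<bar>RS_sum f g p - RS_sum f' g p\<bar> \<le> \<omega> * L"
proof -
  have "0 \<le> \<omega>" using assms(3)[of 0] by simp
  have "RS_sum f g p - RS_sum f' g p = (\<Sum>(t, K)\<in>p. (f t - f' t) * (g (Sup K) - g (Inf K)))"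
    unfolding RS_sum_def sum_subtractf[symmetric] by (simp add: split_beta algebra_simps)
  also have "\<bar>\<dots>\<bar> \<le> (\<Sum>(t, K)\<in>p. \<omega> * \<bar>g (Sup K) - g (Inf K)\<bar>)"
  proof (rule order_trans[OF sum_abs sum_mono], safe)
    fix t K assume "(t, K) \<in> p"
    then have "t \<in> {0..1}" using tagged_division_ofD(2,3)[OF assms(2)] by blast
    then show "\<bar>(f t - f' t) * (g (Sup K) - g (Inf K))\<bar> \<le> \<omega> * \<bar>g (Sup K) - g (Inf K)\<bar>"
      unfolding abs_mult using assms(3) by (intro mult_right_mono) auto
  qed
  also have "\<dots> = \<omega> * (\<Sum>(t, K)\<in>p. \<bar>g (Sup K) - g (Inf K)\<bar>)"
    by (simp add: sum_distrib_left split_beta)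
  also have "\<dots> \<le> \<omega> * L"
    using sum_tagged_variation_le[OF assms(1,2)] \<open>0 \<le> \<omega>\<close> by (rule mult_left_mono)
  finally show ?thesis .
qed

lemma has_RS_integral_close:
  assumes "variation_le g L" "has_RS_integral f g J" "has_RS_integral f' g J'"
    and "\<And>t. t \<in> {0..1} \<Longrightarrow> \<bar>f t - f' t\<bar> \<le> \<omega>"
  shows "\<bar>J - J'\<bar> \<le> \<omega> * L"
proof (rule field_le_epsilon)
  fix \<epsilon> :: real assume "0 < \<epsilon>"
  then have "0 < \<epsilon> / 2" by simp
  obtain \<delta>1 where \<delta>1: "\<delta>1 > 0" "\<And>p. p tagged_division_of {0..1} \<Longrightarrow> (\<forall>(t, K)\<in>p. diameter K < \<delta>1) \<Longrightarrow> \<bar>RS_sum f g p - J\<bar> < \<epsilon> / 2"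
    using assms(2)[unfolded has_RS_integral_iff, rule_format, OF \<open>0 < \<epsilon> / 2\<close>] by blast
  obtain \<delta>2 where \<delta>2: "\<delta>2 > 0" "\<And>p. p tagged_division_of {0..1} \<Longrightarrow> (\<forall>(t, K)\<in>p. diameter K < \<delta>2) \<Longrightarrow> \<bar>RS_sum f' g p - J'\<bar> < \<epsilon> / 2"
    using assms(3)[unfolded has_RS_integral_iff, rule_format, OF \<open>0 < \<epsilon> / 2\<close>] by blast
  obtain p where p: "p tagged_division_of {0..1::real}" "\<forall>(t, K)\<in>p. diameter K < min \<delta>1 \<delta>2"
    using exists_tagged_division_diameter[of "min \<delta>1 \<delta>2"] \<delta>1(1) \<delta>2(1) by auto
  have "\<bar>RS_sum f g p - J\<bar> < \<epsilon> / 2" using p by (intro \<delta>1(2)) auto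
  moreover have "\<bar>RS_sum f' g p - J'\<bar> < \<epsilon> / 2" using p by (intro \<delta>2(2)) auto
  moreover have "\<bar>RS_sum f g p - RS_sum f' g p\<bar> \<le> \<omega> * L"
    by (rule RS_sum_close[OF assms(1) p(1) assms(4)])
  ultimately show "\<bar>J - J'\<bar> \<le> \<omega> * L + \<epsilon>" by linarith
qed

lemma has_RS_integral_unique:
  assumes "variation_le g L" "has_RS_integral f g J" "has_RS_integral f g J'"
  shows "J = J'"
  using has_RS_integral_close[OF assms, of 0] by simp

text \<open>
  For a smooth integrand the integral exists by integration by parts, for every continuous
  integrator.  With \<open>F t = f t * g t - \<integral>\<^sub>0\<^sup>t g f'\<close> the increments of \<open>F\<close> telescope, and on an interval
  \<open>[a, b]\<close> with tag \<open>t\<close> the difference between \<open>f t * (g b - g a)\<close> and \<open>F b - F a\<close> is a sum of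
  products of an increment of \<open>f\<close>, of order \<open>b - a\<close>, with an oscillation of \<open>g\<close>.
\<close>

lemma has_RS_integral_smooth:
  fixes f f' g :: "real \<Rightarrow> real"
  assumes deriv: "\<And>x. (f has_real_derivative f' x) (at x)"
    and cont_f': "continuous_on {0..1} f'" and cont_g: "continuous_on {0..1} g"
  shows "has_RS_integral f g (f 1 * g 1 - f 0 * g 0 - integral {0..1} (\<lambda>x. g x * f' x))"
  unfolding has_RS_integral_iff
proof (intro allI impI)
  fix \<epsilon> :: real assume "0 < \<epsilon>"
  obtain M where M: "M > 0" "\<And>x. x \<in> {0..1} \<Longrightarrow> \<bar>f' x\<bar> \<le> M"
    using compact_imp_bounded[OF compact_continuous_image[OF cont_f' compact_Icc]]
    unfolding bounded_pos by auto
  define \<eta> where "\<eta> = \<epsilon> / (4 * M)"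
  have "\<eta> > 0" using M \<open>0 < \<epsilon>\<close> by (simp add: \<eta>_def)
  have "uniformly_continuous_on {0..1} g" using cont_g by (simp add: compact_uniformly_continuous)
  then obtain \<delta> where \<delta>: "\<delta> > 0"
      "\<And>y x. y \<in> {0..1} \<Longrightarrow> x \<in> {0..1} \<Longrightarrow> dist x y < \<delta> \<Longrightarrow> dist (g x) (g y) < \<eta>"
    using \<open>\<eta> > 0\<close> by (rule uniformly_continuous_onE) blast
  then have close: "\<bar>g x - g y\<bar> \<le> \<eta>" if "x \<in> {0..1}" "y \<in> {0..1}" "\<bar>x - y\<bar> < \<delta>" for x y
    using that unfolding dist_real_def by (intro less_imp_le) blast
  define F where "F t = f t * g t - integral {0..t} (\<lambda>x. g x * f' x)" for t
  have f_lip: "\<bar>f x - f y\<bar> \<le> M * \<bar>x - y\<bar>" if "x \<in> {0..1}" "y \<in> {0..1}" for x y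
    using field_differentiable_bound[of "{0..1}" f f' M x y] M(2) that
      has_field_derivative_at_within[OF deriv] by auto
  have int: "(\<lambda>x. g x * f' x) integrable_on {a..b}" "continuous_on {a..b} f'" "continuous_on {a..b} g"
    if "0 \<le> a" "b \<le> 1" for a b
  proof -
    have sub: "{a..b} \<subseteq> {0..1}" using that by auto
    show "continuous_on {a..b} f'" "continuous_on {a..b} g"
      using continuous_on_subset[OF cont_f' sub] continuous_on_subset[OF cont_g sub] .
    then show "(\<lambda>x. g x * f' x) integrable_on {a..b}"
      by (intro integrable_continuous_real continuous_intros)
  qed
  have local: "\<bar>f t * (g b - g a) - (F b - F a)\<bar> \<le> 3 * M * \<eta> * (b - a)"
    if t: "a \<le> t" "t \<le> b" and ab: "0 \<le> a" "b \<le> 1" "b - a < \<delta>" for a b t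
  proof -
    have "integral {0..b} (\<lambda>x. g x * f' x) = integral {0..a} (\<lambda>x. g x * f' x) + integral {a..b} (\<lambda>x. g x * f' x)"
      using Henstock_Kurzweil_Integration.integral_combine[OF ab(1) _ int(1)[of 0 b]] t ab by simp
    moreover have "((\<lambda>x. g t * f' x) has_integral g t * (f b - f a)) {a..b}"
      using t fundamental_theorem_of_calculus[of a b f f'] has_field_derivative_at_within[OF deriv]
      by (intro has_integral_mult_right) (auto simp: has_real_derivative_iff_has_vector_derivative)
    then have "integral {a..b} (\<lambda>x. (g x - g t) * f' x) = integral {a..b} (\<lambda>x. g x * f' x) - g t * (f b - f a)"
      unfolding left_diff_distrib using int(1)[OF ab(1,2)] by (simp add: has_integral_iff Henstock_Kurzweil_Integration.integral_diff)
    moreover have "norm (integral {a..b} (\<lambda>x. (g x - g t) * f' x)) \<le> (\<eta> * M) * (b - a)"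
    proof (rule integral_bound)
      show "continuous_on {a..b} (\<lambda>x. (g x - g t) * f' x)"
        using int(2,3)[OF ab(1,2)] by (intro continuous_intros)
      fix x assume x: "x \<in> {a..b}"
      show "norm ((g x - g t) * f' x) \<le> \<eta> * M"
        unfolding real_norm_def abs_mult using x t ab close[of x t] M \<open>\<eta> > 0\<close>
        by (intro mult_mono) auto
    qed (use t in simp)
    moreover have "\<bar>(f t - f b) * (g b - g t)\<bar> \<le> (M * (b - a)) * \<eta>"
      unfolding abs_mult
    proof (rule mult_mono)
      have "\<bar>f t - f b\<bar> \<le> M * \<bar>t - b\<bar>" using t ab by (intro f_lip) auto
      also have "\<dots> \<le> M * (b - a)" using t M(1) by (intro mult_left_mono) auto
      finally show "\<bar>f t - f b\<bar> \<le> M * (b - a)" .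
      show "\<bar>g b - g t\<bar> \<le> \<eta>" using t ab close[of b t] by auto
    qed (use t M in auto)
    moreover have "\<bar>(f a - f t) * (g a - g t)\<bar> \<le> (M * (b - a)) * \<eta>"
      unfolding abs_mult
    proof (rule mult_mono)
      have "\<bar>f a - f t\<bar> \<le> M * \<bar>a - t\<bar>" using t ab by (intro f_lip) auto
      also have "\<dots> \<le> M * (b - a)" using t M(1) by (intro mult_left_mono) auto
      finally show "\<bar>f a - f t\<bar> \<le> M * (b - a)" .
      show "\<bar>g a - g t\<bar> \<le> \<eta>" using t ab close[of a t] by auto
    qed (use t M in auto)
    moreover have "f t * (g b - g a) - (F b - F a) =
       (f t - f b) * (g b - g t) + (f a - f t) * (g a - g t)
       + (integral {0..b} (\<lambda>x. g x * f' x) - integral {0..a} (\<lambda>x. g x * f' x) - g t * (f b - f a))"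
      by (simp add: F_def algebra_simps)
    ultimately have "\<bar>f t * (g b - g a) - (F b - F a)\<bar> \<le> (M * (b - a)) * \<eta> + (M * (b - a)) * \<eta> + (\<eta> * M) * (b - a)"
      unfolding real_norm_def by linarith
    then show ?thesis by (simp add: algebra_simps)
  qed
  show "\<exists>\<delta>>0. \<forall>p. p tagged_division_of {0..1} \<and> (\<forall>(t, K)\<in>p. diameter K < \<delta>) \<longrightarrow>
       \<bar>RS_sum f g p - (f 1 * g 1 - f 0 * g 0 - integral {0..1} (\<lambda>x. g x * f' x))\<bar> < \<epsilon>"
  proof (intro exI[of _ \<delta>] conjI allI impI \<delta>(1))
    fix p :: "(real \<times> real set) set" assume p: "p tagged_division_of {0..1} \<and> (\<forall>(t, K)\<in>p. diameter K < \<delta>)"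
    have "F 1 - F 0 = (\<Sum>(t, K)\<in>p. F (Sup K) - F (Inf K))"
      using additive_tagged_division_1[of 0 1 p F] p by simp
    then have "RS_sum f g p - (F 1 - F 0) = (\<Sum>(t, K)\<in>p. f t * (g (Sup K) - g (Inf K)) - (F (Sup K) - F (Inf K)))"
      unfolding RS_sum_def by (simp add: split_beta sum_subtractf)
    also have "\<bar>\<dots>\<bar> \<le> (\<Sum>(t, K)\<in>p. 3 * M * \<eta> * (Sup K - Inf K))"
    proof (rule order_trans[OF sum_abs sum_mono], safe)
      fix t K assume tK: "(t, K) \<in> p"
      then obtain a b where K: "K = {a..b}" "a \<le> t" "t \<le> b" "0 \<le> a" "b \<le> 1" "Inf K = a" "Sup K = b"
        using tagged_interval_real p by blast
      moreover have "b - a < \<delta>"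
      proof -
        have "diameter K < \<delta>" using p tK by auto
        then show ?thesis using K by simp
      qed
      ultimately show "\<bar>f t * (g (Sup K) - g (Inf K)) - (F (Sup K) - F (Inf K))\<bar> \<le> 3 * M * \<eta> * (Sup K - Inf K)"
        using local[of a t b] by simp
    qed
    also have "\<dots> = 3 * M * \<eta> * (\<Sum>(t, K)\<in>p. Sup K - Inf K)"
      by (simp add: sum_distrib_left split_beta)
    also have "(\<Sum>(t, K)\<in>p. Sup K - Inf K) = 1"
      using additive_tagged_division_1[of 0 1 p "\<lambda>x. x"] p by simp
    also have "3 * M * \<eta> * 1 < \<epsilon>" using M(1) \<open>0 < \<epsilon>\<close> by (simp add: \<eta>_def)
    finally show "\<bar>RS_sum f g p - (f 1 * g 1 - f 0 * g 0 - integral {0..1} (\<lambda>x. g x * f' x))\<bar> < \<epsilon>"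
      by (simp add: F_def algebra_simps)
  qed
qed

text \<open>
  The integrals of polynomials that converge uniformly to \<open>f\<close> form a Cauchy sequence, and its limit
  is the integral of \<open>f\<close>.  Approximation by polynomials replaces the comparison of two tagged
  divisions by a common refinement.
\<close>

lemma has_RS_integral_exists:
  assumes var: "variation_le g L" and cont_f: "continuous_on {0..1} f" and cont_g: "continuous_on {0..1} g"
  shows "\<exists>J. has_RS_integral f g J"
proof -
  have "0 \<le> L" using variation_nonneg[OF var] .
  have "\<forall>n. \<exists>q. real_polynomial_function q \<and> (\<forall>t\<in>{0..1}. \<bar>f t - q t\<bar> < inverse (real (Suc n)))"
  proof
    fix n
    have "0 < inverse (real (Suc n))" by simp
    then obtain q where "real_polynomial_function q" "\<And>t. t \<in> {0..1} \<Longrightarrow> \<bar>f t - q t\<bar> < inverse (real (Suc n))"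
      using Stone_Weierstrass_real_polynomial_function[OF compact_Icc cont_f] by blast
    then show "\<exists>q. real_polynomial_function q \<and> (\<forall>t\<in>{0..1}. \<bar>f t - q t\<bar> < inverse (real (Suc n)))" by blast
  qed
  from choice[OF this] obtain q where
    "\<forall>n. real_polynomial_function (q n) \<and> (\<forall>t\<in>{0..1}. \<bar>f t - q n t\<bar> < inverse (real (Suc n)))" ..
  then have q: "\<And>n. real_polynomial_function (q n)"
    "\<And>n t. t \<in> {0..1} \<Longrightarrow> \<bar>f t - q n t\<bar> < inverse (real (Suc n))" by blast+
  have "\<forall>n. \<exists>J. has_RS_integral (q n) g J"
  proof
    fix n
    obtain q' where q': "real_polynomial_function q'" "\<And>x. (q n has_real_derivative q' x) (at x)"
      using has_real_derivative_polynomial_function[OF q(1)[of n]] by blast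
    have "continuous_on {0..1} q'"
      by (intro continuous_at_imp_continuous_on ballI continuous_real_polymonial_function q'(1))
    from has_RS_integral_smooth[OF q'(2) this cont_g] show "\<exists>J. has_RS_integral (q n) g J" ..
  qed
  from choice[OF this] obtain J where J: "\<And>n. has_RS_integral (q n) g (J n)" by blast
  have lim: "(\<lambda>n. inverse (real (Suc n)) * L) \<longlonglongrightarrow> 0"
    using tendsto_mult_left_zero[OF LIMSEQ_inverse_real_of_nat] .
  have close: "\<bar>J m - J n\<bar> \<le> (inverse (real (Suc m)) + inverse (real (Suc n))) * L" for m n
  proof (rule has_RS_integral_close[OF var J J])
    fix t :: real assume "t \<in> {0..1}"
    from q(2)[OF this, of m] q(2)[OF this, of n] 
    show "\<bar>q m t - q n t\<bar> \<le> inverse (real (Suc m)) + inverse (real (Suc n))" by linarith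
  qed
  have "Cauchy J"
    unfolding Cauchy_def dist_real_def
  proof (intro allI impI)
    fix \<epsilon> :: real assume "0 < \<epsilon>"
    then have "\<forall>\<^sub>F n in sequentially. inverse (real (Suc n)) * L < \<epsilon> / 2"
      using lim by (intro order_tendstoD) auto
    then obtain N where N: "\<And>n. n \<ge> N \<Longrightarrow> inverse (real (Suc n)) * L < \<epsilon> / 2"
      unfolding eventually_sequentially by blast
    show "\<exists>M. \<forall>m\<ge>M. \<forall>n\<ge>M. \<bar>J m - J n\<bar> < \<epsilon>"
    proof (intro exI[of _ N] allI impI)
      fix m n assume "m \<ge> N" "n \<ge> N"
      then show "\<bar>J m - J n\<bar> < \<epsilon>" using close[of m n] N[of m] N[of n] by (simp add: distrib_right)
    qed
  qed
  then obtain J0 where J0: "J \<longlonglongrightarrow> J0" using convergent_eq_Cauchy by blast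
  have "has_RS_integral f g J0"
    unfolding has_RS_integral_iff
  proof (intro allI impI)
    fix \<epsilon> :: real assume "0 < \<epsilon>"
    then have "\<forall>\<^sub>F n in sequentially. inverse (real (Suc n)) * L < \<epsilon> / 3"
      using lim by (intro order_tendstoD) auto
    moreover have "\<forall>\<^sub>F n in sequentially. dist (J n) J0 < \<epsilon> / 3"
      using J0 \<open>0 < \<epsilon>\<close> by (intro tendstoD) auto
    ultimately have "\<forall>\<^sub>F n in sequentially. inverse (real (Suc n)) * L < \<epsilon> / 3 \<and> dist (J n) J0 < \<epsilon> / 3"
      by eventually_elim simp
    then obtain n where n: "inverse (real (Suc n)) * L < \<epsilon> / 3" "\<bar>J n - J0\<bar> < \<epsilon> / 3"
      unfolding eventually_sequentially dist_real_def by blast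
    have "0 < \<epsilon> / 3" using \<open>0 < \<epsilon>\<close> by simp
    then obtain \<delta> where \<delta>: "\<delta> > 0"
      "\<And>p. p tagged_division_of {0..1} \<Longrightarrow> (\<forall>(t, K)\<in>p. diameter K < \<delta>) \<Longrightarrow> \<bar>RS_sum (q n) g p - J n\<bar> < \<epsilon> / 3"
      using J[of n, unfolded has_RS_integral_iff, rule_format, OF \<open>0 < \<epsilon> / 3\<close>] by blast
    show "\<exists>\<delta>>0. \<forall>p. p tagged_division_of {0..1} \<and> (\<forall>(t, K)\<in>p. diameter K < \<delta>) \<longrightarrow> \<bar>RS_sum f g p - J0\<bar> < \<epsilon>"
    proof (intro exI[of _ \<delta>] conjI allI impI \<delta>(1))
      fix p :: "(real \<times> real set) set"
      assume p: "p tagged_division_of {0..1} \<and> (\<forall>(t, K)\<in>p. diameter K < \<delta>)"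
      then have "\<bar>RS_sum (q n) g p - J n\<bar> < \<epsilon> / 3" by (intro \<delta>(2)) auto
      moreover have "\<bar>RS_sum f g p - RS_sum (q n) g p\<bar> \<le> inverse (real (Suc n)) * L"
        using p q(2)[THEN less_imp_le] by (intro RS_sum_close[OF var]) auto
      ultimately show "\<bar>RS_sum f g p - J0\<bar> < \<epsilon>" using n by linarith
    qed
  qed
  then show ?thesis by blast
qed

lemma RS_sum_add: "RS_sum (\<lambda>t. f t + f' t) g p = RS_sum f g p + RS_sum f' g p"
  by (simp add: RS_sum_def split_beta distrib_right sum.distrib)

lemma RS_sum_cmult: "RS_sum (\<lambda>t. c * f t) g p = c * RS_sum f g p"
  by (simp add: RS_sum_def split_beta sum_distrib_left mult.assoc)

lemma has_RS_integral_add: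
  assumes "has_RS_integral f g J" "has_RS_integral f' g J'"
  shows "has_RS_integral (\<lambda>t. f t + f' t) g (J + J')"
  unfolding has_RS_integral_iff
proof (intro allI impI)
  fix \<epsilon> :: real assume "0 < \<epsilon>"
  then have "0 < \<epsilon> / 2" by simp
  obtain \<delta>1 where \<delta>1: "\<delta>1 > 0" "\<And>p. p tagged_division_of {0..1} \<Longrightarrow> (\<forall>(t, K)\<in>p. diameter K < \<delta>1) \<Longrightarrow> \<bar>RS_sum f g p - J\<bar> < \<epsilon> / 2"
    using assms(1)[unfolded has_RS_integral_iff, rule_format, OF \<open>0 < \<epsilon> / 2\<close>] by blast
  obtain \<delta>2 where \<delta>2: "\<delta>2 > 0" "\<And>p. p tagged_division_of {0..1} \<Longrightarrow> (\<forall>(t, K)\<in>p. diameter K < \<delta>2) \<Longrightarrow> \<bar>RS_sum f' g p - J'\<bar> < \<epsilon> / 2"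
    using assms(2)[unfolded has_RS_integral_iff, rule_format, OF \<open>0 < \<epsilon> / 2\<close>] by blast
  show "\<exists>\<delta>>0. \<forall>p. p tagged_division_of {0..1} \<and> (\<forall>(t, K)\<in>p. diameter K < \<delta>) \<longrightarrow>
      \<bar>RS_sum (\<lambda>t. f t + f' t) g p - (J + J')\<bar> < \<epsilon>"
  proof (intro exI[of _ "min \<delta>1 \<delta>2"] conjI allI impI)
    fix p :: "(real \<times> real set) set"
    assume p: "p tagged_division_of {0..1} \<and> (\<forall>(t, K)\<in>p. diameter K < min \<delta>1 \<delta>2)"
    have "\<bar>RS_sum f g p - J\<bar> < \<epsilon> / 2" using p by (intro \<delta>1(2)) auto
    moreover have "\<bar>RS_sum f' g p - J'\<bar> < \<epsilon> / 2" using p by (intro \<delta>2(2)) auto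
    ultimately show "\<bar>RS_sum (\<lambda>t. f t + f' t) g p - (J + J')\<bar> < \<epsilon>"
      unfolding RS_sum_add by linarith
  qed (use \<delta>1(1) \<delta>2(1) in auto)
qed

lemma has_RS_integral_cmult:
  assumes "has_RS_integral f g J"
  shows "has_RS_integral (\<lambda>t. c * f t) g (c * J)"
  unfolding has_RS_integral_iff
proof (intro allI impI)
  fix \<epsilon> :: real assume "0 < \<epsilon>"
  then have "0 < \<epsilon> / (\<bar>c\<bar> + 1)" by (simp add: add_nonneg_pos)
  then obtain \<delta> where \<delta>: "\<delta> > 0" "\<And>p. p tagged_division_of {0..1} \<Longrightarrow> (\<forall>(t, K)\<in>p. diameter K < \<delta>) \<Longrightarrow> \<bar>RS_sum f g p - J\<bar> < \<epsilon> / (\<bar>c\<bar> + 1)"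
    using assms[unfolded has_RS_integral_iff, rule_format, OF \<open>0 < \<epsilon> / (\<bar>c\<bar> + 1)\<close>] by blast
  show "\<exists>\<delta>>0. \<forall>p. p tagged_division_of {0..1} \<and> (\<forall>(t, K)\<in>p. diameter K < \<delta>) \<longrightarrow>
      \<bar>RS_sum (\<lambda>t. c * f t) g p - c * J\<bar> < \<epsilon>"
  proof (intro exI[of _ \<delta>] conjI allI impI \<delta>(1))
    fix p :: "(real \<times> real set) set"
    assume p: "p tagged_division_of {0..1} \<and> (\<forall>(t, K)\<in>p. diameter K < \<delta>)"
    have "\<bar>RS_sum (\<lambda>t. c * f t) g p - c * J\<bar> = \<bar>c\<bar> * \<bar>RS_sum f g p - J\<bar>"
      unfolding RS_sum_cmult right_diff_distrib[symmetric] abs_mult ..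
    also have "\<dots> \<le> \<bar>c\<bar> * (\<epsilon> / (\<bar>c\<bar> + 1))"
      using p by (intro mult_left_mono less_imp_le[OF \<delta>(2)]) auto
    also have "\<dots> < \<epsilon>" using \<open>0 < \<epsilon>\<close> by (simp add: divide_simps add_nonneg_pos)
    finally show "\<bar>RS_sum (\<lambda>t. c * f t) g p - c * J\<bar> < \<epsilon>" .
  qed
qed

lemma has_RS_integral_linear_combination:
  assumes "finite A" "\<And>r. r \<in> A \<Longrightarrow> has_RS_integral (f r) g (J r)"
  shows "has_RS_integral (\<lambda>t. \<Sum>r\<in>A. c r * f r t) g (\<Sum>r\<in>A. c r * J r)"
  using assms
proof (induction A rule: finite_induct)
  case empty
  show ?case by (auto simp: has_RS_integral_iff RS_sum_def intro: exI[of _ 1])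
next
  case (insert x A)
  then show ?case by (simp add: has_RS_integral_add has_RS_integral_cmult)
qed

lemma rectifiable_component:
  fixes g :: "real \<Rightarrow> real ^ 'k"
  assumes "rectifiable g"
  obtains L where "\<And>j. variation_le (\<lambda>t. g t $ j) L"
proof -
  obtain L where L: "\<And>d. d division_of {0..1} \<Longrightarrow> (\<Sum>K\<in>d. norm (g (Sup K) - g (Inf K))) \<le> L"
    using assms unfolding rectifiable_def by blast
  have "variation_le (\<lambda>t. g t $ j) L" for j
    unfolding variation_le_def
  proof (intro allI impI)
    fix d :: "real set set" assume "d division_of {0..1}"
    have "(\<Sum>K\<in>d. \<bar>g (Sup K) $ j - g (Inf K) $ j\<bar>) \<le> (\<Sum>K\<in>d. norm (g (Sup K) - g (Inf K)))"
      using component_le_norm_cart[of "g (Sup K) - g (Inf K)" j for K] by (intro sum_mono) simp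
    then show "(\<Sum>K\<in>d. \<bar>g (Sup K) $ j - g (Inf K) $ j\<bar>) \<le> L" using L[OF \<open>d division_of {0..1}\<close>] by linarith
  qed
  then show thesis by (rule that)
qed

lemma has_RS_integral_line_integral:
  assumes "rectifiable g" "continuous_on (path_image g) U"
  shows "has_RS_integral (\<lambda>t. U (g t)) (\<lambda>t. g t $ j) (line_integral U g j)"
proof -
  obtain L where L: "variation_le (\<lambda>t. g t $ j) L" using rectifiable_component[OF assms(1)] by blast
  have g: "continuous_on {0..1} g" using assms(1) by (simp add: rectifiable_def path_def)
  have "continuous_on {0..1} (\<lambda>t. U (g t))"
    using continuous_on_compose2[OF assms(2) g] by (simp add: path_image_def)
  moreover have "continuous_on {0..1} (\<lambda>t. g t $ j)" using g by (intro continuous_intros)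
  ultimately obtain J where J: "has_RS_integral (\<lambda>t. U (g t)) (\<lambda>t. g t $ j) J"
    using has_RS_integral_exists[OF L] by blast
  then have "line_integral U g j = J"
    unfolding line_integral_def by (rule the_equality) (rule has_RS_integral_unique[OF L _ J])
  then show ?thesis using J by simp
qed

lemma line_integral_linear_combination:
  assumes "rectifiable g" "finite A" "\<And>r. r \<in> A \<Longrightarrow> continuous_on (path_image g) (U r)"
  shows "line_integral (\<lambda>x. \<Sum>r\<in>A. c r * U r x) g j = (\<Sum>r\<in>A. c r * line_integral (U r) g j)"
proof -
  obtain L where L: "variation_le (\<lambda>t. g t $ j) L" using rectifiable_component[OF assms(1)] by blast
  show ?thesis
  proof (rule has_RS_integral_unique[OF L])
    show "has_RS_integral (\<lambda>t. \<Sum>r\<in>A. c r * U r (g t)) (\<lambda>t. g t $ j) (line_integral (\<lambda>x. \<Sum>r\<in>A. c r * U r x) g j)"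
      using assms by (intro has_RS_integral_line_integral[where U = "\<lambda>x. \<Sum>r\<in>A. c r * U r x"] continuous_intros)
    show "has_RS_integral (\<lambda>t. \<Sum>r\<in>A. c r * U r (g t)) (\<lambda>t. g t $ j) (\<Sum>r\<in>A. c r * line_integral (U r) g j)"
      using assms by (intro has_RS_integral_linear_combination has_RS_integral_line_integral)
  qed
qed

text \<open>
  The constant \<open>L\<close> depends on the curve only, so uniform convergence on the curve carries over to
  line integrals.
\<close>

lemma line_integral_close:
  fixes g :: "real \<Rightarrow> real ^ 'k"
  assumes "rectifiable g"
  obtains L where "\<And>U V \<omega> j. continuous_on (path_image g) U \<Longrightarrow> continuous_on (path_image g) V \<Longrightarrow>
     (\<And>x. x \<in> path_image g \<Longrightarrow> \<bar>U x - V x\<bar> \<le> \<omega>) \<Longrightarrow> \<bar>line_integral U g j - line_integral V g j\<bar> \<le> \<omega> * L"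
proof -
  obtain L where L: "\<And>j. variation_le (\<lambda>t. g t $ j) L" using rectifiable_component[OF assms(1)] by blast
  show thesis
  proof (rule that)
    fix U V :: "real ^ 'k \<Rightarrow> real" and \<omega> j
    assume *: "continuous_on (path_image g) U" "continuous_on (path_image g) V"
      "\<And>x. x \<in> path_image g \<Longrightarrow> \<bar>U x - V x\<bar> \<le> \<omega>"
    show "\<bar>line_integral U g j - line_integral V g j\<bar> \<le> \<omega> * L"
      by (rule has_RS_integral_close[OF L has_RS_integral_line_integral[OF assms *(1)] has_RS_integral_line_integral[OF assms *(2)]])
        (rule *(3), simp add: path_image_def)
  qed
qed


section \<open>Closed plane forms whose coefficients are merely differentiable in each variable\<close>

text \<open>
  The integral of \<open>u ds + v dt\<close> along the boundary of \<open>[a, b] \<times> [c, d]\<close>, traversed counterclockwise.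
\<close>

definition circulation ::
    "(real \<Rightarrow> real \<Rightarrow> real) \<Rightarrow> (real \<Rightarrow> real \<Rightarrow> real) \<Rightarrow> real \<Rightarrow> real \<Rightarrow> real \<Rightarrow> real \<Rightarrow> real"
  where "circulation u v a b c d =
    integral {a..b} (\<lambda>s. u s c - u s d) + integral {c..d} (\<lambda>t. v b t - v a t)"

text \<open>
  Reflection in the diagonal reverses the orientation.  Through it, facts about the second coordinate
  follow from those about the first.
\<close>

lemma circulation_transpose:
  "circulation (\<lambda>s t. v t s) (\<lambda>s t. u t s) c d a b = - circulation u v a b c d"
proof -
  have "integral {c..d} (\<lambda>s. v a s - v b s) = - integral {c..d} (\<lambda>s. v b s - v a s)"
    unfolding integral_neg[symmetric] by (simp add: algebra_simps)
  moreover have "integral {a..b} (\<lambda>s. u s d - u s c) = - integral {a..b} (\<lambda>s. u s c - u s d)"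
    unfolding integral_neg[symmetric] by (simp add: algebra_simps)
  ultimately show ?thesis by (simp add: circulation_def)
qed

context
  fixes u v :: "real \<Rightarrow> real \<Rightarrow> real"
  assumes cont_u: "continuous_on UNIV (\<lambda>(s, t). u s t)"
    and cont_v: "continuous_on UNIV (\<lambda>(s, t). v s t)"
begin

lemma continuous_on_u:
  assumes "continuous_on S f" "continuous_on S g"
  shows "continuous_on S (\<lambda>x. u (f x) (g x))"
  using continuous_on_compose2[OF cont_u continuous_on_Pair[OF assms]] by simp

lemma continuous_on_v:
  assumes "continuous_on S f" "continuous_on S g"
  shows "continuous_on S (\<lambda>x. v (f x) (g x))"
  using continuous_on_compose2[OF cont_v continuous_on_Pair[OF assms]] by simp

lemma integrable_u_diff: "(\<lambda>s. u s c - u s d) integrable_on {a..b}"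
  by (intro integrable_continuous_real continuous_intros continuous_on_u continuous_on_v)

lemma integrable_v_diff: "(\<lambda>t. v b t - v a t) integrable_on {c..d}"
  by (intro integrable_continuous_real continuous_intros continuous_on_u continuous_on_v)

lemma circulation_split_horizontal:
  assumes "a \<le> x" "x \<le> b"
  shows "circulation u v a b c d = circulation u v a x c d + circulation u v x b c d"
proof -
  have "integral {a..b} (\<lambda>s. u s c - u s d) =
      integral {a..x} (\<lambda>s. u s c - u s d) + integral {x..b} (\<lambda>s. u s c - u s d)"
    using Henstock_Kurzweil_Integration.integral_combine[OF assms integrable_u_diff] by simp
  moreover have "integral {c..d} (\<lambda>t. v b t - v a t) =
      integral {c..d} (\<lambda>t. v x t - v a t) + integral {c..d} (\<lambda>t. v b t - v x t)"
    by (subst integral_add[symmetric]) (auto intro: integrable_v_diff)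
  ultimately show ?thesis by (simp add: circulation_def)
qed

lemma circulation_degenerate: "circulation u v a a c d = 0"
  by (simp add: circulation_def)

lemma continuous_on_circulation: "continuous_on {a..b} (\<lambda>x. circulation u v a x c d)"
  unfolding circulation_def
proof (rule continuous_on_add)
  show "continuous_on {a..b} (\<lambda>x. integral {a..x} (\<lambda>s. u s c - u s d))"
    by (rule indefinite_integral_continuous_1[OF integrable_u_diff])
  have "continuous_on {a..b} (\<lambda>x. integral (cbox c d) (\<lambda>t. v x t - v a t))"
    by (rule integral_continuous_on_param) (auto simp: split_beta intro!: continuous_intros continuous_on_v)
  then show "continuous_on {a..b} (\<lambda>x. integral {c..d} (\<lambda>t. v x t - v a t))"
    by simp
qed

lemma circulation_le_horizontal:
  assumes "a \<le> x" "x \<le> b"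
    and "\<bar>circulation u v a x c d\<bar> \<le> \<epsilon> * ((x - a) * (d - c))"
    and "\<bar>circulation u v x b c d\<bar> \<le> \<epsilon> * ((b - x) * (d - c))"
  shows "\<bar>circulation u v a b c d\<bar> \<le> \<epsilon> * ((b - a) * (d - c))"
proof -
  have "\<epsilon> * ((b - a) * (d - c)) = \<epsilon> * ((x - a) * (d - c)) + \<epsilon> * ((b - x) * (d - c))"
    by (simp add: algebra_simps)
  then show ?thesis
    using assms circulation_split_horizontal[of a x b c d] by linarith
qed

lemma circulation_pieces:
  fixes k :: nat and a h :: real
  assumes "0 \<le> h" 
    and "\<And>i. i < k \<Longrightarrow> \<bar>circulation u v (a + i * h) (a + (real i + 1) * h) c d\<bar> \<le> \<epsilon> * (h * (d - c))"
  shows "\<bar>circulation u v a (a + k * h) c d\<bar> \<le> \<epsilon> * (k * h * (d - c))"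
  using assms(2)
proof (induction k)
  case 0
  then show ?case by (simp add: circulation_degenerate)
next
  case (Suc k)
  have le: "a \<le> a + k * h" "a + k * h \<le> a + (real k + 1) * h"
    using assms(1) by (auto simp: algebra_simps)
  show ?case
    using circulation_le_horizontal[OF le, of c d \<epsilon>] Suc.IH Suc.prems(1)[of k] Suc.prems
    by (force simp: algebra_simps)
qed

text \<open>
  A wide rectangle is cut into \<open>\<lfloor>q\<rfloor>\<close> equal pieces, where \<open>q\<close> is the ratio of its sides; then the pieces
  have side ratios between 1 and 2.
\<close>

lemma circulation_le_wide:
  assumes "c < d" "d - c \<le> b - a"
    and piece: "\<And>x y. a \<le> x \<Longrightarrow> y \<le> b \<Longrightarrow> d - c \<le> y - x \<Longrightarrow> y - x \<le> 2 * (d - c) \<Longrightarrow>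
      \<bar>circulation u v x y c d\<bar> \<le> \<kappa> * ((y - x) * (d - c))"
  shows "\<bar>circulation u v a b c d\<bar> \<le> \<kappa> * ((b - a) * (d - c))"
proof -
  \<comment> \<open>\<open>q\<close> is at least 1, so \<open>k \<le> q < 2 * k\<close>.\<close>
  define q where "q = (b - a) / (d - c)"
  define k where "k = nat \<lfloor>q\<rfloor>"
  define h where "h = (b - a) / k"
  have q: "1 \<le> q" using assms by (simp add: q_def)
  then have k: "1 \<le> k" "real k \<le> q" "q < real k + 1" unfolding k_def by linarith+
  have ba: "b - a = q * (d - c)" using assms by (simp add: q_def)
  have kh: "k * h = b - a" using k by (simp add: h_def)
  have h1: "d - c \<le> h"
    using k assms mult_right_mono[of "real k" q "d - c"] by (simp add: h_def ba pos_le_divide_eq mult.commute)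
  have "q * (d - c) \<le> (2 * real k) * (d - c)"
    using k assms by (intro mult_right_mono) auto
  then have h2: "h \<le> 2 * (d - c)"
    unfolding h_def ba using k by (subst pos_divide_le_eq) (auto simp: mult_ac)
  have "\<bar>circulation u v a (a + k * h) c d\<bar> \<le> \<kappa> * (k * h * (d - c))"
  proof (rule circulation_pieces)
    show "0 \<le> h" using h1 assms by simp
    fix i assume i: "i < k"
    then have "(real i + 1) * h \<le> k * h" using h1 assms by (intro mult_right_mono) auto
    then have "a + (real i + 1) * h \<le> b" using kh by simp
    moreover have "a + (real i + 1) * h - (a + i * h) = h" by (simp add: algebra_simps)
    ultimately show "\<bar>circulation u v (a + i * h) (a + (real i + 1) * h) c d\<bar> \<le> \<kappa> * (h * (d - c))"
      using piece[of "a + i * h" "a + (real i + 1) * h"] h1 h2 assms(1) by simp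
  qed
  then show ?thesis by (simp add: kh)
qed

text \<open>
  The circulation depends continuously on the rectangle.  Hence a bound by the area extends to a
  rectangle of which only one side meets an exceptional set.
\<close>

lemma circulation_le_limit_left:
  assumes "a < b" and "\<And>x. a < x \<Longrightarrow> x < b \<Longrightarrow> \<bar>circulation u v a x c d\<bar> \<le> \<epsilon> * ((x - a) * (d - c))"
  shows "\<bar>circulation u v a b c d\<bar> \<le> \<epsilon> * ((b - a) * (d - c))"
proof -
  have cl: "closure {a<..<b} = {a..b}" using assms(1) by simp
  have "0 \<le> \<epsilon> * ((b - a) * (d - c)) - \<bar>circulation u v a b c d\<bar>"
  proof (rule continuous_ge_on_closure[of "{a<..<b}" "\<lambda>x. \<epsilon> * ((x - a) * (d - c)) - \<bar>circulation u v a x c d\<bar>"])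
    show "continuous_on (closure {a<..<b}) (\<lambda>x. \<epsilon> * ((x - a) * (d - c)) - \<bar>circulation u v a x c d\<bar>)"
      unfolding cl by (intro continuous_intros continuous_on_circulation)
  qed (use assms cl in auto)
  then show ?thesis by simp
qed

lemma circulation_le_limit_right:
  assumes "a < b" and "\<And>x. a < x \<Longrightarrow> x < b \<Longrightarrow> \<bar>circulation u v x b c d\<bar> \<le> \<epsilon> * ((b - x) * (d - c))"
  shows "\<bar>circulation u v a b c d\<bar> \<le> \<epsilon> * ((b - a) * (d - c))"
proof -
  have cl: "closure {a<..<b} = {a..b}" using assms(1) by simp
  have "0 \<le> \<epsilon> * ((b - a) * (d - c)) - \<bar>circulation u v a b c d - circulation u v a a c d\<bar>"
  proof (rule continuous_ge_on_closure[of "{a<..<b}"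
        "\<lambda>x. \<epsilon> * ((b - x) * (d - c)) - \<bar>circulation u v a b c d - circulation u v a x c d\<bar>"])
    show "continuous_on (closure {a<..<b})
        (\<lambda>x. \<epsilon> * ((b - x) * (d - c)) - \<bar>circulation u v a b c d - circulation u v a x c d\<bar>)"
      unfolding cl by (intro continuous_intros continuous_on_circulation)
    show "0 \<le> \<epsilon> * ((b - x) * (d - c)) - \<bar>circulation u v a b c d - circulation u v a x c d\<bar>"
      if "x \<in> {a<..<b}" for x
      using that assms(2)[of x] circulation_split_horizontal[of a x b c d] by auto
  qed (use assms cl in auto)
  then show ?thesis by (simp add: circulation_degenerate)
qed

end

text \<open>
  The context is left and entered again whenever its lemmas are to be applied to the transposed form.
\<close>

context
  fixes u v :: "real \<Rightarrow> real \<Rightarrow> real"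
  assumes cont_u: "continuous_on UNIV (\<lambda>(s, t). u s t)"
    and cont_v: "continuous_on UNIV (\<lambda>(s, t). v s t)"
begin

lemma cont_transpose:
  "continuous_on UNIV (\<lambda>(s, t). v t s)" "continuous_on UNIV (\<lambda>(s, t). u t s)"
  using continuous_on_v[OF cont_u cont_v continuous_on_snd[OF continuous_on_id] continuous_on_fst[OF continuous_on_id]]
    continuous_on_u[OF cont_u cont_v continuous_on_snd[OF continuous_on_id] continuous_on_fst[OF continuous_on_id]]
  by (auto simp: split_beta)

lemma circulation_split_vertical:
  assumes "c \<le> y" "y \<le> d"
  shows "circulation u v a b c d = circulation u v a b c y + circulation u v a b y d"
  using circulation_split_horizontal[OF cont_transpose assms, of a b]
  by (simp add: circulation_transpose[of v u])

lemma circulation_le_vertical: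
  assumes "c \<le> y" "y \<le> d"
    and "\<bar>circulation u v a b c y\<bar> \<le> \<epsilon> * ((b - a) * (y - c))"
    and "\<bar>circulation u v a b y d\<bar> \<le> \<epsilon> * ((b - a) * (d - y))"
  shows "\<bar>circulation u v a b c d\<bar> \<le> \<epsilon> * ((b - a) * (d - c))"
  using circulation_le_horizontal[OF cont_transpose assms(1,2), of a b \<epsilon>] assms(3,4)
  by (simp add: circulation_transpose[of v u] mult.commute)

text \<open>
  A bound by the area survives the gluing of adjacent rectangles, so it is a local matter.  The
  compactness argument is Bolzano's bisection, run first along the vertical line over each \<open>s\<close>, to get a
  width \<open>\<delta>\<close> that serves for the whole line, and then along the first coordinate.
\<close>

lemma circulation_le_local:
  assumes "a \<le> b" "c \<le> d"
    and local: "\<And>z. z \<in> {a..b} \<times> {c..d} \<Longrightarrow> \<exists>X. open X \<and> z \<in> X \<and>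
      (\<forall>a' b' c' d'. a' \<le> b' \<longrightarrow> c' \<le> d' \<longrightarrow> {a'..b'} \<times> {c'..d'} \<subseteq> X \<inter> {a..b} \<times> {c..d} \<longrightarrow>
         \<bar>circulation u v a' b' c' d'\<bar> \<le> \<epsilon> * ((b' - a') * (d' - c')))"
  shows "\<bar>circulation u v a b c d\<bar> \<le> \<epsilon> * ((b - a) * (d - c))"
proof -
  define P where "P a' b' c' d' \<longleftrightarrow> (a \<le> a' \<and> a' \<le> b' \<and> b' \<le> b \<and> c \<le> c' \<and> c' \<le> d' \<and> d' \<le> d \<longrightarrow>
      \<bar>circulation u v a' b' c' d'\<bar> \<le> \<epsilon> * ((b' - a') * (d' - c')))" for a' b' c' d'
  have column: "\<exists>\<delta>>0. \<forall>a' b'. a' \<le> s \<and> s \<le> b' \<and> b' - a' < \<delta> \<longrightarrow> P a' b' c d"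
    if s: "a \<le> s" "s \<le> b" for s
    using \<open>c \<le> d\<close>
  proof (induction c d rule: Bolzano)
    case (trans x y z)
    then obtain \<delta>1 \<delta>2 where \<delta>: "\<delta>1 > 0" "\<delta>2 > 0"
      "\<And>a' b'. a' \<le> s \<Longrightarrow> s \<le> b' \<Longrightarrow> b' - a' < \<delta>1 \<Longrightarrow> P a' b' x y"
      "\<And>a' b'. a' \<le> s \<Longrightarrow> s \<le> b' \<Longrightarrow> b' - a' < \<delta>2 \<Longrightarrow> P a' b' y z" by blast
    have "P a' b' x z" if "a' \<le> s" "s \<le> b'" "b' - a' < min \<delta>1 \<delta>2" for a' b'
    proof -
      have "P a' b' x y" "P a' b' y z" using \<delta>(3,4) that by auto
      then show ?thesis 
        unfolding P_def using circulation_le_vertical[OF trans(3,4), of a' b' \<epsilon>] trans(3,4) by auto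
    qed
    then show ?case using \<delta>(1,2) by (intro exI[of _ "min \<delta>1 \<delta>2"]) auto
  next
    case (local t)
    obtain X where X: "open X" "(s, t) \<in> X"
      "\<And>a' b' c' d'. a' \<le> b' \<Longrightarrow> c' \<le> d' \<Longrightarrow> {a'..b'} \<times> {c'..d'} \<subseteq> X \<inter> {a..b} \<times> {c..d} \<Longrightarrow>
         \<bar>circulation u v a' b' c' d'\<bar> \<le> \<epsilon> * ((b' - a') * (d' - c'))"
      using assms(3)[of "(s, t)"] s local by auto
    obtain A B where AB: "open A" "open B" "s \<in> A" "t \<in> B" "A \<times> B \<subseteq> X"
      using open_prod_elim[OF X(1,2)] by (metis mem_Sigma_iff)
    obtain r1 where r1: "r1 > 0" "\<And>x. \<bar>x - s\<bar> < r1 \<Longrightarrow> x \<in> A"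
      using AB(1,3) unfolding open_dist by (auto simp: dist_real_def)
    obtain r2 where r2: "r2 > 0" "\<And>x. \<bar>x - t\<bar> < r2 \<Longrightarrow> x \<in> B"
      using AB(2,4) unfolding open_dist by (auto simp: dist_real_def)
    have "P a' b' c' d'" if "a' \<le> s \<and> s \<le> b' \<and> b' - a' < r1" "c' \<le> t \<and> t \<le> d' \<and> d' - c' < r2" for a' b' c' d'
      unfolding P_def
    proof
      assume in_rect: "a \<le> a' \<and> a' \<le> b' \<and> b' \<le> b \<and> c \<le> c' \<and> c' \<le> d' \<and> d' \<le> d"
      have "{a'..b'} \<subseteq> A" "{c'..d'} \<subseteq> B" using that r1(2) r2(2) by (auto simp: subset_iff)
      then show "\<bar>circulation u v a' b' c' d'\<bar> \<le> \<epsilon> * ((b' - a') * (d' - c'))"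
        using in_rect AB(5) by (intro X(3)) auto
    qed
    then show ?case using r1(1) r2(1) by (intro exI[of _ r2]) blast
  qed
  have "P a b c d"
    using \<open>a \<le> b\<close>
  proof (induction a b rule: Bolzano)
    case (trans x y z)
    then show ?case 
      unfolding P_def using circulation_le_horizontal[OF cont_u cont_v trans(3,4), of c d \<epsilon>] trans(3,4) by auto
  next
    case (local s)
    then show ?case using column[of s] by auto
  qed
  then show ?thesis using assms(1,2) by (auto simp: P_def)
qed

lemma circulation_degenerate_vertical: "circulation u v a b c c = 0"
  using circulation_degenerate[OF cont_transpose, of c a b] circulation_transpose[of v u c c a b] by simp

lemma circulation_le_limit_below:
  assumes "c < d" and "\<And>y. c < y \<Longrightarrow> y < d \<Longrightarrow> \<bar>circulation u v a b c y\<bar> \<le> \<epsilon> * ((b - a) * (y - c))"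
  shows "\<bar>circulation u v a b c d\<bar> \<le> \<epsilon> * ((b - a) * (d - c))"
  using circulation_le_limit_left[OF cont_transpose assms(1), of a b \<epsilon>] assms(2)
  by (simp add: circulation_transpose[of v u] mult.commute)

lemma circulation_le_limit_above:
  assumes "c < d" and "\<And>y. c < y \<Longrightarrow> y < d \<Longrightarrow> \<bar>circulation u v a b y d\<bar> \<le> \<epsilon> * ((b - a) * (d - y))"
  shows "\<bar>circulation u v a b c d\<bar> \<le> \<epsilon> * ((b - a) * (d - c))"
  using circulation_le_limit_right[OF cont_transpose assms(1), of a b \<epsilon>] assms(2)
  by (simp add: circulation_transpose[of v u] mult.commute)

text \<open>
  Every rectangle is made of near-squares, whose squared perimeter is comparable to their area.  This
  comparison is what turns estimates by lengths into estimates by the area.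
\<close>

lemma circulation_le_of_near_squares:
  assumes near: "\<And>a b c d. a < b \<Longrightarrow> c < d \<Longrightarrow> b - a \<le> 2 * (d - c) \<Longrightarrow> d - c \<le> 2 * (b - a) \<Longrightarrow>
      {a..b} \<times> {c..d} \<subseteq> B \<Longrightarrow> \<bar>circulation u v a b c d\<bar> \<le> \<kappa> * ((b - a) * (d - c))"
    and rect: "a \<le> b" "c \<le> d" "{a..b} \<times> {c..d} \<subseteq> B"
  shows "\<bar>circulation u v a b c d\<bar> \<le> \<kappa> * ((b - a) * (d - c))"
proof -
  consider "a = b" | "c = d" | "a < b" "c < d" "d - c \<le> b - a" | "a < b" "c < d" "b - a \<le> d - c"
    using rect by linarith
  then show ?thesis
  proof cases
    case 1
    then show ?thesis by (simp add: circulation_degenerate[OF cont_u cont_v])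
  next
    case 2
    then show ?thesis by (simp add: circulation_degenerate_vertical)
  next
    case 3
    show ?thesis
    proof (rule circulation_le_wide[OF cont_u cont_v 3(2,3)])
      fix x y assume "a \<le> x" "y \<le> b" "d - c \<le> y - x" "y - x \<le> 2 * (d - c)"
      then show "\<bar>circulation u v x y c d\<bar> \<le> \<kappa> * ((y - x) * (d - c))"
        using 3 rect(3) by (intro near) auto
    qed
  next
    case 4
    have "\<bar>circulation (\<lambda>s t. v t s) (\<lambda>s t. u t s) c d a b\<bar> \<le> \<kappa> * ((d - c) * (b - a))"
    proof (rule circulation_le_wide[OF cont_transpose 4(1,3)])
      fix x y assume xy: "c \<le> x" "y \<le> d" "b - a \<le> y - x" "y - x \<le> 2 * (b - a)"
      have "\<bar>circulation u v a b x y\<bar> \<le> \<kappa> * ((b - a) * (y - x))"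
        using 4 rect(3) xy by (intro near) auto
      then show "\<bar>circulation (\<lambda>s t. v t s) (\<lambda>s t. u t s) x y a b\<bar> \<le> \<kappa> * ((y - x) * (b - a))"
        by (simp add: circulation_transpose[of v u] mult.commute)
    qed
    then show ?thesis by (simp add: circulation_transpose[of v u] mult.commute)
  qed
qed

text \<open>
  The points \<open>(s, c)\<close> and \<open>(s, d)\<close> are joined along the bottom side, the left side and the top side,
  passing through \<open>(xc, c)\<close>, \<open>(a, ya)\<close> and \<open>(xd, d)\<close>; increments of \<open>u\<close> are controlled only from these
  three points.  The increments \<open>p1\<close> along bottom and top cancel.
\<close>

lemma horizontal_estimate:
  fixes s xc xd ya a b c d p1 p2 \<kappa> :: real
  assumes s: "s \<in> {a..b}" and x: "xc \<in> {a..b}" "xd \<in> {a..b}" and y: "ya \<in> {c..d}"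
    and C: "\<And>s. s \<in> {a..b} \<Longrightarrow> \<bar>u s c - u xc c - (s - xc) * p1\<bar> \<le> \<kappa> * \<bar>s - xc\<bar>"
    and D: "\<And>s. s \<in> {a..b} \<Longrightarrow> \<bar>u s d - u xd d - (s - xd) * p1\<bar> \<le> \<kappa> * \<bar>s - xd\<bar>"
    and A: "\<And>t. t \<in> {c..d} \<Longrightarrow> \<bar>u a t - u a ya - (t - ya) * p2\<bar> \<le> \<kappa> * \<bar>t - ya\<bar>"
    and "0 \<le> \<kappa>"
  shows "\<bar>u s c - u s d + p2 * (d - c)\<bar> \<le> \<kappa> * (4 * (b - a) + (d - c))"
proof -
  have bound: "\<kappa> * \<bar>z - w\<bar> \<le> \<kappa> * (b - a)" if "z \<in> {a..b}" "w \<in> {a..b}" for z w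
    using that \<open>0 \<le> \<kappa>\<close> by (intro mult_left_mono) auto
  have ab: "a \<in> {a..b}" and cd: "c \<in> {c..d}" "d \<in> {c..d}" using s y by auto
  have sum: "\<kappa> * \<bar>c - ya\<bar> + \<kappa> * \<bar>d - ya\<bar> = \<kappa> * (d - c)"
    using y by (simp add: abs_if algebra_simps)
  have id: "u s c - u s d + p2 * (d - c) =
      (u s c - u xc c - (s - xc) * p1) - (u a c - u xc c - (a - xc) * p1)
      + (u a c - u a ya - (c - ya) * p2) - (u a d - u a ya - (d - ya) * p2)
      + (u a d - u xd d - (a - xd) * p1) - (u s d - u xd d - (s - xd) * p1)"
    by (simp add: algebra_simps)
  have triangle: "\<bar>x1 - x2 + x3 - x4 + x5 - x6\<bar> \<le> 4 * K + (k3 + k4)"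
    if "\<bar>x1\<bar> \<le> K" "\<bar>x2\<bar> \<le> K" "\<bar>x3\<bar> \<le> k3" "\<bar>x4\<bar> \<le> k4" "\<bar>x5\<bar> \<le> K" "\<bar>x6\<bar> \<le> K"
    for x1 x2 x3 x4 x5 x6 K k3 k4 :: real
    using that unfolding abs_le_iff by linarith
  have "\<bar>u s c - u s d + p2 * (d - c)\<bar> \<le> 4 * (\<kappa> * (b - a)) + (\<kappa> * \<bar>c - ya\<bar> + \<kappa> * \<bar>d - ya\<bar>)"
    unfolding id
    by (intro triangle order_trans[OF C bound] order_trans[OF D bound] A s ab cd x)
  then show ?thesis unfolding sum by (simp add: algebra_simps)
qed

lemma circulation_horizontal_part:
  assumes "a \<le> b" and "\<And>s. s \<in> {a..b} \<Longrightarrow> \<bar>u s c - u s d + k\<bar> \<le> M"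
  shows "\<bar>integral {a..b} (\<lambda>s. u s c - u s d) + k * (b - a)\<bar> \<le> M * (b - a)"
proof -
  have "integral {a..b} (\<lambda>s. u s c - u s d + k) = integral {a..b} (\<lambda>s. u s c - u s d) + k * (b - a)"
    using assms(1) by (subst integral_add) (auto intro: integrable_u_diff[OF cont_u cont_v])
  moreover have "norm (integral {a..b} (\<lambda>s. u s c - u s d + k)) \<le> M * (b - a)"
    using assms by (intro integral_bound continuous_intros continuous_on_u[OF cont_u cont_v]) auto
  ultimately show ?thesis by simp
qed

end

text \<open>
  For \<open>A / B\<close> between 1/2 and 2 one has \<open>2 * (A\<^sup>2 + B\<^sup>2) \<le> 5 * (A * B)\<close>, by expanding
  \<open>0 \<le> (2 * B - A) * (2 * A - B)\<close>.
\<close>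

lemma near_square_area:
  fixes A B \<alpha> \<beta> \<kappa> :: real
  assumes "0 \<le> \<alpha>" "\<alpha> \<le> A" "0 \<le> \<beta>" "\<beta> \<le> B" "A \<le> 2 * B" "B \<le> 2 * A" "0 \<le> \<kappa>"
  shows "\<kappa> * (\<alpha> * \<beta>) + \<kappa> * (4 * \<alpha> + \<beta>) * \<alpha> + \<kappa> * (4 * \<beta> + \<alpha>) * \<beta> \<le> 18 * \<kappa> * (A * B)"
proof -
  have "0 \<le> (2 * B - A) * (2 * A - B)" using assms by simp
  moreover have "\<alpha>\<^sup>2 \<le> A\<^sup>2" "\<beta>\<^sup>2 \<le> B\<^sup>2" using assms by (auto intro: power_mono)
  moreover have "\<alpha> * \<beta> \<le> A * B" "0 \<le> A * B" using assms by (auto intro: mult_mono)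
  ultimately have "3 * (\<alpha> * \<beta>) + 4 * \<alpha>\<^sup>2 + 4 * \<beta>\<^sup>2 \<le> 18 * (A * B)"
    by (simp add: algebra_simps power2_eq_square)
  then have "\<kappa> * (3 * (\<alpha> * \<beta>) + 4 * \<alpha>\<^sup>2 + 4 * \<beta>\<^sup>2) \<le> \<kappa> * (18 * (A * B))"
    using assms by (intro mult_left_mono)
  then show ?thesis by (simp add: algebra_simps power2_eq_square)
qed

context
  fixes u v :: "real \<Rightarrow> real \<Rightarrow> real"
  assumes cont_u: "continuous_on UNIV (\<lambda>(s, t). u s t)"
    and cont_v: "continuous_on UNIV (\<lambda>(s, t). v s t)"
begin

text \<open>
  Suppose that, along the lines parallel to the axes through each point of \<open>T\<close>, the increments of the
  form differ from those of an affine form by at most \<open>\<kappa>\<close> times the distance.  If \<open>T\<close> touches all four sides, any two boundary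
  points are linked by a short path of such lines, so the form is nearly affine on the whole boundary.
  The affine form contributes \<open>r1 - p2\<close> times the area.  The rectangle may be thin, so
  the error is measured by the area of a surrounding near-square.
\<close>

lemma circulation_almost_affine:
  fixes a b c d p1 p2 r1 r2 \<kappa> :: real
  assumes "a \<le> b" "c \<le> d" "0 \<le> \<kappa>" "\<bar>r1 - p2\<bar> \<le> \<kappa>"
    and size: "b - a \<le> A" "d - c \<le> B" "A \<le> 2 * B" "B \<le> 2 * A"
    and on_sides: "(a, ya) \<in> T" "(b, yb) \<in> T" "(xc, c) \<in> T" "(xd, d) \<in> T"
      "ya \<in> {c..d}" "yb \<in> {c..d}" "xc \<in> {a..b}" "xd \<in> {a..b}"
    and u1: "\<And>s t s'. (s, t) \<in> T \<Longrightarrow> s \<in> {a..b} \<Longrightarrow> s' \<in> {a..b} \<Longrightarrow> \<bar>u s' t - u s t - (s' - s) * p1\<bar> \<le> \<kappa> * \<bar>s' - s\<bar>"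
    and u2: "\<And>s t t'. (s, t) \<in> T \<Longrightarrow> t \<in> {c..d} \<Longrightarrow> t' \<in> {c..d} \<Longrightarrow> \<bar>u s t' - u s t - (t' - t) * p2\<bar> \<le> \<kappa> * \<bar>t' - t\<bar>"
    and v1: "\<And>s t s'. (s, t) \<in> T \<Longrightarrow> s \<in> {a..b} \<Longrightarrow> s' \<in> {a..b} \<Longrightarrow> \<bar>v s' t - v s t - (s' - s) * r1\<bar> \<le> \<kappa> * \<bar>s' - s\<bar>"
    and v2: "\<And>s t t'. (s, t) \<in> T \<Longrightarrow> t \<in> {c..d} \<Longrightarrow> t' \<in> {c..d} \<Longrightarrow> \<bar>v s t' - v s t - (t' - t) * r2\<bar> \<le> \<kappa> * \<bar>t' - t\<bar>"
  shows "\<bar>circulation u v a b c d\<bar> \<le> 18 * \<kappa> * (A * B)"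
proof -
  have ab: "a \<in> {a..b}" "b \<in> {a..b}" "c \<in> {c..d}" "d \<in> {c..d}" using assms by auto
  have "\<bar>u s c - u s d + p2 * (d - c)\<bar> \<le> \<kappa> * (4 * (b - a) + (d - c))" if "s \<in> {a..b}" for s
    using horizontal_estimate[OF cont_u cont_v that on_sides(7,8,5)
        u1[OF on_sides(3,7)] u1[OF on_sides(4,8)] u2[OF on_sides(1,5)] \<open>0 \<le> \<kappa>\<close>] .
  then have 1: "\<bar>integral {a..b} (\<lambda>s. u s c - u s d) + p2 * (d - c) * (b - a)\<bar>
      \<le> \<kappa> * (4 * (b - a) + (d - c)) * (b - a)"
    using circulation_horizontal_part[OF cont_u cont_v \<open>a \<le> b\<close>] by blast
  have "\<bar>v a t - v b t + r1 * (b - a)\<bar> \<le> \<kappa> * (4 * (d - c) + (b - a))" if "t \<in> {c..d}" for t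
    using horizontal_estimate[OF cont_transpose[OF cont_u cont_v] that on_sides(5,6,7)
        v2[OF on_sides(1,5)] v2[OF on_sides(2,6)] v1[OF on_sides(3,7)] \<open>0 \<le> \<kappa>\<close>] .
  then have "\<bar>integral {c..d} (\<lambda>t. v a t - v b t) + r1 * (b - a) * (d - c)\<bar>
      \<le> \<kappa> * (4 * (d - c) + (b - a)) * (d - c)"
    using circulation_horizontal_part[OF cont_transpose[OF cont_u cont_v] \<open>c \<le> d\<close>] by blast
  moreover have "integral {c..d} (\<lambda>t. v a t - v b t) = - integral {c..d} (\<lambda>t. v b t - v a t)"
    unfolding integral_neg[symmetric] by (simp add: algebra_simps)
  ultimately have 2: "\<bar>integral {c..d} (\<lambda>t. v b t - v a t) - r1 * (b - a) * (d - c)\<bar>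
      \<le> \<kappa> * (4 * (d - c) + (b - a)) * (d - c)"
    by linarith
  have "\<bar>(r1 - p2) * ((b - a) * (d - c))\<bar> \<le> \<kappa> * ((b - a) * (d - c))"
    using assms unfolding abs_mult by (auto intro!: mult_mono)
  moreover have "(r1 - p2) * ((b - a) * (d - c)) = r1 * (b - a) * (d - c) - p2 * (d - c) * (b - a)"
    by (simp add: algebra_simps)
  ultimately have "\<bar>circulation u v a b c d\<bar> \<le> \<kappa> * ((b - a) * (d - c))
      + \<kappa> * (4 * (b - a) + (d - c)) * (b - a) + \<kappa> * (4 * (d - c) + (b - a)) * (d - c)"
    using 1 2 unfolding circulation_def by linarith
  also have "\<dots> \<le> 18 * \<kappa> * (A * B)"
    using assms by (intro near_square_area) auto
  finally show ?thesis .
qed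

text \<open>
  The complement of the inner rectangle is cut into two strips of full height, on its left and right,
  and two of its own width, below and above it.  The bounds are required only for rectangles that stay away
  from the inner one, because those are the ones that avoid the exceptional set.
\<close>

lemma circulation_frame:
  assumes x: "A \<le> a" "a \<le> b" "b \<le> A'" and y: "C \<le> c" "c \<le> d" "d \<le> C'"
    and left: "\<And>x. A < x \<Longrightarrow> x < a \<Longrightarrow> \<bar>circulation u v A x C C'\<bar> \<le> \<epsilon> * ((x - A) * (C' - C))"
    and right: "\<And>x. b < x \<Longrightarrow> x < A' \<Longrightarrow> \<bar>circulation u v x A' C C'\<bar> \<le> \<epsilon> * ((A' - x) * (C' - C))"
    and below: "\<And>y. C < y \<Longrightarrow> y < c \<Longrightarrow> \<bar>circulation u v a b C y\<bar> \<le> \<epsilon> * ((b - a) * (y - C))"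
    and above: "\<And>y. d < y \<Longrightarrow> y < C' \<Longrightarrow> \<bar>circulation u v a b y C'\<bar> \<le> \<epsilon> * ((b - a) * (C' - y))"
  shows "\<bar>circulation u v A A' C C'\<bar> \<le>
    \<bar>circulation u v a b c d\<bar> + \<epsilon> * ((A' - A) * (C' - C) - (b - a) * (d - c))"
proof -
  note cont = cont_u cont_v
  have 1: "\<bar>circulation u v A a C C'\<bar> \<le> \<epsilon> * ((a - A) * (C' - C))"
    using circulation_le_limit_left[OF cont _ left] circulation_degenerate[OF cont] x by (cases "A = a") auto
  have 2: "\<bar>circulation u v b A' C C'\<bar> \<le> \<epsilon> * ((A' - b) * (C' - C))"
    using circulation_le_limit_right[OF cont _ right] circulation_degenerate[OF cont] x by (cases "A' = b") auto
  have 3: "\<bar>circulation u v a b C c\<bar> \<le> \<epsilon> * ((b - a) * (c - C))"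
    using circulation_le_limit_below[OF cont _ below] circulation_degenerate_vertical[OF cont] y by (cases "C = c") auto
  have 4: "\<bar>circulation u v a b d C'\<bar> \<le> \<epsilon> * ((b - a) * (C' - d))"
    using circulation_le_limit_above[OF cont _ above] circulation_degenerate_vertical[OF cont] y by (cases "C' = d") auto
  have "circulation u v A A' C C' = circulation u v A a C C' +
      (circulation u v a b C c + (circulation u v a b c d + circulation u v a b d C')) + circulation u v b A' C C'"
    using x y circulation_split_horizontal[OF cont, of A a A' C C'] circulation_split_horizontal[OF cont, of a b A' C C']
      circulation_split_vertical[OF cont, of C c C' a b] circulation_split_vertical[OF cont, of c d C' a b] by simp
  moreover have "\<epsilon> * ((a - A) * (C' - C)) + \<epsilon> * ((b - a) * (c - C)) + \<epsilon> * ((b - a) * (C' - d)) + \<epsilon> * ((A' - b) * (C' - C))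
      = \<epsilon> * ((A' - A) * (C' - C) - (b - a) * (d - c))"
    by (simp add: algebra_simps)
  ultimately show ?thesis using 1 2 3 4 unfolding abs_le_iff by linarith
qed

text \<open>
  The core of the argument.  Let \<open>Q\<close> be a near-square and \<open>R\<close> the smallest rectangle that contains
  \<open>T \<inter> Q\<close>.  The frame \<open>Q - R\<close> avoids \<open>T\<close> and contributes at most \<open>\<epsilon>\<close> times its area; \<open>R\<close> touches \<open>T\<close> with
  each side, so its circulation is at most \<open>\<epsilon> / 2 * \<bar>Q\<bar>\<close> by \<open>circulation_almost_affine\<close>.  If \<open>R\<close>
  fills at least half of \<open>Q\<close>, this is at most \<open>\<epsilon> * \<bar>R\<bar>\<close>, and \<open>Q\<close> obeys the bound.  If \<open>R\<close> is smaller than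
  that, any bound \<open>(\<epsilon> + \<theta>) * area\<close> already known for all rectangles, applied to \<open>R\<close>, yields the bound
  \<open>(\<epsilon> + \<theta> / 2) * area\<close> for \<open>Q\<close>.  Starting with \<open>\<theta> = \<epsilon>\<close> and iterating removes \<open>\<theta>\<close>.
\<close>

lemma circulation_le_of_bad_portion:
  fixes T B :: "(real \<times> real) set"
  assumes T: "closed T" and "0 < \<epsilon>" and \<kappa>: "36 * \<kappa> = \<epsilon>" and rp: "\<bar>r1 - p2\<bar> \<le> \<kappa>"
    and off: "\<And>a b c d. a \<le> b \<Longrightarrow> c \<le> d \<Longrightarrow> {a..b} \<times> {c..d} \<subseteq> B - T \<Longrightarrow> \<bar>circulation u v a b c d\<bar> \<le> \<epsilon> * ((b - a) * (d - c))"
    and u1: "\<And>s t s'. (s, t) \<in> T \<inter> B \<Longrightarrow> (s', t) \<in> B \<Longrightarrow> \<bar>u s' t - u s t - (s' - s) * p1\<bar> \<le> \<kappa> * \<bar>s' - s\<bar>"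
    and u2: "\<And>s t t'. (s, t) \<in> T \<inter> B \<Longrightarrow> (s, t') \<in> B \<Longrightarrow> \<bar>u s t' - u s t - (t' - t) * p2\<bar> \<le> \<kappa> * \<bar>t' - t\<bar>"
    and v1: "\<And>s t s'. (s, t) \<in> T \<inter> B \<Longrightarrow> (s', t) \<in> B \<Longrightarrow> \<bar>v s' t - v s t - (s' - s) * r1\<bar> \<le> \<kappa> * \<bar>s' - s\<bar>"
    and v2: "\<And>s t t'. (s, t) \<in> T \<inter> B \<Longrightarrow> (s, t') \<in> B \<Longrightarrow> \<bar>v s t' - v s t - (t' - t) * r2\<bar> \<le> \<kappa> * \<bar>t' - t\<bar>"
    and rect: "a \<le> b" "c \<le> d" "{a..b} \<times> {c..d} \<subseteq> B"
  shows "\<bar>circulation u v a b c d\<bar> \<le> \<epsilon> * ((b - a) * (d - c))"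
proof -
  have near: "(\<exists>a b c d. A \<le> a \<and> a \<le> b \<and> b \<le> A' \<and> C \<le> c \<and> c \<le> d \<and> d \<le> C' \<and>
      \<bar>circulation u v a b c d\<bar> \<le> \<epsilon> / 2 * ((A' - A) * (C' - C)) \<and>
      \<bar>circulation u v A A' C C'\<bar> \<le> \<bar>circulation u v a b c d\<bar> + \<epsilon> * ((A' - A) * (C' - C) - (b - a) * (d - c)))"
    if Q: "A < A'" "C < C'" "A' - A \<le> 2 * (C' - C)" "C' - C \<le> 2 * (A' - A)" "{A..A'} \<times> {C..C'} \<subseteq> B"
    for A A' C C'
  proof (cases "T \<inter> {A..A'} \<times> {C..C'} = {}")
    case True
    then have "{A..A'} \<times> {C..C'} \<subseteq> B - T" using Q by blast
    then have "\<bar>circulation u v A A' C C'\<bar> \<le> \<epsilon> * ((A' - A) * (C' - C))" using Q by (intro off) auto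
    then show ?thesis using Q \<open>0 < \<epsilon>\<close>
      by (intro exI[of _ A] exI[of _ C]) (auto simp: circulation_degenerate[OF cont_u cont_v])
  next
    case False
    define K where "K = T \<inter> {A..A'} \<times> {C..C'}"
    have K: "compact K" "K \<noteq> {}"
      using False T by (auto simp: K_def intro!: closed_Int_compact compact_Times)
    have cf: "continuous_on K fst" "continuous_on K snd" by (intro continuous_intros)+
    \<comment> \<open>The extreme points of \<open>K\<close> in the four directions; they span the smallest rectangle around \<open>K\<close>.\<close>
    obtain a ya where a: "(a, ya) \<in> K" "\<And>s t. (s, t) \<in> K \<Longrightarrow> a \<le> s"
      using continuous_attains_inf[OF K cf(1)] by fastforce
    obtain b yb where b: "(b, yb) \<in> K" "\<And>s t. (s, t) \<in> K \<Longrightarrow> s \<le> b"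
      using continuous_attains_sup[OF K cf(1)] by fastforce
    obtain xc c where c: "(xc, c) \<in> K" "\<And>s t. (s, t) \<in> K \<Longrightarrow> c \<le> t"
      using continuous_attains_inf[OF K cf(2)] by fastforce
    obtain xd d where d: "(xd, d) \<in> K" "\<And>s t. (s, t) \<in> K \<Longrightarrow> t \<le> d"
      using continuous_attains_sup[OF K cf(2)] by fastforce
    have le: "A \<le> a" "a \<le> b" "b \<le> A'" "C \<le> c" "c \<le> d" "d \<le> C'"
      using a b c d by (auto simp: K_def)
    have TB: "(s, t) \<in> T \<inter> B" if "(s, t) \<in> K" for s t using that Q by (auto simp: K_def)
    have TK: "(s, t) \<in> K" if "s \<in> {A..A'}" "t \<in> {C..C'}" "(s, t) \<in> T" for s t using that by (auto simp: K_def)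
    have inB: "(s, t) \<in> B" if "s \<in> {A..A'}" "t \<in> {C..C'}" for s t using that Q by auto
    have KQ: "s \<in> {A..A'} \<and> t \<in> {C..C'}" if "(s, t) \<in> K" for s t using that by (auto simp: K_def)
    have sides: "ya \<in> {c..d}" "yb \<in> {c..d}" "xc \<in> {a..b}" "xd \<in> {a..b}"
      using a b c d by auto
    have "\<bar>circulation u v a b c d\<bar> \<le> 18 * \<kappa> * ((A' - A) * (C' - C))"
    proof (rule circulation_almost_affine[where T = K and ya = ya and yb = yb and xc = xc and xd = xd and ?p1.0 = p1 and ?p2.0 = p2 and ?r1.0 = r1 and ?r2.0 = r2])
      show "0 \<le> \<kappa>" using \<kappa> \<open>0 < \<epsilon>\<close> by simp
      show "\<bar>u s' t - u s t - (s' - s) * p1\<bar> \<le> \<kappa> * \<bar>s' - s\<bar>"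
        if "(s, t) \<in> K" "s' \<in> {a..b}" for s t s'
        using that le KQ[OF that(1)] by (intro u1 TB inB) auto
      show "\<bar>u s t' - u s t - (t' - t) * p2\<bar> \<le> \<kappa> * \<bar>t' - t\<bar>"
        if "(s, t) \<in> K" "t' \<in> {c..d}" for s t t'
        using that le KQ[OF that(1)] by (intro u2 TB inB) auto
      show "\<bar>v s' t - v s t - (s' - s) * r1\<bar> \<le> \<kappa> * \<bar>s' - s\<bar>"
        if "(s, t) \<in> K" "s' \<in> {a..b}" for s t s'
        using that le KQ[OF that(1)] by (intro v1 TB inB) auto
      show "\<bar>v s t' - v s t - (t' - t) * r2\<bar> \<le> \<kappa> * \<bar>t' - t\<bar>"
        if "(s, t) \<in> K" "t' \<in> {c..d}" for s t t'
        using that le KQ[OF that(1)] by (intro v2 TB inB) auto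
    qed (use le Q rp a(1) b(1) c(1) d(1) sides in auto)
    moreover have "18 * \<kappa> = \<epsilon> / 2" using \<kappa> by simp
    ultimately have bound: "\<bar>circulation u v a b c d\<bar> \<le> \<epsilon> / 2 * ((A' - A) * (C' - C))"
      by (simp only:)
    have "\<bar>circulation u v A A' C C'\<bar> \<le>
        \<bar>circulation u v a b c d\<bar> + \<epsilon> * ((A' - A) * (C' - C) - (b - a) * (d - c))"
    proof (rule circulation_frame)
      show "\<bar>circulation u v A x C C'\<bar> \<le> \<epsilon> * ((x - A) * (C' - C))" if "A < x" "x < a" for x
      proof (rule off)
        show "{A..x} \<times> {C..C'} \<subseteq> B - T"
        proof safe
          fix s t assume st: "s \<in> {A..x}" "t \<in> {C..C'}"
          then have Q': "s \<in> {A..A'}" "t \<in> {C..C'}" using that le by auto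
          show "(s, t) \<in> B" by (rule inB[OF Q'])
          assume "(s, t) \<in> T"
          from a(2)[OF TK[OF Q' this]] show False using st that by auto
        qed
      qed (use that Q in auto)
      show "\<bar>circulation u v x A' C C'\<bar> \<le> \<epsilon> * ((A' - x) * (C' - C))" if "b < x" "x < A'" for x
      proof (rule off)
        show "{x..A'} \<times> {C..C'} \<subseteq> B - T"
        proof safe
          fix s t assume st: "s \<in> {x..A'}" "t \<in> {C..C'}"
          then have Q': "s \<in> {A..A'}" "t \<in> {C..C'}" using that le by auto
          show "(s, t) \<in> B" by (rule inB[OF Q'])
          assume "(s, t) \<in> T"
          from b(2)[OF TK[OF Q' this]] show False using st that by auto
        qed
      qed (use that Q in auto)
      show "\<bar>circulation u v a b C y\<bar> \<le> \<epsilon> * ((b - a) * (y - C))" if "C < y" "y < c" for y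
      proof (rule off)
        show "{a..b} \<times> {C..y} \<subseteq> B - T"
        proof safe
          fix s t assume st: "s \<in> {a..b}" "t \<in> {C..y}"
          then have Q': "s \<in> {A..A'}" "t \<in> {C..C'}" using that le by auto
          show "(s, t) \<in> B" by (rule inB[OF Q'])
          assume "(s, t) \<in> T"
          from c(2)[OF TK[OF Q' this]] show False using st that by auto
        qed
      qed (use that le in auto)
      show "\<bar>circulation u v a b y C'\<bar> \<le> \<epsilon> * ((b - a) * (C' - y))" if "d < y" "y < C'" for y
      proof (rule off)
        show "{a..b} \<times> {y..C'} \<subseteq> B - T"
        proof safe
          fix s t assume st: "s \<in> {a..b}" "t \<in> {y..C'}"
          then have Q': "s \<in> {A..A'}" "t \<in> {C..C'}" using that le by auto
          show "(s, t) \<in> B" by (rule inB[OF Q'])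
          assume "(s, t) \<in> T"
          from d(2)[OF TK[OF Q' this]] show False using st that by auto
        qed
      qed (use that le in auto)
    qed (use le in auto)
    then show ?thesis using le bound by blast
  qed
  have all: "\<bar>circulation u v a b c d\<bar> \<le> (\<epsilon> + \<epsilon> / 2 ^ n) * ((b - a) * (d - c))"
    if "a \<le> b" "c \<le> d" "{a..b} \<times> {c..d} \<subseteq> B" for n :: nat and a b c d
    using that
  proof (induction n arbitrary: a b c d)
    case 0
    show ?case
    proof (rule circulation_le_of_near_squares[OF cont_u cont_v _ 0])
      fix A A' C C' assume Q: "A < A'" "C < C'" "A' - A \<le> 2 * (C' - C)" "C' - C \<le> 2 * (A' - A)" "{A..A'} \<times> {C..C'} \<subseteq> B"
      obtain a b c d where le: "A \<le> a" "a \<le> b" "b \<le> A'" "C \<le> c" "c \<le> d" "d \<le> C'"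
        and *: "\<bar>circulation u v a b c d\<bar> \<le> \<epsilon> / 2 * ((A' - A) * (C' - C))"
          "\<bar>circulation u v A A' C C'\<bar> \<le> \<bar>circulation u v a b c d\<bar> + \<epsilon> * ((A' - A) * (C' - C) - (b - a) * (d - c))"
        using near[OF Q] by blast
      have "0 \<le> \<epsilon> * ((b - a) * (d - c))" "0 \<le> \<epsilon> * ((A' - A) * (C' - C))" using le \<open>0 < \<epsilon>\<close> by auto
      then show "\<bar>circulation u v A A' C C'\<bar> \<le> (\<epsilon> + \<epsilon> / 2 ^ 0) * ((A' - A) * (C' - C))"
        using * unfolding right_diff_distrib power_0 by (simp add: distrib_right)
    qed
  next
    case (Suc n)
    show ?case
    proof (rule circulation_le_of_near_squares[OF cont_u cont_v _ Suc.prems])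
      fix A A' C C' assume Q: "A < A'" "C < C'" "A' - A \<le> 2 * (C' - C)" "C' - C \<le> 2 * (A' - A)" "{A..A'} \<times> {C..C'} \<subseteq> B"
      obtain a b c d where le: "A \<le> a" "a \<le> b" "b \<le> A'" "C \<le> c" "c \<le> d" "d \<le> C'"
        and *: "\<bar>circulation u v a b c d\<bar> \<le> \<epsilon> / 2 * ((A' - A) * (C' - C))"
          "\<bar>circulation u v A A' C C'\<bar> \<le> \<bar>circulation u v a b c d\<bar> + \<epsilon> * ((A' - A) * (C' - C) - (b - a) * (d - c))"
        using near[OF Q] by blast
      define \<theta> where "\<theta> = \<epsilon> / 2 ^ n"
      define small where "small = (b - a) * (d - c)"
      define large where "large = (A' - A) * (C' - C)"
      have "{a..b} \<times> {c..d} \<subseteq> {A..A'} \<times> {C..C'}" using le by (intro Sigma_mono) auto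
      then have "{a..b} \<times> {c..d} \<subseteq> B" using Q(5) by (rule subset_trans)
      then have IH: "\<bar>circulation u v a b c d\<bar> \<le> (\<epsilon> + \<theta>) * small"
        unfolding \<theta>_def small_def using le by (intro Suc.IH) auto
      have "0 \<le> \<theta>" "0 \<le> large" using \<open>0 < \<epsilon>\<close> Q by (auto simp: \<theta>_def large_def)
      have "\<bar>circulation u v A A' C C'\<bar> \<le> \<epsilon> * large + \<theta> / 2 * large"
      proof (cases "large \<le> 2 * small")
        case True
        then have "\<epsilon> * (large / 2) \<le> \<epsilon> * small" using \<open>0 < \<epsilon>\<close> by (intro mult_left_mono) auto
        moreover have "0 \<le> \<theta> / 2 * large" using \<open>0 \<le> \<theta>\<close> \<open>0 \<le> large\<close> by simp
        ultimately show ?thesis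
          using * unfolding small_def[symmetric] large_def[symmetric] right_diff_distrib[of \<epsilon> large] by linarith
      next
        case False
        then have "\<theta> * small \<le> \<theta> * (large / 2)" using \<open>0 \<le> \<theta>\<close> by (intro mult_left_mono) auto
        then show ?thesis
          using *(2) IH unfolding small_def[symmetric] large_def[symmetric] right_diff_distrib[of \<epsilon> large] distrib_right by linarith
      qed
      then show "\<bar>circulation u v A A' C C'\<bar> \<le> (\<epsilon> + \<epsilon> / 2 ^ Suc n) * ((A' - A) * (C' - C))"
        by (simp add: \<theta>_def large_def distrib_right)
    qed
  qed
  have "(\<lambda>n. (\<epsilon> + \<epsilon> / 2 ^ n) * ((b - a) * (d - c))) \<longlonglongrightarrow> (\<epsilon> + 0) * ((b - a) * (d - c))"
    by (intro tendsto_intros LIMSEQ_divide_realpow_zero) auto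
  then show ?thesis
    using LIMSEQ_le_const[of _ _ "\<bar>circulation u v a b c d\<bar>"] all[OF rect] by fastforce
qed

end

text \<open>
  The Baire category theorem, in the form that one of countably many closed sets covering \<open>T\<close> contains a
  whole relatively open piece of \<open>T\<close>.
\<close>

lemma closed_countable_Union_portion:
  fixes T :: "'a::{real_normed_vector, heine_borel} set"
  assumes "closed T" "T \<noteq> {}" "T = (\<Union>n::nat. F n)" "\<And>n. closed (F n)"
  obtains n X where "open X" "X \<inter> T \<noteq> {}" "X \<inter> T \<subseteq> F n"
proof -
  have "\<exists>n X. open X \<and> X \<inter> T \<noteq> {} \<and> X \<inter> T \<subseteq> F n"
  proof (rule ccontr)
    assume contra: "\<nexists>n X. open X \<and> X \<inter> T \<noteq> {} \<and> X \<inter> T \<subseteq> F n"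
    have "T \<subseteq> closure (\<Inter>(range (\<lambda>n. T - F n)))"
    proof (rule Baire)
      fix G assume "G \<in> range (\<lambda>n. T - F n)"
      then obtain n where G: "G = T - F n" by blast
      have "openin (top_of_set T) (T \<inter> - F n)"
        using assms(4) by (intro openin_open_Int) (simp add: open_Compl)
      moreover have "T \<subseteq> closure G"
      proof
        fix x assume "x \<in> T"
        show "x \<in> closure G"
          unfolding closure_iff_nhds_not_empty
        proof (intro allI impI)
          fix A V assume "V \<subseteq> A" "open V" "x \<in> V"
          then have "\<not> V \<inter> T \<subseteq> F n" using contra \<open>x \<in> T\<close> by blast
          then show "G \<inter> A \<noteq> {}" using \<open>V \<subseteq> A\<close> by (auto simp: G)
        qed
      qed
      ultimately show "openin (top_of_set T) G \<and> T \<subseteq> closure G" by (simp add: G Diff_eq)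
    qed (use assms in auto)
    moreover have "\<Inter>(range (\<lambda>n. T - F n)) = {}" using assms(3) by auto
    ultimately have "T \<subseteq> closure {}" by (simp only:)
    then show False using assms(2) by simp
  qed
  then show thesis using that by blast
qed

text \<open>
  Two difference quotients with a common limit are compared with each other rather than with the
  limit, and without denominators.  In this form the condition is closed in the base point, since the
  derivative, about whose dependence on the point nothing is known, does not occur in it.
\<close>

lemma eventually_uniform_quotients:
  fixes f g :: "real \<Rightarrow> real"
  assumes "(f has_real_derivative p) (at x)" "(g has_real_derivative p) (at y)" "0 < \<kappa>"
  shows "\<exists>n::nat. \<forall>h k. \<bar>h\<bar> \<le> inverse (real (Suc n)) \<longrightarrow> \<bar>k\<bar> \<le> inverse (real (Suc n)) \<longrightarrow>
     \<bar>k * (f (x + h) - f x) - h * (g (y + k) - g y)\<bar> \<le> \<kappa> * \<bar>h * k\<bar>"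
proof -
  have *: "\<exists>\<delta>>0. \<forall>h. \<bar>h\<bar> \<le> \<delta> \<longrightarrow> \<bar>f (x + h) - f x - p * h\<bar> \<le> \<kappa> / 2 * \<bar>h\<bar>"
    if "(f has_real_derivative p) (at x)" for f x
  proof -
    have "(f has_derivative (*) p) (at x)" using that by (simp add: has_field_derivative_def)
    then obtain d where "d > 0" "\<And>y. norm (y - x) < d \<Longrightarrow> norm (f y - f x - p * (y - x)) \<le> \<kappa> / 2 * norm (y - x)"
      unfolding has_derivative_at_alt using \<open>0 < \<kappa>\<close> by (metis half_gt_zero)
    from this(1) this(2)[of "x + h" for h] show ?thesis
      by (intro exI[of _ "d / 2"]) auto
  qed
  obtain d1 d2 where d: "d1 > 0" "d2 > 0"
    "\<And>h. \<bar>h\<bar> \<le> d1 \<Longrightarrow> \<bar>f (x + h) - f x - p * h\<bar> \<le> \<kappa> / 2 * \<bar>h\<bar>"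
    "\<And>h. \<bar>h\<bar> \<le> d2 \<Longrightarrow> \<bar>g (y + h) - g y - p * h\<bar> \<le> \<kappa> / 2 * \<bar>h\<bar>"
    using *[OF assms(1)] *[OF assms(2)] by blast
  obtain n where n: "inverse (real (Suc n)) < min d1 d2"
    using reals_Archimedean[of "min d1 d2"] d by auto
  show ?thesis
  proof (intro exI[of _ n] allI impI)
    fix h k :: real assume hk: "\<bar>h\<bar> \<le> inverse (real (Suc n))" "\<bar>k\<bar> \<le> inverse (real (Suc n))"
    have "k * (f (x + h) - f x) - h * (g (y + k) - g y)
        = k * (f (x + h) - f x - p * h) - h * (g (y + k) - g y - p * k)"
      by (simp add: algebra_simps)
    also have "\<bar>\<dots>\<bar> \<le> \<bar>k\<bar> * \<bar>f (x + h) - f x - p * h\<bar> + \<bar>h\<bar> * \<bar>g (y + k) - g y - p * k\<bar>"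
      unfolding abs_mult[symmetric] by linarith
    also have "\<dots> \<le> \<bar>k\<bar> * (\<kappa> / 2 * \<bar>h\<bar>) + \<bar>h\<bar> * (\<kappa> / 2 * \<bar>k\<bar>)"
      using hk n d(3)[of h] d(4)[of k] by (intro add_mono mult_left_mono) auto
    also have "\<dots> = \<kappa> * \<bar>h * k\<bar>" by (simp add: abs_mult)
    finally show "\<bar>k * (f (x + h) - f x) - h * (g (y + k) - g y)\<bar> \<le> \<kappa> * \<bar>h * k\<bar>" .
  qed
qed

lemma quotient_transfer:
  fixes \<tau> :: real
  assumes "0 < \<tau>" "\<bar>\<tau> * \<Delta> - h * \<Delta>'\<bar> \<le> \<kappa> / 2 * \<bar>h * \<tau>\<bar>" "\<bar>\<Delta>' / \<tau> - p\<bar> \<le> \<kappa> / 2"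
  shows "\<bar>\<Delta> - h * p\<bar> \<le> \<kappa> * \<bar>h\<bar>"
proof -
  have "\<Delta> - h * p = (\<tau> * \<Delta> - h * \<Delta>') / \<tau> + h * (\<Delta>' / \<tau> - p)"
    using assms(1) by (simp add: field_simps)
  also have "\<bar>\<dots>\<bar> \<le> \<bar>(\<tau> * \<Delta> - h * \<Delta>') / \<tau>\<bar> + \<bar>h * (\<Delta>' / \<tau> - p)\<bar>"
    by (rule abs_triangle_ineq)
  also have "\<bar>(\<tau> * \<Delta> - h * \<Delta>') / \<tau>\<bar> \<le> \<kappa> / 2 * \<bar>h\<bar>"
    using assms(1,2) by (simp add: abs_mult pos_divide_le_eq)
  also have "\<bar>h * (\<Delta>' / \<tau> - p)\<bar> \<le> \<bar>h\<bar> * (\<kappa> / 2)"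
    unfolding abs_mult using assms(3) by (intro mult_left_mono) auto
  finally show ?thesis by (simp add: mult.commute)
qed

text \<open>
  A theorem of Looman--Menchoff type: the partial derivatives are only assumed to exist at each point,
  without any continuity, integrability or boundedness.  For \<open>\<epsilon> > 0\<close> let \<open>T\<close> be the closed set of points
  without a neighbourhood on which the circulation is at most \<open>\<epsilon>\<close> times the area.  It is the union of
  the closed sets \<open>F n\<close> of points at which the difference quotients of \<open>u\<close> and of \<open>v\<close> in each direction,
  and likewise those of \<open>u\<close> in \<open>t\<close> and of \<open>v\<close> in \<open>s\<close>, agree up to a small multiple of \<open>\<epsilon>\<close> for all increments
  up to \<open>1 / (n + 1)\<close>.  If \<open>T\<close> is not empty, Baire's theorem provides a piece of \<open>T\<close>
  inside one \<open>F n\<close>.  The quotients with the fixed increment \<open>\<tau> = 1 / (n + 1)\<close> replace the derivatives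
  there, and these are continuous in the base point; so near a point of the piece the form is
  uniformly almost affine, and \<open>circulation_le_of_bad_portion\<close> shows that this point is not in \<open>T\<close>.
\<close>

theorem circulation_eq_0:
  fixes u v :: "real \<Rightarrow> real \<Rightarrow> real"
  assumes cont: "continuous_on UNIV (\<lambda>(s, t). u s t)" "continuous_on UNIV (\<lambda>(s, t). v s t)"
    and rect: "a \<le> b" "c \<le> d"
    and partials: "\<And>s t. s \<in> {a..b} \<Longrightarrow> t \<in> {c..d} \<Longrightarrow> \<exists>p1 p2 r2.
      ((\<lambda>x. u x t) has_real_derivative p1) (at s) \<and> (u s has_real_derivative p2) (at t) \<and>
      ((\<lambda>x. v x t) has_real_derivative p2) (at s) \<and> (v s has_real_derivative r2) (at t)"
  shows "circulation u v a b c d = 0"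
proof -
  define R where "R = {a..b} \<times> {c..d}"
  have "\<bar>circulation u v a b c d\<bar> \<le> \<epsilon> * ((b - a) * (d - c))" if "0 < \<epsilon>" for \<epsilon>
  proof -
    define good where "good X \<longleftrightarrow> (\<forall>a b c d. a \<le> b \<longrightarrow> c \<le> d \<longrightarrow> {a..b} \<times> {c..d} \<subseteq> X \<longrightarrow>
      \<bar>circulation u v a b c d\<bar> \<le> \<epsilon> * ((b - a) * (d - c)))" for X
    define T where "T = R - \<Union>{X. open X \<and> good (X \<inter> R)}"
    have clT: "closed T" unfolding T_def R_def by (intro closed_Diff closed_Times open_Union) auto
    have off_T: "\<bar>circulation u v a b c d\<bar> \<le> \<epsilon> * ((b - a) * (d - c))"
      if r: "a \<le> b" "c \<le> d" "{a..b} \<times> {c..d} \<subseteq> R - T" for a b c d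
    proof (rule circulation_le_local[OF cont r(1,2)])
      fix z assume z: "z \<in> {a..b} \<times> {c..d}"
      then obtain X where X: "open X" "good (X \<inter> R)" "z \<in> X" using r(3) unfolding T_def by blast
      have sub: "X \<inter> {a..b} \<times> {c..d} \<subseteq> X \<inter> R" using r(3) by blast
      have "\<bar>circulation u v a' b' c' d'\<bar> \<le> \<epsilon> * ((b' - a') * (d' - c'))"
        if "a' \<le> b'" "c' \<le> d'" "{a'..b'} \<times> {c'..d'} \<subseteq> X \<inter> {a..b} \<times> {c..d}" for a' b' c' d'
        using X(2) that(1,2) subset_trans[OF that(3) sub] unfolding good_def by blast
      then show "\<exists>X. open X \<and> z \<in> X \<and> (\<forall>a' b' c' d'. a' \<le> b' \<longrightarrow> c' \<le> d' \<longrightarrow>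
          {a'..b'} \<times> {c'..d'} \<subseteq> X \<inter> {a..b} \<times> {c..d} \<longrightarrow>
          \<bar>circulation u v a' b' c' d'\<bar> \<le> \<epsilon> * ((b' - a') * (d' - c')))"
        using X(1,3) by blast
    qed
    have "T = {}"
    proof (rule ccontr)
      assume "T \<noteq> {}"
      \<comment> \<open>The factor 36 is \<open>2 * 18\<close>, so that \<open>circulation_almost_affine\<close> gives \<open>\<epsilon> / 2\<close> times the area.\<close>
      define \<kappa> where "\<kappa> = \<epsilon> / 36"
      have "0 < \<kappa>" using that by (simp add: \<kappa>_def)
      define U1 where "U1 = (\<lambda>z h. u (fst z + h) (snd z))"
      define U2 where "U2 = (\<lambda>z h. u (fst z) (snd z + h))"
      define V1 where "V1 = (\<lambda>z h. v (fst z + h) (snd z))"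
      define V2 where "V2 = (\<lambda>z h. v (fst z) (snd z + h))"
      note UV_defs = U1_def U2_def V1_def V2_def
      \<comment> \<open>\<open>(U2, V1)\<close> encodes \<open>\<partial>u/\<partial>t = \<partial>v/\<partial>s\<close>, the other pairs the existence of the partial derivatives.\<close>
      define D where "D = {(U1, U1), (U2, U2), (U2, V1), (V1, V1), (V2, V2)}"
      define P where "P \<phi> \<psi> n z \<longleftrightarrow> (\<forall>h k. \<bar>h\<bar> \<le> inverse (real (Suc n)) \<longrightarrow> \<bar>k\<bar> \<le> inverse (real (Suc n)) \<longrightarrow>
        \<bar>k * (\<phi> z h - \<phi> z 0) - h * (\<psi> z k - \<psi> z 0)\<bar> \<le> \<kappa> / 2 * \<bar>h * k\<bar>)"
        for \<phi> \<psi> :: "real \<times> real \<Rightarrow> real \<Rightarrow> real" and n z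
      define F where "F n = {z \<in> T. \<forall>(\<phi>, \<psi>)\<in>D. P \<phi> \<psi> n z}" for n
      have contD: "continuous_on UNIV (\<lambda>z. U1 z h)" "continuous_on UNIV (\<lambda>z. U2 z h)"
        "continuous_on UNIV (\<lambda>z. V1 z h)" "continuous_on UNIV (\<lambda>z. V2 z h)" for h
        unfolding UV_defs
        by (intro continuous_on_u[OF cont] continuous_on_v[OF cont] continuous_intros)+
      have clP: "closed {z. P \<phi> \<psi> n z}"
        if "\<And>h. continuous_on UNIV (\<lambda>z. \<phi> z h)" "\<And>h. continuous_on UNIV (\<lambda>z. \<psi> z h)" for \<phi> \<psi> n
        unfolding P_def
        by (intro closed_Collect_all closed_Collect_imp closed_Collect_le open_Collect_const continuous_intros that)
      have mono: "P \<phi> \<psi> N z" if "P \<phi> \<psi> n z" "n \<le> N" for \<phi> \<psi> n N z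
      proof -
        have "inverse (real (Suc N)) \<le> inverse (real (Suc n))" using that(2) by (intro le_imp_inverse_le) auto
        then have "\<bar>h\<bar> \<le> inverse (real (Suc n))" if "\<bar>h\<bar> \<le> inverse (real (Suc N))" for h
          using that by linarith
        then show ?thesis using that(1) unfolding P_def by blast
      qed
      have covered: "\<exists>n. z \<in> F n" if "z \<in> T" for z
      proof -
        obtain s t where z: "z = (s, t)" by (cases z)
        have "s \<in> {a..b}" "t \<in> {c..d}" using that z by (auto simp: T_def R_def)
        from partials[OF this] obtain p1 p2 r2 where
          D1: "((\<lambda>x. u x t) has_real_derivative p1) (at s)" and D2: "(u s has_real_derivative p2) (at t)" and
          D3: "((\<lambda>x. v x t) has_real_derivative p2) (at s)" and D4: "(v s has_real_derivative r2) (at t)"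
          by blast
        have "0 < \<kappa> / 2" using \<open>0 < \<kappa>\<close> by simp
        note ev = eventually_uniform_quotients[OF _ _ this]
        obtain n1 where "P U1 U1 n1 z"
          using ev[OF D1 D1] unfolding P_def UV_defs z fst_conv snd_conv add_0_right by blast
        obtain n2 where "P U2 U2 n2 z"
          using ev[OF D2 D2] unfolding P_def UV_defs z fst_conv snd_conv add_0_right by blast
        obtain n3 where "P U2 V1 n3 z"
          using ev[OF D2 D3] unfolding P_def UV_defs z fst_conv snd_conv add_0_right by blast
        obtain n4 where "P V1 V1 n4 z"
          using ev[OF D3 D3] unfolding P_def UV_defs z fst_conv snd_conv add_0_right by blast
        obtain n5 where "P V2 V2 n5 z"
          using ev[OF D4 D4] unfolding P_def UV_defs z fst_conv snd_conv add_0_right by blast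
        with \<open>P U1 U1 n1 z\<close> \<open>P U2 U2 n2 z\<close> \<open>P U2 V1 n3 z\<close> \<open>P V1 V1 n4 z\<close>
        have "\<forall>(\<phi>, \<psi>)\<in>D. P \<phi> \<psi> (n1 + n2 + n3 + n4 + n5) z"
          unfolding D_def by (auto elim!: mono)
        then show ?thesis using that by (auto simp: F_def)
      qed
      have "closed (F n)" for n
      proof -
        have "F n = T \<inter> {z. P U1 U1 n z} \<inter> {z. P U2 U2 n z} \<inter> {z. P U2 V1 n z} \<inter> {z. P V1 V1 n z} \<inter> {z. P V2 V2 n z}"
          by (auto simp: F_def D_def)
        then show ?thesis using clT clP contD by (metis closed_Int)
      qed
      moreover have "T = (\<Union>n. F n)" using covered by (auto simp: F_def)
      ultimately obtain n X where X: "open X" "X \<inter> T \<noteq> {}" "X \<inter> T \<subseteq> F n"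
        using closed_countable_Union_portion[OF clT \<open>T \<noteq> {}\<close>] by metis
      then obtain z0 where z0: "z0 \<in> X" "z0 \<in> T" by blast
      define \<tau> where "\<tau> = inverse (real (Suc n))"
      have "0 < \<tau>" by (simp add: \<tau>_def)
      \<comment> \<open>The approximate derivative at the fixed scale \<open>\<tau>\<close>, continuous in \<open>z\<close>.\<close>
      define slope where "slope \<phi> z = (\<phi> z \<tau> - \<phi> z 0) / \<tau>" for \<phi> :: "real \<times> real \<Rightarrow> real \<Rightarrow> real" and z
      define Y where "Y = X \<inter> {z. \<bar>slope U1 z - slope U1 z0\<bar> < \<kappa> / 2} \<inter> {z. \<bar>slope U2 z - slope U2 z0\<bar> < \<kappa> / 2}
        \<inter> {z. \<bar>slope V1 z - slope V1 z0\<bar> < \<kappa> / 2} \<inter> {z. \<bar>slope V2 z - slope V2 z0\<bar> < \<kappa> / 2} \<inter> ball z0 (\<tau> / 2)"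
      have "open Y"
        unfolding Y_def slope_def using X(1) \<open>0 < \<tau>\<close>
        by (intro open_Int open_Collect_less continuous_intros contD open_ball) auto
      have "z0 \<in> Y" using z0 \<open>0 < \<tau>\<close> \<open>0 < \<kappa>\<close> by (simp add: Y_def)
      have est: "\<bar>\<phi> z h - \<phi> z 0 - h * slope \<phi> z0\<bar> \<le> \<kappa> * \<bar>h\<bar>"
        if "z \<in> T \<inter> Y" "(\<phi>, \<phi>) \<in> D" "\<bar>slope \<phi> z - slope \<phi> z0\<bar> < \<kappa> / 2" "\<bar>h\<bar> \<le> \<tau>" for z \<phi> h
      proof (rule quotient_transfer[OF \<open>0 < \<tau>\<close>])
        have "P \<phi> \<phi> n z" using that X(3) by (auto simp: Y_def F_def)
        then show "\<bar>\<tau> * (\<phi> z h - \<phi> z 0) - h * (\<phi> z \<tau> - \<phi> z 0)\<bar> \<le> \<kappa> / 2 * \<bar>h * \<tau>\<bar>"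
          using that(4) \<open>0 < \<tau>\<close> unfolding P_def \<tau>_def[symmetric] by simp
        show "\<bar>(\<phi> z \<tau> - \<phi> z 0) / \<tau> - slope \<phi> z0\<bar> \<le> \<kappa> / 2"
          using that(3) by (simp add: slope_def)
      qed
      have close: "\<bar>s' - s\<bar> \<le> \<tau>" "\<bar>t' - t\<bar> \<le> \<tau>" if "(s, t) \<in> Y" "(s', t') \<in> Y" for s t s' t'
      proof -
        have "dist (s', t') (s, t) < \<tau>" 
          using that dist_triangle_half_r[of z0 "(s', t')" \<tau> "(s, t)"] by (auto simp: Y_def)
        then show "\<bar>s' - s\<bar> \<le> \<tau>" "\<bar>t' - t\<bar> \<le> \<tau>"
          using dist_fst_le[of "(s', t')" "(s, t)"] dist_snd_le[of "(s', t')" "(s, t)"] by (auto simp: dist_real_def)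
      qed
      have "good (Y \<inter> R)"
        unfolding good_def
      proof (intro allI impI)
        fix a b c d assume rect': "a \<le> b" "c \<le> d" "{a..b} \<times> {c..d} \<subseteq> Y \<inter> R"
        show "\<bar>circulation u v a b c d\<bar> \<le> \<epsilon> * ((b - a) * (d - c))"
        proof (rule circulation_le_of_bad_portion[OF cont clT \<open>0 < \<epsilon>\<close> _ _ _ _ _ _ _ rect'])
          show "36 * \<kappa> = \<epsilon>" by (simp add: \<kappa>_def)
          have "P U2 V1 n z0" using X(3) z0 by (auto simp: F_def D_def)
          note this[unfolded P_def, folded \<tau>_def, rule_format, of \<tau> \<tau>]
          then have "\<bar>\<tau> * (U2 z0 \<tau> - U2 z0 0) - \<tau> * (V1 z0 \<tau> - V1 z0 0)\<bar> \<le> \<kappa> / 2 * \<bar>\<tau> * \<tau>\<bar>"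
            using \<open>0 < \<tau>\<close> by simp
          then have "\<bar>(U2 z0 \<tau> - U2 z0 0) - \<tau> * slope V1 z0\<bar> \<le> \<kappa> * \<bar>\<tau>\<bar>"
            using \<open>0 < \<kappa>\<close> by (intro quotient_transfer[OF \<open>0 < \<tau>\<close>]) (auto simp: slope_def)
          moreover have "U2 z0 \<tau> - U2 z0 0 = \<tau> * slope U2 z0"
            using \<open>0 < \<tau>\<close> by (simp add: slope_def)
          ultimately have "\<bar>\<tau>\<bar> * \<bar>slope U2 z0 - slope V1 z0\<bar> \<le> \<bar>\<tau>\<bar> * \<kappa>"
            unfolding abs_mult[symmetric] right_diff_distrib by (simp only: mult.commute)
          then show "\<bar>slope V1 z0 - slope U2 z0\<bar> \<le> \<kappa>"
            using \<open>0 < \<tau>\<close> by (simp add: abs_minus_commute)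
          show "\<bar>circulation u v a b c d\<bar> \<le> \<epsilon> * ((b - a) * (d - c))"
            if "a \<le> b" "c \<le> d" "{a..b} \<times> {c..d} \<subseteq> (Y \<inter> R) - T" for a b c d
            using that by (intro off_T) auto
          show "\<bar>u s' t - u s t - (s' - s) * slope U1 z0\<bar> \<le> \<kappa> * \<bar>s' - s\<bar>"
            if "(s, t) \<in> T \<inter> (Y \<inter> R)" "(s', t) \<in> Y \<inter> R" for s t s'
            using est[of "(s, t)" U1 "s' - s"] that close(1)[of s t s' t] by (auto simp: D_def Y_def U1_def)
          show "\<bar>v s' t - v s t - (s' - s) * slope V1 z0\<bar> \<le> \<kappa> * \<bar>s' - s\<bar>"
            if "(s, t) \<in> T \<inter> (Y \<inter> R)" "(s', t) \<in> Y \<inter> R" for s t s'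
            using est[of "(s, t)" V1 "s' - s"] that close(1)[of s t s' t] by (auto simp: D_def Y_def V1_def)
          show "\<bar>u s t' - u s t - (t' - t) * slope U2 z0\<bar> \<le> \<kappa> * \<bar>t' - t\<bar>"
            if "(s, t) \<in> T \<inter> (Y \<inter> R)" "(s, t') \<in> Y \<inter> R" for s t t'
            using est[of "(s, t)" U2 "t' - t"] that close(2)[of s t s t'] by (auto simp: D_def Y_def U2_def)
          show "\<bar>v s t' - v s t - (t' - t) * slope V2 z0\<bar> \<le> \<kappa> * \<bar>t' - t\<bar>"
            if "(s, t) \<in> T \<inter> (Y \<inter> R)" "(s, t') \<in> Y \<inter> R" for s t t'
            using est[of "(s, t)" V2 "t' - t"] that close(2)[of s t s t'] by (auto simp: D_def Y_def V2_def)
        qed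
      qed
      then have "z0 \<notin> T" using \<open>open Y\<close> \<open>z0 \<in> Y\<close> by (auto simp: T_def)
      then show False using z0 by simp
    qed
    then show ?thesis using off_T[OF rect] by (simp add: R_def)
  qed
  note bound = this
  have "\<bar>circulation u v a b c d\<bar> \<le> 0 + e" if "0 < e" for e
  proof -
    have "0 < e / ((b - a) * (d - c) + 1)" "0 \<le> (b - a) * (d - c)" using that rect by (auto simp: add_nonneg_pos)
    then have "\<bar>circulation u v a b c d\<bar> \<le> e / ((b - a) * (d - c) + 1) * ((b - a) * (d - c))" by (intro bound)
    also have "\<dots> \<le> e" using that \<open>0 \<le> (b - a) * (d - c)\<close> by (simp add: divide_simps)
    finally show ?thesis by simp
  qed
  then have "\<bar>circulation u v a b c d\<bar> \<le> 0" by (rule field_le_epsilon)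
  then show ?thesis by simp
qed


section \<open>Averages over cubes\<close>

text \<open>
  The mean over a segment of length \<open>\<eta>\<close> in one coordinate direction.  Taken in all coordinate directions
  in turn, it becomes the mean over a cube, but each step needs one-dimensional integrals only.
\<close>

definition average :: "real \<Rightarrow> 'k::finite \<Rightarrow> (real ^ 'k \<Rightarrow> real) \<Rightarrow> real ^ 'k \<Rightarrow> real"
  where "average \<eta> i f x = (1 / \<eta>) * integral {0..\<eta>} (\<lambda>t. f (x + t *\<^sub>R axis i 1))"

definition averages :: "real \<Rightarrow> 'k::finite list \<Rightarrow> (real ^ 'k \<Rightarrow> real) \<Rightarrow> real ^ 'k \<Rightarrow> real"
  where "averages \<eta> xs f = foldr (average \<eta>) xs f"

lemma averages_simps [simp]:
  "averages \<eta> [] f = f" "averages \<eta> (i # xs) f = average \<eta> i (averages \<eta> xs f)"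
  by (simp_all add: averages_def)

lemma continuous_on_line:
  fixes f :: "real ^ 'k::finite \<Rightarrow> real"
  assumes "continuous_on UNIV f"
  shows "continuous_on A (\<lambda>t. f (x + t *\<^sub>R v))"
  by (rule continuous_on_compose2[OF assms]) (auto intro!: continuous_intros)

lemma integrable_on_line:
  fixes f :: "real ^ 'k::finite \<Rightarrow> real"
  assumes "continuous_on UNIV f"
  shows "(\<lambda>t. f (x + t *\<^sub>R v)) integrable_on {a..b}"
  by (intro integrable_continuous_real continuous_on_line assms)

lemma continuous_on_average:
  assumes "continuous_on UNIV f"
  shows "continuous_on UNIV (average \<eta> i f)"
proof -
  have "continuous_on UNIV (\<lambda>x. integral (cbox 0 \<eta>) (\<lambda>t. f (x + t *\<^sub>R axis i 1)))"
    by (rule integral_continuous_on_param, simp add: split_beta, rule continuous_on_compose2[OF assms])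
      (auto intro!: continuous_intros)
  then show ?thesis unfolding average_def by (intro continuous_intros) simp
qed

lemma continuous_on_averages:
  "continuous_on UNIV f \<Longrightarrow> continuous_on UNIV (averages \<eta> xs f)"
  by (induction xs) (auto intro: continuous_on_average)

lemma average_commute:
  assumes "continuous_on UNIV f"
  shows "average \<eta> i (average \<eta> j f) = average \<eta> j (average \<eta> i f)"
proof
  fix x
  have "integral (cbox 0 \<eta>) (\<lambda>s. integral (cbox 0 \<eta>) (\<lambda>t. f (x + s *\<^sub>R axis i 1 + t *\<^sub>R axis j 1)))
      = integral (cbox 0 \<eta>) (\<lambda>t. integral (cbox 0 \<eta>) (\<lambda>s. f (x + s *\<^sub>R axis i 1 + t *\<^sub>R axis j 1)))"
    by (rule integral_swap_continuous, simp add: split_beta, rule continuous_on_compose2[OF assms])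
      (auto intro!: continuous_intros)
  then show "average \<eta> i (average \<eta> j f) x = average \<eta> j (average \<eta> i f) x"
    by (simp add: average_def add_ac)
qed

text \<open>
  By Fubini's theorem the order of averaging is immaterial, so any direction can be made the last one;
  \<open>averages_inner\<close> makes it the first.
\<close>

lemma averages_front:
  assumes "continuous_on UNIV f" "i \<in> set xs"
  shows "averages \<eta> xs f = average \<eta> i (averages \<eta> (remove1 i xs) f)"
  using assms(2)
proof (induction xs)
  case (Cons j xs)
  then show ?case
    using average_commute[OF continuous_on_averages[OF assms(1)]] by (cases "i = j") auto
qed simp

lemma averages_inner:
  assumes "continuous_on UNIV f"
  shows "average \<eta> i (averages \<eta> xs f) = averages \<eta> xs (average \<eta> i f)"
proof (induction xs)
  case (Cons j xs)
  have "average \<eta> i (average \<eta> j (averages \<eta> xs f)) = average \<eta> j (average \<eta> i (averages \<eta> xs f))"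
    by (rule average_commute[OF continuous_on_averages[OF assms]])
  then show ?case unfolding averages_simps Cons.IH .
qed simp

lemma average_shift: "average \<eta> i (\<lambda>y. f (y + a)) x = average \<eta> i f (x + a)"
  by (simp add: average_def add_ac)

lemma averages_shift: "averages \<eta> xs (\<lambda>y. f (y + a)) x = averages \<eta> xs f (x + a)"
proof (induction xs arbitrary: x)
  case (Cons i xs)
  have "averages \<eta> xs (\<lambda>y. f (y + a)) = (\<lambda>y. averages \<eta> xs f (y + a))"
    using Cons.IH by blast
  then show ?case by (simp add: average_shift)
qed simp

lemma average_diff:
  assumes "continuous_on UNIV f" "continuous_on UNIV g"
  shows "average \<eta> i (\<lambda>y. f y - g y) = (\<lambda>y. average \<eta> i f y - average \<eta> i g y)"
proof
  fix x
  show "average \<eta> i (\<lambda>y. f y - g y) x = average \<eta> i f x - average \<eta> i g x"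
    unfolding average_def right_diff_distrib[symmetric]
    by (subst Henstock_Kurzweil_Integration.integral_diff) (auto intro: integrable_on_line assms)
qed

lemma averages_diff:
  assumes "continuous_on UNIV f" "continuous_on UNIV g"
  shows "averages \<eta> xs (\<lambda>y. f y - g y) = (\<lambda>y. averages \<eta> xs f y - averages \<eta> xs g y)"
  by (induction xs) (simp_all add: average_diff continuous_on_averages assms)

lemma average_near:
  assumes "0 < \<eta>" "continuous_on UNIV f" "\<And>t. t \<in> {0..\<eta>} \<Longrightarrow> \<bar>f (x + t *\<^sub>R axis i 1) - c\<bar> \<le> \<omega>"
  shows "\<bar>average \<eta> i f x - c\<bar> \<le> \<omega>"
proof -
  have "integral {0..\<eta>} (\<lambda>t. f (x + t *\<^sub>R axis i 1) - c) = integral {0..\<eta>} (\<lambda>t. f (x + t *\<^sub>R axis i 1)) - \<eta> * c"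
    using assms(1) by (subst Henstock_Kurzweil_Integration.integral_diff) (auto intro: integrable_on_line assms(2))
  moreover have "norm (integral {0..\<eta>} (\<lambda>t. f (x + t *\<^sub>R axis i 1) - c)) \<le> \<omega> * (\<eta> - 0)"
    using assms by (intro integral_bound continuous_on_diff continuous_on_line continuous_on_const) auto
  ultimately have "\<bar>\<eta> * (average \<eta> i f x - c)\<bar> \<le> \<eta> * \<omega>"
    using assms(1) by (simp add: average_def right_diff_distrib mult.commute)
  then show ?thesis using assms(1) by (simp add: abs_mult)
qed

text \<open>
  The averages at \<open>x\<close> depend only on the values at distance at most \<open>\<eta> * length xs\<close>.  With \<open>c = f x\<close> this
  gives their convergence as \<open>\<eta>\<close> tends to 0; applied to a difference, with \<open>c = \<omega> = 0\<close>, it gives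
  their locality.
\<close>

lemma averages_near:
  fixes f :: "real ^ 'k::finite \<Rightarrow> real" and \<eta> :: real
  assumes "0 < \<eta>" "continuous_on UNIV f" "\<And>y. dist x y \<le> \<eta> * length xs \<Longrightarrow> \<bar>f y - c\<bar> \<le> \<omega>"
  shows "\<bar>averages \<eta> xs f x - c\<bar> \<le> \<omega>"
  using assms(3)
proof (induction xs arbitrary: x)
  case Nil
  then show ?case by simp
next
  case (Cons i xs)
  have "\<bar>average \<eta> i (averages \<eta> xs f) x - c\<bar> \<le> \<omega>"
  proof (rule average_near[OF assms(1) continuous_on_averages[OF assms(2)]])
    fix t assume t: "t \<in> {0..\<eta>}"
    show "\<bar>averages \<eta> xs f (x + t *\<^sub>R axis i 1) - c\<bar> \<le> \<omega>"
    proof (rule Cons.IH)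
      fix y assume y: "dist (x + t *\<^sub>R axis i 1) y \<le> \<eta> * length xs"
      have "dist x y \<le> dist x (x + t *\<^sub>R axis i 1) + dist (x + t *\<^sub>R axis i 1) y" by (rule dist_triangle)
      also have "dist x (x + t *\<^sub>R axis i 1) \<le> \<eta>" using t by (simp add: dist_norm norm_axis_1)
      finally show "\<bar>f y - c\<bar> \<le> \<omega>" using y by (intro Cons.prems) (simp add: algebra_simps)
    qed
  qed
  then show ?case by simp
qed

lemma average_has_partial_derivative:
  fixes f :: "real ^ 'k::finite \<Rightarrow> real"
  assumes "0 < \<eta>" "continuous_on UNIV f"
  shows "((\<lambda>s. average \<eta> i f (x + s *\<^sub>R axis i 1)) has_real_derivative (f (x + \<eta> *\<^sub>R axis i 1) - f x) / \<eta>) (at 0)"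
proof -
  define \<phi> where "\<phi> t = f (x + t *\<^sub>R axis i 1)" for t
  have "continuous_on {-1..\<eta> + 1} \<phi>" unfolding \<phi>_def by (rule continuous_on_line[OF assms(2)])
  then obtain G where G: "\<And>t. t \<in> {-1..\<eta> + 1} \<Longrightarrow> (G has_vector_derivative \<phi> t) (at t within {-1..\<eta> + 1})"
    using antiderivative_continuous by blast
  have G': "(G has_vector_derivative \<phi> t) (at t within S)" if "t \<in> {-1<..<\<eta> + 1}" for t S
  proof -
    have "at t within {-1..\<eta> + 1} = at t" using that by (intro at_within_interior) auto
    then show ?thesis using G[of t] that by (auto intro: has_vector_derivative_at_within)
  qed
  have avg: "average \<eta> i f (x + s *\<^sub>R axis i 1) = (G (s + \<eta>) - G s) / \<eta>" if "s \<in> {-1<..<1}" for s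
  proof -
    have "((\<lambda>t. \<phi> (s + t)) has_integral G (s + \<eta>) - G (s + 0)) {0..\<eta>}"
    proof (rule fundamental_theorem_of_calculus)
      show "((\<lambda>t. G (s + t)) has_vector_derivative \<phi> (s + t)) (at t within {0..\<eta>})" if "t \<in> {0..\<eta>}" for t
      proof -
        have "(G has_vector_derivative \<phi> (s + t)) (at (s + t))" using that \<open>s \<in> {-1<..<1}\<close> by (intro G') auto
        moreover have "((\<lambda>t. s + t) has_vector_derivative 1) (at t within {0..\<eta>})"
          by (auto intro!: derivative_eq_intros)
        ultimately have "(G \<circ> (\<lambda>t. s + t) has_vector_derivative 1 *\<^sub>R \<phi> (s + t)) (at t within {0..\<eta>})"
          by (intro vector_diff_chain_within) (auto intro: has_vector_derivative_at_within)
        then show ?thesis by (simp add: o_def)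
      qed
    qed (use assms(1) in simp)
    then have "integral {0..\<eta>} (\<lambda>t. \<phi> (s + t)) = G (s + \<eta>) - G s" by (simp add: has_integral_iff)
    then show ?thesis by (simp add: average_def \<phi>_def scaleR_add_left add_ac)
  qed
  have "((\<lambda>s. (G (s + \<eta>) - G s) / \<eta>) has_real_derivative (\<phi> \<eta> - \<phi> 0) / \<eta>) (at 0)"
  proof -
    have "(G has_real_derivative \<phi> \<eta>) (at (0 + \<eta>))" "(G has_real_derivative \<phi> 0) (at 0)"
      using G'[of \<eta> UNIV] G'[of 0 UNIV] assms(1) by (auto simp: has_real_derivative_iff_has_vector_derivative)
    then show ?thesis
      using DERIV_shift[of G "\<phi> \<eta>" 0 \<eta>] by (intro DERIV_cdivide DERIV_diff) simp_all
  qed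
  then have "((\<lambda>s. average \<eta> i f (x + s *\<^sub>R axis i 1)) has_real_derivative (\<phi> \<eta> - \<phi> 0) / \<eta>) (at 0)"
    by (rule has_field_derivative_transform_within_open[where S = "{-1<..<1}"]) (auto simp: avg)
  then show ?thesis by (simp add: \<phi>_def)
qed

lemma averages_has_partial_derivative:
  fixes f :: "real ^ 'k::finite \<Rightarrow> real"
  assumes "0 < \<eta>" "continuous_on UNIV f" "i \<in> set xs"
  shows "((\<lambda>s. averages \<eta> xs f (x + s *\<^sub>R axis i 1)) has_real_derivative
    (averages \<eta> (remove1 i xs) f (x + \<eta> *\<^sub>R axis i 1) - averages \<eta> (remove1 i xs) f x) / \<eta>) (at 0)"
  unfolding averages_front[OF assms(2,3)]
  by (intro average_has_partial_derivative continuous_on_averages assms)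

lemma has_derivative_of_continuous_partials:
  fixes F :: "real ^ 'k::finite \<Rightarrow> real"
  assumes partial: "\<And>i x. ((\<lambda>s. F (x + s *\<^sub>R axis i 1)) has_real_derivative D i x) (at 0)"
    and cont: "\<And>i. continuous_on UNIV (D i)"
  shows "(F has_derivative (\<lambda>h. \<Sum>i\<in>UNIV. h $ i * D i x)) (at x)"
  unfolding has_derivative_at_alt
proof (intro conjI allI impI)
  show "bounded_linear (\<lambda>h. \<Sum>i\<in>UNIV. h $ i * D i x)"
    by (intro bounded_linear_sum bounded_linear_mult_const bounded_linear_vec_nth)
  fix e :: real assume "0 < e"
  define \<omega> where "\<omega> = e / CARD('k)"
  have "0 < \<omega>" using \<open>0 < e\<close> by (simp add: \<omega>_def)
  have "\<forall>\<^sub>F y in nhds x. \<forall>i. dist (D i y) (D i x) < \<omega>"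
  proof (intro eventually_all_finite allI)
    fix i
    have "isCont (D i) x" using cont[of i] by (simp add: continuous_on_eq_continuous_at)
    then have "(D i \<longlongrightarrow> D i x) (nhds x)" by (simp add: continuous_within tendsto_nhds_iff)
    then show "\<forall>\<^sub>F y in nhds x. dist (D i y) (D i x) < \<omega>" using \<open>0 < \<omega>\<close> by (rule tendstoD)
  qed
  then obtain d where d: "d > 0" "\<And>y i. dist y x < d \<Longrightarrow> \<bar>D i y - D i x\<bar> < \<omega>"
    unfolding eventually_nhds_metric dist_real_def by blast
  show "\<exists>d>0. \<forall>y. norm (y - x) < d \<longrightarrow> norm (F y - F x - (\<Sum>i\<in>UNIV. (y - x) $ i * D i x)) \<le> e * norm (y - x)"
  proof (intro exI[of _ d] conjI allI impI d(1))
    fix y assume "norm (y - x) < d"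
    define h where "h = y - x"
    define part :: "'k set \<Rightarrow> real ^ 'k" where "part A = (\<Sum>i\<in>A. h $ i *\<^sub>R axis i 1)" for A
    have part_nth: "part A $ j = (if j \<in> A then h $ j else 0)" if "finite A" for A j
    proof -
      have "part A $ j = (\<Sum>i\<in>A. if i = j then h $ j else 0)"
        unfolding part_def sum_component by (rule sum.cong) (auto simp: axis_def)
      then show ?thesis using that by simp
    qed
    have "\<bar>F (x + part A) - F x - (\<Sum>i\<in>A. h $ i * D i x)\<bar> \<le> (\<Sum>i\<in>A. \<omega> * \<bar>h $ i\<bar>)" if "finite A" for A
      using that
    proof (induction A rule: finite_induct)
      case empty
      then show ?case by (simp add: part_def)
    next
      case (insert j A)
      define G where "G s = F (x + part A + s *\<^sub>R axis j 1) - s * D j x" for s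
      have "norm (G (h $ j) - G 0) \<le> \<omega> * norm (h $ j - 0)"
      proof (rule field_differentiable_bound[of "{-\<bar>h $ j\<bar>..\<bar>h $ j\<bar>}"])
        fix s assume s: "s \<in> {-\<bar>h $ j\<bar>..\<bar>h $ j\<bar>}"
        have "((\<lambda>r. F (x + part A + (r + s) *\<^sub>R axis j 1)) has_real_derivative D j (x + part A + s *\<^sub>R axis j 1)) (at 0)"
          using partial[of "x + part A + s *\<^sub>R axis j 1" j] by (simp add: scaleR_add_left add_ac)
        then have "((\<lambda>r. F (x + part A + r *\<^sub>R axis j 1)) has_real_derivative D j (x + part A + s *\<^sub>R axis j 1)) (at s)"
          using DERIV_shift[of "\<lambda>r. F (x + part A + r *\<^sub>R axis j 1)" _ 0 s] by simp
        then have "(G has_real_derivative D j (x + part A + s *\<^sub>R axis j 1) - D j x) (at s)"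
          unfolding G_def by (auto intro!: derivative_eq_intros)
        then show "(G has_real_derivative D j (x + part A + s *\<^sub>R axis j 1) - D j x) (at s within {-\<bar>h $ j\<bar>..\<bar>h $ j\<bar>})"
          by (rule has_field_derivative_at_within)
        have "norm (part A + s *\<^sub>R axis j 1) \<le> norm h"
        proof (rule norm_le_componentwise_cart)
          fix i show "norm ((part A + s *\<^sub>R axis j 1) $ i) \<le> norm (h $ i)"
            using s insert.hyps by (auto simp: part_nth axis_def)
        qed
        then have "dist (x + part A + s *\<^sub>R axis j 1) x < d"
          using \<open>norm (y - x) < d\<close> by (simp add: dist_norm h_def add.assoc)
        then show "norm (D j (x + part A + s *\<^sub>R axis j 1) - D j x) \<le> \<omega>"
          using d(2) by (simp add: less_imp_le)
      qed auto
      moreover have "F (x + part (insert j A)) - F x - (\<Sum>i\<in>insert j A. h $ i * D i x)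
          = (F (x + part A) - F x - (\<Sum>i\<in>A. h $ i * D i x)) + (G (h $ j) - G 0)"
        using insert.hyps by (simp add: G_def part_def algebra_simps)
      moreover have "(\<Sum>i\<in>insert j A. \<omega> * \<bar>h $ i\<bar>) = (\<Sum>i\<in>A. \<omega> * \<bar>h $ i\<bar>) + \<omega> * \<bar>h $ j\<bar>"
        using insert.hyps by simp
      ultimately show ?case using insert.IH unfolding real_norm_def by simp
    qed
    from this[of UNIV] have "\<bar>F (x + part UNIV) - F x - (\<Sum>i\<in>UNIV. h $ i * D i x)\<bar> \<le> (\<Sum>i\<in>UNIV. \<omega> * \<bar>h $ i\<bar>)" by simp
    also have "(\<Sum>i\<in>UNIV. \<omega> * \<bar>h $ i\<bar>) \<le> (\<Sum>i\<in>(UNIV::'k set). \<omega> * norm h)"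
      using \<open>0 < \<omega>\<close> by (intro sum_mono mult_left_mono component_le_norm_cart) auto
    also have "\<dots> = e * norm h" by (simp add: \<omega>_def)
    also have "part UNIV = h" by (simp add: vec_eq_iff part_nth)
    finally show "norm (F y - F x - (\<Sum>i\<in>UNIV. (y - x) $ i * D i x)) \<le> e * norm (y - x)"
      by (simp add: h_def)
  qed
qed


section \<open>Line integrals of closed forms along the edge of a surface\<close>

text \<open>
  The partial derivative of an averaged coefficient is a difference of averages over opposite faces of
  the cube.  With the direction \<open>j\<close> split off, it is the average, over the remaining directions, of a
  difference of integrals over opposite edges of a coordinate square, and the hypothesis exchanges the
  two pairs of opposite edges.
\<close>

lemma averages_partials_symmetric:
  fixes f g :: "real ^ 'k::finite \<Rightarrow> real" and \<eta> :: real
  assumes "0 < \<eta>" and cont: "continuous_on UNIV f" "continuous_on UNIV g"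
    and ij: "i \<noteq> j" "i \<in> set xs" "j \<in> set xs"
    and rect: "\<And>y. dist x y \<le> \<eta> * length xs \<Longrightarrow>
      average \<eta> j g (y + \<eta> *\<^sub>R axis i 1) - average \<eta> j g y = average \<eta> i f (y + \<eta> *\<^sub>R axis j 1) - average \<eta> i f y"
  shows "averages \<eta> (remove1 i xs) g (x + \<eta> *\<^sub>R axis i 1) - averages \<eta> (remove1 i xs) g x =
    averages \<eta> (remove1 j xs) f (x + \<eta> *\<^sub>R axis j 1) - averages \<eta> (remove1 j xs) f x"
proof -
  define ys where "ys = remove1 j (remove1 i xs)"
  have step: "averages \<eta> (remove1 a xs) \<phi> (x + v) - averages \<eta> (remove1 a xs) \<phi> x
      = averages \<eta> (remove1 b (remove1 a xs)) (\<lambda>y. average \<eta> b \<phi> (y + v) - average \<eta> b \<phi> y) x"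
    if "a \<noteq> b" "b \<in> set xs" "continuous_on UNIV \<phi>" for a b \<phi> v
  proof -
    have "b \<in> set (remove1 a xs)" using that by simp
    then have eq: "averages \<eta> (remove1 a xs) \<phi> = averages \<eta> (remove1 b (remove1 a xs)) (average \<eta> b \<phi>)"
      using averages_front[OF that(3)] averages_inner[OF that(3)] by simp
    have shifted: "continuous_on UNIV (\<lambda>y. average \<eta> b \<phi> (y + v))"
      by (rule continuous_on_compose2[OF continuous_on_average[OF that(3)]]) (auto intro!: continuous_intros)
    show ?thesis
      unfolding eq averages_diff[OF shifted continuous_on_average[OF that(3)]] averages_shift ..
  qed
  have shifted: "continuous_on UNIV (\<lambda>y. average \<eta> b \<phi> (y + v) - average \<eta> b \<phi> y)"
    if "continuous_on UNIV \<phi>" for b \<phi> and v :: "real ^ 'k"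
    by (rule continuous_on_diff[OF continuous_on_compose2[OF continuous_on_average[OF that]] continuous_on_average[OF that]])
      (auto intro!: continuous_intros)
  define A where "A = (\<lambda>y. average \<eta> j g (y + \<eta> *\<^sub>R axis i 1) - average \<eta> j g y)"
  define B where "B = (\<lambda>y. average \<eta> i f (y + \<eta> *\<^sub>R axis j 1) - average \<eta> i f y)"
  have AB: "continuous_on UNIV A" "continuous_on UNIV B" unfolding A_def B_def by (intro shifted cont)+
  have len: "length ys \<le> length xs" by (simp add: ys_def length_remove1)
  have "\<bar>averages \<eta> ys (\<lambda>y. A y - B y) x - 0\<bar> \<le> 0"
  proof (rule averages_near[OF \<open>0 < \<eta>\<close>])
    show "continuous_on UNIV (\<lambda>y. A y - B y)" using AB by (intro continuous_intros)
    fix y assume "dist x y \<le> \<eta> * length ys"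
    also have "\<dots> \<le> \<eta> * length xs" using len \<open>0 < \<eta>\<close> by simp
    finally show "\<bar>A y - B y - 0\<bar> \<le> 0" using rect by (simp add: A_def B_def)
  qed
  then have "averages \<eta> ys A x = averages \<eta> ys B x" by (simp add: averages_diff[OF AB])
  moreover have "ys = remove1 i (remove1 j xs)" by (simp add: ys_def remove1_commute)
  ultimately show ?thesis
    using step[OF ij(1,3) cont(2)] step[OF ij(1)[symmetric] ij(2) cont(1)]
    by (simp add: A_def B_def ys_def)
qed

text \<open>
  The exchange of the edges says that the circulation of \<open>f dx\<^sub>i + g dx\<^sub>j\<close> around the square vanishes.
\<close>

lemma average_rectangle:
  fixes f g :: "real ^ 'k::finite \<Rightarrow> real" and \<eta> :: real
  assumes "0 < \<eta>" and cont: "continuous_on UNIV f" "continuous_on UNIV g"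
    and partials: "\<And>s t. s \<in> {0..\<eta>} \<Longrightarrow> t \<in> {0..\<eta>} \<Longrightarrow> \<exists>p1 p2 r2.
      ((\<lambda>h. f (y + s *\<^sub>R axis i 1 + t *\<^sub>R axis j 1 + h *\<^sub>R axis i 1)) has_real_derivative p1) (at 0) \<and>
      ((\<lambda>h. f (y + s *\<^sub>R axis i 1 + t *\<^sub>R axis j 1 + h *\<^sub>R axis j 1)) has_real_derivative p2) (at 0) \<and>
      ((\<lambda>h. g (y + s *\<^sub>R axis i 1 + t *\<^sub>R axis j 1 + h *\<^sub>R axis i 1)) has_real_derivative p2) (at 0) \<and>
      ((\<lambda>h. g (y + s *\<^sub>R axis i 1 + t *\<^sub>R axis j 1 + h *\<^sub>R axis j 1)) has_real_derivative r2) (at 0)"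
  shows "average \<eta> j g (y + \<eta> *\<^sub>R axis i 1) - average \<eta> j g y = average \<eta> i f (y + \<eta> *\<^sub>R axis j 1) - average \<eta> i f y"
proof -
  define u where "u s t = f (y + s *\<^sub>R axis i 1 + t *\<^sub>R axis j 1)" for s t
  define v where "v s t = g (y + s *\<^sub>R axis i 1 + t *\<^sub>R axis j 1)" for s t
  have "circulation u v 0 \<eta> 0 \<eta> = 0"
  proof (rule circulation_eq_0)
    show "continuous_on UNIV (\<lambda>(s, t). u s t)"
      unfolding u_def split_beta by (rule continuous_on_compose2[OF cont(1)]) (auto intro!: continuous_intros)
    show "continuous_on UNIV (\<lambda>(s, t). v s t)"
      unfolding v_def split_beta by (rule continuous_on_compose2[OF cont(2)]) (auto intro!: continuous_intros)
    fix s t assume st: "s \<in> {0..\<eta>}" "t \<in> {0..\<eta>}"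
    obtain p1 p2 r2 where
      D: "((\<lambda>h. f (y + s *\<^sub>R axis i 1 + t *\<^sub>R axis j 1 + h *\<^sub>R axis i 1)) has_real_derivative p1) (at 0)"
      "((\<lambda>h. f (y + s *\<^sub>R axis i 1 + t *\<^sub>R axis j 1 + h *\<^sub>R axis j 1)) has_real_derivative p2) (at 0)"
      "((\<lambda>h. g (y + s *\<^sub>R axis i 1 + t *\<^sub>R axis j 1 + h *\<^sub>R axis i 1)) has_real_derivative p2) (at 0)"
      "((\<lambda>h. g (y + s *\<^sub>R axis i 1 + t *\<^sub>R axis j 1 + h *\<^sub>R axis j 1)) has_real_derivative r2) (at 0)"
      using partials[OF st] by blast
    have "((\<lambda>x. u x t) has_real_derivative p1) (at s)" "(u s has_real_derivative p2) (at t)"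
      "((\<lambda>x. v x t) has_real_derivative p2) (at s)" "(v s has_real_derivative r2) (at t)"
      using D DERIV_shift[of "\<lambda>x. u x t" p1 0 s] DERIV_shift[of "u s" p2 0 t]
        DERIV_shift[of "\<lambda>x. v x t" p2 0 s] DERIV_shift[of "v s" r2 0 t]
      by (simp_all add: u_def v_def scaleR_add_left add_ac)
    then show "\<exists>p1 p2 r2. ((\<lambda>x. u x t) has_real_derivative p1) (at s) \<and> (u s has_real_derivative p2) (at t) \<and>
        ((\<lambda>x. v x t) has_real_derivative p2) (at s) \<and> (v s has_real_derivative r2) (at t)" by blast
  qed (use \<open>0 < \<eta>\<close> in auto)
  moreover have "integral {0..\<eta>} (\<lambda>s. u s 0 - u s \<eta>) = \<eta> * (average \<eta> i f y - average \<eta> i f (y + \<eta> *\<^sub>R axis j 1))"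
    using \<open>0 < \<eta>\<close> Henstock_Kurzweil_Integration.integral_diff[OF integrable_on_line[OF cont(1), of y "axis i 1" 0 \<eta>]
        integrable_on_line[OF cont(1), of "y + \<eta> *\<^sub>R axis j 1" "axis i 1" 0 \<eta>]]
    by (simp add: average_def u_def right_diff_distrib add_ac)
  moreover have "integral {0..\<eta>} (\<lambda>t. v \<eta> t - v 0 t) = \<eta> * (average \<eta> j g (y + \<eta> *\<^sub>R axis i 1) - average \<eta> j g y)"
    using \<open>0 < \<eta>\<close> Henstock_Kurzweil_Integration.integral_diff[OF integrable_on_line[OF cont(2), of "y + \<eta> *\<^sub>R axis i 1" "axis j 1" 0 \<eta>]
        integrable_on_line[OF cont(2), of y "axis j 1" 0 \<eta>]]
    by (simp add: average_def v_def right_diff_distrib add_ac)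
  ultimately have "\<eta> * ((average \<eta> i f y - average \<eta> i f (y + \<eta> *\<^sub>R axis j 1))
      + (average \<eta> j g (y + \<eta> *\<^sub>R axis i 1) - average \<eta> j g y)) = 0"
    unfolding circulation_def distrib_left by simp
  then show ?thesis using \<open>0 < \<eta>\<close> by simp
qed

lemma surface_compact:
  fixes S :: "(real ^ 'k::finite) set"
  assumes "piecewise_smooth_surface_with_edge S g"
  shows "compact S" "path_image g \<subseteq> S"
proof -
  from assms[unfolded piecewise_smooth_surface_with_edge_def] obtain pieces where
    fin: "finite pieces" and smooth: "\<forall>(\<phi>, D)\<in>pieces. smooth_piece \<phi> D" and
    S: "S = (\<Union>(\<phi>, D)\<in>pieces. \<phi> ` D)" and boundary: "surface_boundary S = path_image g"
    by (elim exE conjE) (rule that)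
  show "path_image g \<subseteq> S" using boundary unfolding surface_boundary_def by blast
  have "compact (\<phi> ` D)" if "(\<phi>, D) \<in> pieces" for \<phi> D
  proof (rule compact_continuous_image)
    have "smooth_piece \<phi> D" using bspec[OF smooth that] by simp
    then have boundary_curve: "\<exists>c. jordan_curve c \<and> rectifiable c \<and> D = path_image c \<union> inside (path_image c)"
      and extension: "\<exists>U. D \<subseteq> U \<and> C1_on \<phi> U"
      unfolding smooth_piece_def by (rule conjunct1, rule conjunct1[OF conjunct2])
    obtain c where c: "rectifiable c" "D = path_image c \<union> inside (path_image c)"
      using boundary_curve by blast
    obtain U where U: "D \<subseteq> U" "C1_on \<phi> U" using extension by blast
    have "path c" using c(1) by (simp add: rectifiable_def)
    then show "compact D"
      unfolding c(2) compact_eq_bounded_closed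
      by (simp add: closed_path_image_Un_inside bounded_inside bounded_path_image)
    have "continuous_on U \<phi>" using U(2) unfolding C1_on_def by (intro differentiable_imp_continuous_on) blast
    then show "continuous_on D \<phi>" using U(1) by (rule continuous_on_subset)
  qed
  then show "compact S" unfolding S using fin by (intro compact_UN) auto
qed

text \<open>
  For coefficients with continuous partial derivatives the Stokes formula applies.  Its right-hand side
  involves their derivatives at points of the surface, where symmetry makes the integrand vanish.
\<close>

lemma line_integral_smooth_closed_form:
  fixes F :: "real ^ 'k::finite \<Rightarrow> real ^ 'k"
  assumes surface: "piecewise_smooth_surface_with_edge S g"
    and partial: "\<And>i j x. ((\<lambda>s. F (x + s *\<^sub>R axis i 1) $ j) has_real_derivative D i j x) (at 0)"
    and cont: "\<And>i j. continuous_on UNIV (D i j)"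
    and symmetric: "\<And>i j x. x \<in> S \<Longrightarrow> D i j x = D j i x"
  shows "(\<Sum>j\<in>UNIV. line_integral (\<lambda>x. F x $ j) g j) = 0"
proof -
  have deriv: "(F has_derivative (\<lambda>h. \<chi> j. \<Sum>i\<in>UNIV. h $ i * D i j x)) (at x)" for x
    unfolding has_derivative_componentwise_within[of F]
  proof
    fix b :: "real ^ 'k" assume "b \<in> Basis"
    then obtain j where b: "b = axis j 1" by (auto simp: Basis_vec_def)
    show "((\<lambda>x. F x \<bullet> b) has_derivative (\<lambda>h. (\<chi> j. \<Sum>i\<in>UNIV. h $ i * D i j x) \<bullet> b)) (at x)"
      unfolding b inner_axis using has_derivative_of_continuous_partials[OF partial cont, of j x] by simp
  qed
  have frechet: "frechet_derivative F (at x) = (\<lambda>h. \<chi> j. \<Sum>i\<in>UNIV. h $ i * D i j x)" for x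
    using frechet_derivative_at[OF deriv] by simp
  have "C1_on F UNIV"
    unfolding C1_on_def
  proof (intro conjI allI)
    show "F differentiable_on UNIV" using deriv unfolding differentiable_on_def differentiable_def by blast
    show "continuous_on UNIV (\<lambda>x. frechet_derivative F (at x) v)" for v
      unfolding frechet by (intro continuous_intros cont)
  qed simp
  moreover from surface[unfolded piecewise_smooth_surface_with_edge_def] obtain pieces where
    pieces: "S = (\<Union>(\<phi>, D)\<in>pieces. \<phi> ` D)" and
    stokes: "\<forall>W P. S \<subseteq> W \<and> C1_on P W \<longrightarrow> stokes_formula pieces g P"
    by (elim exE conjE) (rule that)
  ultimately have "stokes_formula pieces g F" by blast
  moreover have "piece_integral_d F \<phi> T = 0" if "(\<phi>, T) \<in> pieces" for \<phi> T
  proof -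
    have "(let v = frechet_derivative \<phi> (at z) (1, 0); w = frechet_derivative \<phi> (at z) (0, 1);
          DP = frechet_derivative F (at (\<phi> z)) in DP v \<bullet> w - DP w \<bullet> v) = 0" if "z \<in> T" for z
    proof -
      have "\<phi> z \<in> S" using that \<open>(\<phi>, T) \<in> pieces\<close> pieces by auto
      then have sym: "D i j (\<phi> z) = D j i (\<phi> z)" for i j by (rule symmetric)
      have "(\<Sum>j\<in>UNIV. (\<Sum>i\<in>UNIV. v $ i * D i j (\<phi> z)) * w $ j) = (\<Sum>j\<in>UNIV. (\<Sum>i\<in>UNIV. w $ i * D i j (\<phi> z)) * v $ j)"
        for v w :: "real ^ 'k"
        unfolding sum_distrib_right by (subst sum.swap) (auto simp: sym mult_ac intro!: sum.cong)
      then show ?thesis by (simp add: Let_def frechet inner_vec_def)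
    qed
    then have "piece_integral_d F \<phi> T = integral T (\<lambda>z. 0)"
      unfolding piece_integral_d_def by (intro Henstock_Kurzweil_Integration.integral_cong) blast
    then show ?thesis by simp
  qed
  ultimately show ?thesis unfolding stokes_formula_def by (simp add: split_beta)
qed

text \<open>
  The coefficients are extended continuously to the whole space and averaged over cubes of side \<open>\<eta>\<close>.
  For small \<open>\<eta>\<close> the cubes at points of the surface stay in \<open>W\<close>, so the averaged form is closed on the
  surface and \<open>line_integral_smooth_closed_form\<close> applies to it; as \<open>\<eta>\<close> tends to 0 it
  converges uniformly on the curve.
\<close>

theorem line_integral_closed_form:
  fixes P :: "real ^ 'k::finite \<Rightarrow> real ^ 'k"
  assumes W: "open W" "S \<subseteq> W" "continuous_on W P"
    and closed: "\<And>x. x \<in> W \<Longrightarrow> \<exists>Q. \<forall>i j.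
      ((\<lambda>s. P (x + s *\<^sub>R axis i 1) $ j) has_real_derivative Q i j) (at 0) \<and> Q i j = Q j i"
    and rect: "rectifiable g" and surface: "piecewise_smooth_surface_with_edge S g"
  shows "(\<Sum>j\<in>UNIV. line_integral (\<lambda>x. P x $ j) g j) = 0"
proof -
  have S: "compact S" "path_image g \<subseteq> S" using surface_compact[OF surface] .
  obtain e where e: "0 < e" "(\<Union>x\<in>S. cball x e) \<subseteq> W"
    using compact_subset_open_imp_cball_epsilon_subset[OF S(1) W(1,2)] by blast
  define C where "C = (\<Union>x\<in>S. cball x e)"
  have "C = {x + y |x y. x \<in> S \<and> y \<in> cball 0 e}"
  proof (intro set_eqI iffI)
    fix z assume "z \<in> C"
    then obtain x where "x \<in> S" "dist x z \<le> e" by (auto simp: C_def)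
    then show "z \<in> {x + y |x y. x \<in> S \<and> y \<in> cball 0 e}"
      by (intro CollectI exI[of _ x] exI[of _ "z - x"]) (auto simp: dist_norm norm_minus_commute)
  next
    fix z assume "z \<in> {x + y |x y. x \<in> S \<and> y \<in> cball 0 e}"
    then obtain x y where "z = x + y" "x \<in> S" "norm y \<le> e" by auto
    then show "z \<in> C" by (auto simp: C_def dist_norm intro!: bexI[of _ x])
  qed
  then have "compact C" using compact_sums[OF S(1) compact_cball[of 0 e]] by simp
  have "C \<subseteq> W" using e(2) by (simp add: C_def)
  then have contC: "continuous_on C P" by (rule continuous_on_subset[OF W(3)])
  obtain B where B: "0 < B" "\<And>x. x \<in> C \<Longrightarrow> norm (P x) \<le> B"
    using compact_imp_bounded[OF compact_continuous_image[OF contC \<open>compact C\<close>]] unfolding bounded_pos by auto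
  \<comment> \<open>Tietze extension, so that averages are defined and of class \<open>C\<^sup>1\<close> on the whole space.\<close>
  obtain P' where P': "continuous_on UNIV P'" "\<And>x. x \<in> C \<Longrightarrow> P' x = P x"
  proof (rule Tietze[OF contC])
    show "closedin (top_of_set UNIV) C" using compact_imp_closed[OF \<open>compact C\<close>] by simp
    show "0 \<le> B" "\<And>x. x \<in> C \<Longrightarrow> norm (P x) \<le> B" using B by auto
  qed blast
  have contP': "continuous_on UNIV (\<lambda>x. P' x $ j)" for j using P'(1) by (intro continuous_intros)
  have closed': "\<exists>Q. \<forall>i j. ((\<lambda>s. P' (y + s *\<^sub>R axis i 1) $ j) has_real_derivative Q i j) (at 0) \<and> Q i j = Q j i"
    if "x \<in> S" "dist x y < e" for x y
  proof -
    have "y \<in> C" using that by (auto simp: C_def intro!: bexI[of _ x])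
    then have "y \<in> W" using \<open>C \<subseteq> W\<close> by blast
    from closed[OF this] obtain Q where
      Q: "\<And>i j. ((\<lambda>s. P (y + s *\<^sub>R axis i 1) $ j) has_real_derivative Q i j) (at 0)" "\<And>i j. Q i j = Q j i" by blast
    have "((\<lambda>s. P' (y + s *\<^sub>R axis i 1) $ j) has_real_derivative Q i j) (at 0)" for i j
    proof (rule has_field_derivative_transform_within_open[OF Q(1)])
      show "open {s. dist x (y + s *\<^sub>R axis i 1) < e}" by (intro open_Collect_less continuous_intros)
      show "0 \<in> {s. dist x (y + s *\<^sub>R axis i 1) < e}" using that by simp
      fix s assume "s \<in> {s. dist x (y + s *\<^sub>R axis i 1) < e}"
      then have "y + s *\<^sub>R axis i 1 \<in> C" using that by (auto simp: C_def intro!: bexI[of _ x])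
      then show "P (y + s *\<^sub>R axis i 1) $ j = P' (y + s *\<^sub>R axis i 1) $ j" by (simp add: P'(2))
    qed
    then show ?thesis using Q(2) by blast
  qed
  obtain xs where xs: "set xs = (UNIV :: 'k set)" using finite_list[OF finite_class.finite_UNIV] by blast
  obtain L where L: "\<And>U V \<omega> j. continuous_on (path_image g) U \<Longrightarrow> continuous_on (path_image g) V \<Longrightarrow>
      (\<And>x. x \<in> path_image g \<Longrightarrow> \<bar>U x - V x\<bar> \<le> \<omega>) \<Longrightarrow> \<bar>line_integral U g j - line_integral V g j\<bar> \<le> \<omega> * L"
    using line_integral_close[OF rect] by blast
  have bound: "\<bar>\<Sum>j\<in>UNIV. line_integral (\<lambda>x. P x $ j) g j\<bar> \<le> real CARD('k) * (\<omega> * L)" if "0 < \<omega>" for \<omega>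
  proof -
    have "uniformly_continuous_on C P'"
      using \<open>compact C\<close> continuous_on_subset[OF P'(1)] by (intro compact_uniformly_continuous) auto
    then obtain \<delta> where \<delta>: "0 < \<delta>" "\<And>x y. x \<in> C \<Longrightarrow> y \<in> C \<Longrightarrow> dist y x < \<delta> \<Longrightarrow> dist (P' y) (P' x) < \<omega>"
      using \<open>0 < \<omega>\<close> by (rule uniformly_continuous_onE) blast
    \<comment> \<open>The cubes have diameter at most \<open>\<eta> * length xs\<close>; two more steps of length \<open>\<eta>\<close> reach the coordinate squares.\<close>
    define \<eta> where "\<eta> = min e \<delta> / (length xs + 3)"
    have \<eta>: "0 < \<eta>" "\<eta> * (length xs + 3) = min e \<delta>" using e(1) \<delta>(1) by (auto simp: \<eta>_def)
    have small: "\<eta> * length xs + 2 * \<eta> < min e \<delta>"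
      unfolding \<eta>(2)[symmetric] using \<eta>(1) by (simp add: algebra_simps)
    define F where "F x = (\<chi> j. averages \<eta> xs (\<lambda>x. P' x $ j) x)" for x
    define D where "D i j x = (averages \<eta> (remove1 i xs) (\<lambda>x. P' x $ j) (x + \<eta> *\<^sub>R axis i 1)
        - averages \<eta> (remove1 i xs) (\<lambda>x. P' x $ j) x) / \<eta>" for i j x
    have "(\<Sum>j\<in>UNIV. line_integral (\<lambda>x. F x $ j) g j) = 0"
    proof (rule line_integral_smooth_closed_form[OF surface])
      show "((\<lambda>s. F (x + s *\<^sub>R axis i 1) $ j) has_real_derivative D i j x) (at 0)" for i j x
        unfolding F_def D_def vec_lambda_beta
        by (rule averages_has_partial_derivative[OF \<eta>(1) contP']) (simp add: xs)
      show "continuous_on UNIV (D i j)" for i j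
        unfolding D_def
        by (intro continuous_on_divide continuous_on_diff continuous_on_averages contP'
            continuous_on_compose2[OF continuous_on_averages[OF contP']] continuous_intros) (use \<eta>(1) in auto)
      fix i j x assume "x \<in> S"
      show "D i j x = D j i x"
      proof (cases "i = j")
        case False
        have "averages \<eta> (remove1 i xs) (\<lambda>x. P' x $ j) (x + \<eta> *\<^sub>R axis i 1) - averages \<eta> (remove1 i xs) (\<lambda>x. P' x $ j) x
          = averages \<eta> (remove1 j xs) (\<lambda>x. P' x $ i) (x + \<eta> *\<^sub>R axis j 1) - averages \<eta> (remove1 j xs) (\<lambda>x. P' x $ i) x"
        proof (rule averages_partials_symmetric[OF \<eta>(1) contP' contP' False])
          fix y assume y: "dist x y \<le> \<eta> * length xs"
          show "average \<eta> j (\<lambda>x. P' x $ j) (y + \<eta> *\<^sub>R axis i 1) - average \<eta> j (\<lambda>x. P' x $ j) y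
            = average \<eta> i (\<lambda>x. P' x $ i) (y + \<eta> *\<^sub>R axis j 1) - average \<eta> i (\<lambda>x. P' x $ i) y"
          proof (rule average_rectangle[OF \<eta>(1) contP' contP'])
            fix s t assume st: "s \<in> {0..\<eta>}" "t \<in> {0..\<eta>}"
            define z where "z = y + s *\<^sub>R axis i 1 + t *\<^sub>R axis j 1"
            have "norm (s *\<^sub>R axis i 1 + t *\<^sub>R axis j (1::real) :: real ^ 'k) \<le> s + t"
              using st by (intro norm_triangle_le) simp
            then have "dist z y \<le> 2 * \<eta>" using st by (simp add: z_def dist_norm add.assoc)
            then have "dist y z \<le> 2 * \<eta>" by (simp only: dist_commute)
            then have "dist x z < e" using y small dist_triangle[of x z y] by linarith
            from closed'[OF \<open>x \<in> S\<close> this] obtain Q where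
              Q: "\<And>a b. ((\<lambda>s. P' (z + s *\<^sub>R axis a 1) $ b) has_real_derivative Q a b) (at 0)" "\<And>a b. Q a b = Q b a" by blast
            show "\<exists>p1 p2 r2.
              ((\<lambda>h. P' (y + s *\<^sub>R axis i 1 + t *\<^sub>R axis j 1 + h *\<^sub>R axis i 1) $ i) has_real_derivative p1) (at 0) \<and>
              ((\<lambda>h. P' (y + s *\<^sub>R axis i 1 + t *\<^sub>R axis j 1 + h *\<^sub>R axis j 1) $ i) has_real_derivative p2) (at 0) \<and>
              ((\<lambda>h. P' (y + s *\<^sub>R axis i 1 + t *\<^sub>R axis j 1 + h *\<^sub>R axis i 1) $ j) has_real_derivative p2) (at 0) \<and>
              ((\<lambda>h. P' (y + s *\<^sub>R axis i 1 + t *\<^sub>R axis j 1 + h *\<^sub>R axis j 1) $ j) has_real_derivative r2) (at 0)"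
              unfolding z_def[symmetric] using Q(1)[of i i] Q(1)[of j i] Q(1)[of i j] Q(1)[of j j] Q(2)[of i j] 
              by (intro exI[of _ "Q i i"] exI[of _ "Q j i"] exI[of _ "Q j j"]) simp
          qed
        qed (simp_all add: xs)
        then show ?thesis by (simp add: D_def)
      qed simp
    qed
    moreover have "\<bar>line_integral (\<lambda>x. P x $ j) g j - line_integral (\<lambda>x. F x $ j) g j\<bar> \<le> \<omega> * L" for j
    proof (rule L)
      have "path_image g \<subseteq> W" using S(2) W(2) by blast
      then show "continuous_on (path_image g) (\<lambda>x. P x $ j)"
        using continuous_on_subset[OF W(3)] by (intro continuous_on_component) blast
      show "continuous_on (path_image g) (\<lambda>x. F x $ j)"
        unfolding F_def vec_lambda_beta
        by (rule continuous_on_subset[OF continuous_on_averages[OF contP']]) simp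
      fix x assume "x \<in> path_image g"
      then have "x \<in> S" using S(2) by blast
      then have xC: "x \<in> C" using e(1) by (auto simp: C_def intro!: bexI[of _ x])
      have "\<bar>averages \<eta> xs (\<lambda>x. P' x $ j) x - P x $ j\<bar> \<le> \<omega>"
      proof (rule averages_near[OF \<eta>(1) contP'])
        fix y assume "dist x y \<le> \<eta> * length xs"
        then have "dist x y < e" "dist y x < \<delta>" using small \<eta>(1) by (auto simp: dist_commute)
        then have "y \<in> C" using \<open>x \<in> S\<close> by (auto simp: C_def intro!: bexI[of _ x])
        then have "norm (P' y - P' x) < \<omega>" using \<delta>(2)[OF xC _ \<open>dist y x < \<delta>\<close>] by (simp add: dist_norm)
        then show "\<bar>P' y $ j - P x $ j\<bar> \<le> \<omega>"
          using component_le_norm_cart[of "P' y - P' x" j] P'(2)[OF xC] by simp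
      qed
      then show "\<bar>P x $ j - F x $ j\<bar> \<le> \<omega>" by (simp add: F_def abs_minus_commute)
    qed
    then have "\<bar>\<Sum>j\<in>UNIV. line_integral (\<lambda>x. P x $ j) g j - line_integral (\<lambda>x. F x $ j) g j\<bar> \<le> (\<Sum>j\<in>(UNIV::'k set). \<omega> * L)"
      by (intro order_trans[OF sum_abs] sum_mono)
    ultimately show ?thesis by (simp add: sum_subtractf)
  qed
  have "((\<lambda>\<omega>. real CARD('k) * (\<omega> * L)) \<longlongrightarrow> real CARD('k) * (0 * L)) (at_right 0)"
    by (intro tendsto_intros)
  moreover have "\<forall>\<^sub>F \<omega> in at_right 0. \<bar>\<Sum>j\<in>UNIV. line_integral (\<lambda>x. P x $ j) g j\<bar> \<le> real CARD('k) * (\<omega> * L)"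
    using bound by (auto simp: eventually_at_right_less intro: eventually_mono[OF eventually_at_right_less[of 0]])
  ultimately have "\<bar>\<Sum>j\<in>UNIV. line_integral (\<lambda>x. P x $ j) g j\<bar> \<le> real CARD('k) * (0 * L)"
    by (intro tendsto_lowerbound) auto
  then show ?thesis by simp
qed


section \<open>Real-linear functionals on the algebra\<close>

text \<open>
  The algebra carries an arbitrary norm and no Euclidean structure, so the continuity of linear
  functionals on a finite-dimensional normed space is derived directly.  The bound on coordinates is
  proved by induction on the dimension; the induction step needs a positive distance of the new basis
  vector from the span of the others, hence that this span is closed.
\<close>

lemma closed_span_of_coordinate_bound:
  fixes B :: "'a::real_normed_vector set"
  assumes "finite B" and bound: "\<And>a :: 'a \<Rightarrow> real. (\<Sum>b\<in>B. \<bar>a b\<bar>) \<le> c * norm (\<Sum>b\<in>B. a b *\<^sub>R b)"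
    and "0 < c"
  shows "closed (span B)"
  unfolding closed_sequential_limits
proof (intro allI impI)
  fix y l assume "(\<forall>n. y n \<in> span B) \<and> y \<longlonglongrightarrow> l"
  then have y: "\<forall>n. \<exists>u. y n = (\<Sum>b\<in>B. u b *\<^sub>R b)" and lim: "y \<longlonglongrightarrow> l"
    using span_finite[OF assms(1)] by auto
  from choice[OF y] obtain u where u: "\<And>n. y n = (\<Sum>b\<in>B. u n b *\<^sub>R b)" by blast
  have diff: "\<bar>u m b - u n b\<bar> \<le> c * dist (y m) (y n)" if "b \<in> B" for m n b
  proof -
    have "\<bar>u m b - u n b\<bar> \<le> (\<Sum>b\<in>B. \<bar>u m b - u n b\<bar>)" using assms(1) that by (intro member_le_sum) auto
    also have "\<dots> \<le> c * norm (\<Sum>b\<in>B. (u m b - u n b) *\<^sub>R b)" by (rule bound)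
    also have "(\<Sum>b\<in>B. (u m b - u n b) *\<^sub>R b) = y m - y n"
      by (simp add: u scaleR_left_diff_distrib sum_subtractf)
    finally show ?thesis by (simp add: dist_norm)
  qed
  have "\<exists>\<alpha>. (\<lambda>n. u n b) \<longlonglongrightarrow> \<alpha>" if "b \<in> B" for b
  proof -
    have "Cauchy (\<lambda>n. u n b)"
      unfolding Cauchy_def
    proof (intro allI impI)
      fix e :: real assume "0 < e"
      then have "0 < e / c" using \<open>0 < c\<close> by simp
      then obtain M where M: "\<And>m n. m \<ge> M \<Longrightarrow> n \<ge> M \<Longrightarrow> dist (y m) (y n) < e / c"
        using LIMSEQ_imp_Cauchy[OF lim] unfolding Cauchy_def by blast
      have "dist (u m b) (u n b) < e" if "m \<ge> M" "n \<ge> M" for m n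
        using diff[OF \<open>b \<in> B\<close>, of m n] M[OF that] \<open>0 < c\<close> by (simp add: dist_real_def pos_less_divide_eq mult.commute)
      then show "\<exists>M. \<forall>m\<ge>M. \<forall>n\<ge>M. dist (u m b) (u n b) < e" by blast
    qed
    then show ?thesis using convergent_eq_Cauchy by blast
  qed
  then have "\<forall>b. \<exists>\<alpha>. b \<in> B \<longrightarrow> (\<lambda>n. u n b) \<longlonglongrightarrow> \<alpha>" by blast
  from choice[OF this] obtain \<alpha> where "\<And>b. b \<in> B \<Longrightarrow> (\<lambda>n. u n b) \<longlonglongrightarrow> \<alpha> b" by blast
  then have "(\<lambda>n. \<Sum>b\<in>B. u n b *\<^sub>R b) \<longlonglongrightarrow> (\<Sum>b\<in>B. \<alpha> b *\<^sub>R b)" by (intro tendsto_intros)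
  then have "l = (\<Sum>b\<in>B. \<alpha> b *\<^sub>R b)" using lim LIMSEQ_unique unfolding u by blast
  then show "l \<in> span B" by (simp add: span_sum span_scale span_base)
qed

lemma finite_independent_coordinate_bound:
  fixes B :: "'a::real_normed_vector set"
  assumes "finite B" "independent B"
  shows "\<exists>c>0. \<forall>a :: 'a \<Rightarrow> real. (\<Sum>b\<in>B. \<bar>a b\<bar>) \<le> c * norm (\<Sum>b\<in>B. a b *\<^sub>R b)"
  using assms
proof (induction B rule: finite_induct)
  case empty
  show ?case by (auto intro: exI[of _ 1])
next
  case (insert b B)
  have ind: "independent B" "b \<notin> span B"
    using insert.prems insert.hyps(2) independent_insert[of b B] by auto
  obtain c where c: "c > 0" "\<And>a :: 'a \<Rightarrow> real. (\<Sum>b\<in>B. \<bar>a b\<bar>) \<le> c * norm (\<Sum>b\<in>B. a b *\<^sub>R b)"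
    using insert.IH[OF ind(1)] by blast
  have "open (- span B)"
    using closed_span_of_coordinate_bound[OF insert.hyps(1) c(2,1)] by (simp add: open_Compl)
  then obtain d where d: "d > 0" "ball b d \<subseteq> - span B"
    using ind(2) unfolding open_contains_ball by blast
  have far: "d \<le> norm (b + y)" if "y \<in> span B" for y
  proof (rule ccontr)
    assume "\<not> d \<le> norm (b + y)"
    then have "- y \<in> ball b d" by (simp add: dist_norm)
    then show False using d(2) that span_neg by blast
  qed
  define K where "K = 1 / d + c * (1 + norm b / d)"
  have "K > 0" using c(1) d(1) by (simp add: K_def add_pos_nonneg)
  moreover have "(\<Sum>b\<in>insert b B. \<bar>a b\<bar>) \<le> K * norm (\<Sum>b\<in>insert b B. a b *\<^sub>R b)" for a
  proof -
    define y where "y = (\<Sum>b\<in>B. a b *\<^sub>R b)"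
    define x where "x = a b *\<^sub>R b + y"
    have "y \<in> span B" unfolding y_def by (intro span_sum span_scale span_base)
    have ab: "\<bar>a b\<bar> * d \<le> norm x"
    proof (cases "a b = 0")
      case False
      have "x = a b *\<^sub>R (b + (1 / a b) *\<^sub>R y)" using False by (simp add: x_def scaleR_add_right)
      then have "norm x = \<bar>a b\<bar> * norm (b + (1 / a b) *\<^sub>R y)" by simp
      then show ?thesis using far[OF span_scale[OF \<open>y \<in> span B\<close>]] by (simp add: mult_left_mono)
    qed simp
    then have ab': "\<bar>a b\<bar> \<le> norm x / d" using d(1) by (simp add: pos_le_divide_eq)
    have "norm y = norm (x - a b *\<^sub>R b)" by (simp add: x_def)
    also have "\<dots> \<le> norm x + \<bar>a b\<bar> * norm b" using norm_triangle_ineq4[of x "a b *\<^sub>R b"] by simp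
    also have "\<dots> \<le> norm x + norm x / d * norm b" using ab' by (intro add_left_mono mult_right_mono) auto
    finally have "c * norm y \<le> c * (norm x + norm x / d * norm b)" using c(1) by (intro mult_left_mono) auto
    then have "(\<Sum>b\<in>B. \<bar>a b\<bar>) \<le> c * (norm x + norm x / d * norm b)" using c(2)[of a] by (simp add: y_def)
    then have "\<bar>a b\<bar> + (\<Sum>b\<in>B. \<bar>a b\<bar>) \<le> norm x / d + c * (norm x + norm x / d * norm b)"
      using ab' by linarith
    also have "\<dots> = K * norm x" by (simp add: K_def algebra_simps)
    finally show ?thesis using insert.hyps by (simp add: x_def y_def)
  qed
  ultimately show ?case by blast
qed

text \<open>
  Applied to \<open>\<lambda>a. L (x * a)\<close>, this also takes care of limits in which a factor \<open>x\<close> stands before the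
  argument.
\<close>

lemma linear_functional_bounded:
  fixes L :: "'a::real_normed_vector \<Rightarrow> real" and B :: "'a set"
  assumes "linear L" "finite B" "span B = UNIV"
  shows "bounded_linear L"
proof -
  obtain B' where B': "B' \<subseteq> B" "independent B'" "B \<subseteq> span B'"
    using maximal_independent_subset[of B] by blast
  have "finite B'" using B'(1) assms(2) by (rule finite_subset)
  have "span B' = UNIV" using B'(3) assms(3) by (metis span_mono span_span top.extremum_uniqueI)
  obtain c where c: "c > 0" "\<And>a :: 'a \<Rightarrow> real. (\<Sum>b\<in>B'. \<bar>a b\<bar>) \<le> c * norm (\<Sum>b\<in>B'. a b *\<^sub>R b)"
    using finite_independent_coordinate_bound[OF \<open>finite B'\<close> B'(2)] by blast
  define M where "M = (\<Sum>b\<in>B'. \<bar>L b\<bar>)"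
  have "norm (L x) \<le> norm x * (c * M)" for x
  proof -
    have "x \<in> span B'" using \<open>span B' = UNIV\<close> by simp
    then obtain a where x: "x = (\<Sum>b\<in>B'. a b *\<^sub>R b)" using span_finite[OF \<open>finite B'\<close>] by auto
    have "L x = (\<Sum>b\<in>B'. a b * L b)"
      unfolding x linear_sum[OF assms(1)] linear_scale[OF assms(1)] by simp
    also have "norm \<dots> \<le> (\<Sum>b\<in>B'. \<bar>a b\<bar> * M)"
      unfolding real_norm_def
    proof (rule order_trans[OF sum_abs sum_mono])
      fix b assume "b \<in> B'"
      then have "\<bar>L b\<bar> \<le> M" unfolding M_def using \<open>finite B'\<close> by (intro member_le_sum) auto
      then show "\<bar>a b * L b\<bar> \<le> \<bar>a b\<bar> * M" unfolding abs_mult by (intro mult_left_mono) auto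
    qed
    also have "\<dots> = (\<Sum>b\<in>B'. \<bar>a b\<bar>) * M" by (simp add: sum_distrib_right)
    also have "\<dots> \<le> (c * norm x) * M" using c(2)[of a] by (intro mult_right_mono) (auto simp: x M_def sum_nonneg)
    finally show ?thesis by (simp add: mult_ac)
  qed
  then show ?thesis using assms(1) by (intro bounded_linear_intro) (auto simp: linear_add linear_scale)
qed

context cartan_algebra
begin

abbreviation coord :: "nat \<Rightarrow> 'a \<Rightarrow> complex"
  where "coord \<equiv> basis_coord cscale n I"

lemma coord_add: "coord r (a + b) = coord r a + coord r b"
  using basis_independent basis_span by (simp add: basis_coord_def representation_add)

lemma coord_scale: "coord r (cscale c a) = c * coord r a"
  using basis_independent basis_span by (simp add: basis_coord_def representation_scale)

lemma coord_expansion: "a = (\<Sum>r = 1..n. cscale (coord r a) (I r))"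
proof -
  have "(\<Sum>b\<in>I ` {1..n}. cscale (representation (I ` {1..n}) a b) b) = a"
    using basis_independent basis_span by (intro sum_representation_eq) auto
  then show ?thesis using basis_inj by (simp add: sum.reindex basis_coord_def)
qed

lemma mult_scale: "x * cscale c y = cscale c (x * y)"
  using scale_mult_left[of c y x] by (simp add: mult.commute)

lemma mult_scaleR: "(x :: 'a) * (t *\<^sub>R y) = t *\<^sub>R (x * y)"
  by (simp add: scaleR_eq_scale mult_scale)

lemma scale_scaleR: "cscale c (t *\<^sub>R y) = t *\<^sub>R cscale c y"
  by (simp add: scaleR_eq_scale mult.commute)

lemma scale_complex: "cscale c a = Re c *\<^sub>R a + Im c *\<^sub>R cscale \<i> a"
proof -
  have "cscale c a = cscale (of_real (Re c) + of_real (Im c) * \<i>) a"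
    using complex_eq[of c] by (simp add: mult.commute)
  then show ?thesis unfolding scale_left_distrib scaleR_eq_scale by simp
qed

lemma real_functional_continuous:
  fixes L :: "'a \<Rightarrow> real"
  assumes "linear L"
  shows "bounded_linear L"
proof (rule linear_functional_bounded[OF assms])
  show "finite (I ` {1..n} \<union> (\<lambda>r. cscale \<i> (I r)) ` {1..n})" by simp
  show "Real_Vector_Spaces.span (I ` {1..n} \<union> (\<lambda>r. cscale \<i> (I r)) ` {1..n}) = UNIV"
  proof (intro set_eqI iffI UNIV_I)
    fix a
    have "(\<Sum>r = 1..n. Re (coord r a) *\<^sub>R I r + Im (coord r a) *\<^sub>R cscale \<i> (I r))
        \<in> Real_Vector_Spaces.span (I ` {1..n} \<union> (\<lambda>r. cscale \<i> (I r)) ` {1..n})"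
      by (intro real_vector.span_sum real_vector.span_add real_vector.span_scale real_vector.span_base) auto
    then show "a \<in> Real_Vector_Spaces.span (I ` {1..n} \<union> (\<lambda>r. cscale \<i> (I r)) ` {1..n})"
      unfolding scale_complex[symmetric] coord_expansion[of a, symmetric] .
  qed
qed

lemma linear_coord: "linear (\<lambda>a. Re (coord r a))" "linear (\<lambda>a. Im (coord r a))"
  by (auto intro!: linearI simp: coord_add coord_scale scaleR_eq_scale)

lemma eq_0_if_functionals_vanish:
  assumes "\<And>L :: 'a \<Rightarrow> real. linear L \<Longrightarrow> L a = 0"
  shows "a = 0"
proof -
  have "coord r a = 0" for r
    using assms[OF linear_coord(1)] assms[OF linear_coord(2)] by (simp add: complex_eq_iff)
  then have "(\<Sum>r = 1..n. cscale (coord r a) (I r)) = 0" by simp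
  then show ?thesis unfolding coord_expansion[of a, symmetric] .
qed

lemma functional_mult_expansion:
  fixes L :: "'a \<Rightarrow> real"
  assumes "linear L"
  shows "L (x * a) = (\<Sum>r = 1..n. L (x * I r) * Re (coord r a)) + (\<Sum>r = 1..n. L (cscale \<i> (x * I r)) * Im (coord r a))"
proof -
  have "x * a = x * (\<Sum>r = 1..n. cscale (coord r a) (I r))"
    by (simp only: coord_expansion[of a, symmetric])
  also have "\<dots> = (\<Sum>r = 1..n. cscale (coord r a) (x * I r))"
    by (simp add: sum_distrib_left mult_scale)
  also have "\<dots> = (\<Sum>r = 1..n. Re (coord r a) *\<^sub>R (x * I r) + Im (coord r a) *\<^sub>R cscale \<i> (x * I r))"
    by (simp only: scale_complex[symmetric])
  finally show ?thesis
    by (simp add: linear_sum[OF assms] linear_add[OF assms] linear_scale[OF assms] sum.distrib mult.commute)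
qed

text \<open>
  A real-linear functional turns the integral of \<open>\<Psi> d\<zeta>\<close> into that of the real 1-form with
  coefficients \<open>L (e\<^sub>j \<Psi>)\<close>.
\<close>

lemma functional_curve_integral:
  fixes e :: "'k::finite \<Rightarrow> 'a" and L :: "'a \<Rightarrow> real"
  assumes L: "linear L" and rect: "rectifiable (E_coord e \<circ> \<gamma>)"
    and cont: "continuous_on (path_image (E_coord e \<circ> \<gamma>)) (\<lambda>x. \<Psi> (E_point e x))"
  shows "L (curve_integral cscale n I e \<gamma> \<Psi>) =
    (\<Sum>j\<in>UNIV. line_integral (\<lambda>x. L (e j * \<Psi> (E_point e x))) (E_coord e \<circ> \<gamma>) j)"
proof -
  define g where "g = E_coord e \<circ> \<gamma>"
  define U where "U r x = Re (coord r (\<Psi> (E_point e x)))" for r x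
  define V where "V r x = Im (coord r (\<Psi> (E_point e x)))" for r x
  have functional: "continuous_on (path_image g) (\<lambda>x. M (\<Psi> (E_point e x)))" if "linear M" for M :: "'a \<Rightarrow> real"
    using cont unfolding g_def
    by (rule bounded_linear.continuous_on[OF real_functional_continuous[OF that]])
  have contUV: "continuous_on (path_image g) (U r)" "continuous_on (path_image g) (V r)" for r
    unfolding U_def V_def
    using functional[of "\<lambda>a. Re (coord r a)"] functional[of "\<lambda>a. Im (coord r a)"] linear_coord by blast+
  have "L (e j * (\<Sum>r = 1..n. line_integral (U r) g j *\<^sub>R I r))
      + L (cscale \<i> (e j * (\<Sum>r = 1..n. line_integral (V r) g j *\<^sub>R I r)))
      = line_integral (\<lambda>x. L (e j * \<Psi> (E_point e x))) g j" for j
  proof -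
    \<comment> \<open>Real and imaginary parts form one linear combination, indexed by a disjoint sum.\<close>
    define c where "c = case_sum (\<lambda>r. L (e j * I r)) (\<lambda>r. L (cscale \<i> (e j * I r)))"
    have "line_integral (\<lambda>x. \<Sum>q\<in>{1..n} <+> {1..n}. c q * case_sum U V q x) g j
        = (\<Sum>q\<in>{1..n} <+> {1..n}. c q * line_integral (case_sum U V q) g j)"
      using rect contUV by (intro line_integral_linear_combination) (auto simp: g_def[symmetric])
    moreover have "(\<lambda>x. \<Sum>q\<in>{1..n} <+> {1..n}. c q * case_sum U V q x) = (\<lambda>x. L (e j * \<Psi> (E_point e x)))"
    proof
      fix x
      show "(\<Sum>q\<in>{1..n} <+> {1..n}. c q * case_sum U V q x) = L (e j * \<Psi> (E_point e x))"
        unfolding functional_mult_expansion[OF L, of "e j" "\<Psi> (E_point e x)"]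
        by (simp add: sum.Plus c_def U_def V_def)
    qed
    moreover have "L (e j * (\<Sum>r = 1..n. line_integral (U r) g j *\<^sub>R I r))
        = (\<Sum>r = 1..n. L (e j * I r) * line_integral (U r) g j)"
      by (simp add: sum_distrib_left mult_scaleR linear_sum[OF L] linear_scale[OF L] mult.commute)
    moreover have "L (cscale \<i> (e j * (\<Sum>r = 1..n. line_integral (V r) g j *\<^sub>R I r)))
        = (\<Sum>r = 1..n. L (cscale \<i> (e j * I r)) * line_integral (V r) g j)"
    proof -
      have "cscale \<i> (e j * (\<Sum>r = 1..n. line_integral (V r) g j *\<^sub>R I r))
        = (\<Sum>r = 1..n. line_integral (V r) g j *\<^sub>R cscale \<i> (e j * I r))"
        by (simp only: sum_distrib_left mult_scaleR scale_sum_right scale_scaleR)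
      then show ?thesis by (simp add: linear_sum[OF L] linear_scale[OF L] mult.commute)
    qed
    ultimately show ?thesis by (simp add: sum.Plus c_def)
  qed
  note components = this
  have "curve_integral cscale n I e \<gamma> \<Psi> =
      (\<Sum>j\<in>UNIV. e j * (\<Sum>r = 1..n. line_integral (U r) g j *\<^sub>R I r)) +
      (\<Sum>j\<in>UNIV. cscale \<i> (e j * (\<Sum>r = 1..n. line_integral (V r) g j *\<^sub>R I r)))"
    unfolding curve_integral_def Let_def g_def U_def V_def scale_sum_right ..
  then show ?thesis
    unfolding g_def[symmetric]
    by (simp only: linear_add[OF L] linear_sum[OF L] sum.distrib[symmetric] components)
qed

end

lemma E_point_axis: "E_point e (x + s *\<^sub>R axis i 1) = E_point e x + s *\<^sub>R e i"
proof -
  have "(\<Sum>j\<in>UNIV. (s *\<^sub>R axis i (1::real)) $ j *\<^sub>R e j) = (\<Sum>j\<in>UNIV. if j = i then s *\<^sub>R e i else 0)"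
    by (intro sum.cong) (auto simp: axis_def)
  then show ?thesis by (simp add: E_point_def scaleR_add_left sum.distrib)
qed

lemma inj_E_point:
  assumes "inj e" "independent (range e)"
  shows "inj (E_point e)"
proof (rule injI)
  fix x y assume "E_point e x = E_point e y"
  then have 0: "(\<Sum>j\<in>UNIV. (x $ j - y $ j) *\<^sub>R e j) = 0"
    by (simp add: E_point_def scaleR_diff_left sum_subtractf)
  define u where "u v = x $ inv e v - y $ inv e v" for v
  have sum_0: "(\<Sum>v\<in>range e. u v *\<^sub>R v) = 0"
    using 0 assms(1) by (simp add: sum.reindex u_def)
  have "u v = 0" if "v \<in> range e" for v
    by (rule independentD[OF assms(2) _ subset_refl sum_0 that]) simp
  from this[of "e j" for j] show "x = y" using assms(1) by (simp add: u_def vec_eq_iff)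
qed

text \<open>
  Monogenicity gives one-sided limits along rays; since \<open>h\<close> and \<open>- h\<close> both lie in \<open>E\<^sub>k\<close>, and the two
  limits are opposite, they combine to a two-sided derivative.
\<close>

lemma has_real_derivative_of_rays:
  fixes F :: "'a::real_normed_vector \<Rightarrow> 'a" and M :: "'a \<Rightarrow> real"
  assumes M: "bounded_linear M"
    and forward: "((\<lambda>\<epsilon>. (1 / \<epsilon>) *\<^sub>R (F (\<zeta> + \<epsilon> *\<^sub>R h) - F \<zeta>)) \<longlongrightarrow> a) (at_right 0)"
    and backward: "((\<lambda>\<epsilon>. (1 / \<epsilon>) *\<^sub>R (F (\<zeta> + \<epsilon> *\<^sub>R - h) - F \<zeta>)) \<longlongrightarrow> - a) (at_right 0)"
  shows "((\<lambda>s. M (F (\<zeta> + s *\<^sub>R h))) has_real_derivative M a) (at 0)"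
proof -
  interpret M: bounded_linear M by (rule M)
  have right: "((\<lambda>s. (M (F (\<zeta> + s *\<^sub>R h)) - M (F \<zeta>)) / s) \<longlongrightarrow> M a) (at_right 0)"
    using M.tendsto[OF forward] by (simp add: M.scaleR M.diff)
  have "((\<lambda>s. - (M ((1 / s) *\<^sub>R (F (\<zeta> + s *\<^sub>R - h) - F \<zeta>)))) \<longlongrightarrow> - M (- a)) (at_right 0)"
    by (intro tendsto_minus M.tendsto[OF backward])
  then have "((\<lambda>s. (M (F (\<zeta> + (- s) *\<^sub>R h)) - M (F \<zeta>)) / (- s)) \<longlongrightarrow> M a) (at_right 0)"
    by (simp add: M.scaleR M.diff M.neg)
  then have left: "((\<lambda>s. (M (F (\<zeta> + s *\<^sub>R h)) - M (F \<zeta>)) / s) \<longlongrightarrow> M a) (at_left 0)"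
    by (subst filterlim_at_left_to_right) simp
  have "((\<lambda>s. (M (F (\<zeta> + s *\<^sub>R h)) - M (F \<zeta>)) / s) \<longlongrightarrow> M a) (at 0)"
    using left right by (rule filterlim_split_at)
  then show ?thesis unfolding DERIV_def by simp
qed


section \<open>The integral theorem\<close>

theorem theorem1:
  fixes cscale :: "complex \<Rightarrow> 'a \<Rightarrow> 'a::{comm_ring_1, real_normed_vector}"
    and m n :: nat
    and I :: "nat \<Rightarrow> 'a"
    and \<Upsilon> :: "nat \<Rightarrow> nat \<Rightarrow> nat \<Rightarrow> complex"
    and e :: "'k::finite \<Rightarrow> 'a"
    and j1 :: 'k
    and \<Omega> \<Sigma> :: "'a set"
    and \<Phi> :: "'a \<Rightarrow> 'a"
    and \<gamma> :: "real \<Rightarrow> 'a"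
  assumes algebra: "cartan_algebra cscale m n I \<Upsilon>"
    and k_bounds: "2 \<le> CARD('k)" "CARD('k) \<le> 2 * n"
    and e_one: "e j1 = 1"
    and e_independent: "inj e" "independent (range e)"
    and f_onto: "\<And>u. u \<in> {1..m} \<Longrightarrow> f_functional cscale n I u ` E_space e = UNIV"
    and domain: "E_domain e \<Omega>"
    and monogenic: "monogenic_on e \<Omega> \<Phi>"
    and surface_in: "\<Sigma> \<subseteq> \<Omega>"
    and curve_in: "path_image \<gamma> \<subseteq> E_space e"
    and curve: "jordan_curve (E_coord e \<circ> \<gamma>)" "rectifiable (E_coord e \<circ> \<gamma>)"
    and surface: "piecewise_smooth_surface_with_edge (E_coord e ` \<Sigma>) (E_coord e \<circ> \<gamma>)"
  shows "curve_integral cscale n I e \<gamma> \<Phi> = 0"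
proof -
  interpret cartan_algebra cscale m n I \<Upsilon> by (rule algebra)
  define W where "W = E_coord e ` \<Omega>"
  have inj: "inj (E_point e)" by (rule inj_E_point[OF e_independent])
  have W: "open W" "\<Omega> \<subseteq> E_space e" using domain by (auto simp: E_domain_def W_def)
  have in_\<Omega>: "E_point e x \<in> \<Omega>" if "x \<in> W" for x
    using that W(2) by (auto simp: W_def E_coord_def E_space_def f_inv_into_f)
  have cont_\<Phi>: "continuous_on W (\<lambda>x. \<Phi> (E_point e x))"
  proof (rule continuous_on_compose2[of \<Omega> \<Phi>])
    show "continuous_on \<Omega> \<Phi>" using monogenic by (simp add: monogenic_on_def)
    show "continuous_on W (E_point e)" unfolding E_point_def by (intro continuous_intros)
  qed (use in_\<Omega> in auto)
  have SW: "E_coord e ` \<Sigma> \<subseteq> W" using surface_in by (auto simp: W_def)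
  have "path_image (E_coord e \<circ> \<gamma>) \<subseteq> W" using surface_compact(2)[OF surface] SW by blast
  then have cont_\<gamma>: "continuous_on (path_image (E_coord e \<circ> \<gamma>)) (\<lambda>x. \<Phi> (E_point e x))"
    by (rule continuous_on_subset[OF cont_\<Phi>])
  show ?thesis
  proof (rule eq_0_if_functionals_vanish)
    fix L :: "'a \<Rightarrow> real" assume L: "linear L"
    have M: "bounded_linear (\<lambda>a. L (e j * a))" for j
      by (rule real_functional_continuous)
        (auto intro!: linearI simp: distrib_left mult_scaleR linear_add[OF L] linear_scale[OF L])
    define P where "P x = (\<chi> j. L (e j * \<Phi> (E_point e x)))" for x
    have "(\<Sum>j\<in>UNIV. line_integral (\<lambda>x. P x $ j) (E_coord e \<circ> \<gamma>) j) = 0"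
    proof (rule line_integral_closed_form[OF W(1) SW _ _ curve(2) surface])
      show "continuous_on W P"
        unfolding P_def
        by (intro continuous_on_vec_lambda bounded_linear.continuous_on[OF M] cont_\<Phi>)
      fix x assume "x \<in> W"
      then obtain \<Phi>' where \<Phi>': "\<And>h. h \<in> E_space e \<Longrightarrow>
          ((\<lambda>\<epsilon>::real. (1 / \<epsilon>) *\<^sub>R (\<Phi> (E_point e x + \<epsilon> *\<^sub>R h) - \<Phi> (E_point e x))) \<longlongrightarrow> h * \<Phi>') (at_right 0)"
        using monogenic in_\<Omega> unfolding monogenic_on_def by blast
      have "E_point e 0 = 0" by (simp add: E_point_def)
      then have "E_point e (axis i 1) = e i" "E_point e (- axis i 1) = - e i" for i
        using E_point_axis[of e 0 1 i] E_point_axis[of e 0 "-1" i] by simp_all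
      from rangeI[of "E_point e" "axis i 1" for i, unfolded this] rangeI[of "E_point e" "- axis i 1" for i, unfolded this]
      have in_E: "e i \<in> E_space e" "- e i \<in> E_space e" for i
        unfolding E_space_def by this
      \<comment> \<open>Here \<open>\<partial>\<^sub>i P\<^sub>j = L (e\<^sub>j e\<^sub>i \<Phi>')\<close>, symmetric by commutativity.\<close>
      have "((\<lambda>s. P (x + s *\<^sub>R axis i 1) $ j) has_real_derivative L (e j * (e i * \<Phi>'))) (at 0)" for i j
        unfolding P_def vec_lambda_beta E_point_axis
        using \<Phi>'[OF in_E(1)] \<Phi>'[OF in_E(2)] by (intro has_real_derivative_of_rays[OF M]) simp_all
      then show "\<exists>Q. \<forall>i j. ((\<lambda>s. P (x + s *\<^sub>R axis i 1) $ j) has_real_derivative Q i j) (at 0) \<and> Q i j = Q j i"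
        by (intro exI[of _ "\<lambda>i j. L (e j * (e i * \<Phi>'))"]) (auto simp: mult.left_commute)
    qed
    then show "L (curve_integral cscale n I e \<gamma> \<Phi>) = 0"
      using functional_curve_integral[OF L curve(2) cont_\<gamma>] by (simp add: P_def)
  qed
qed

end
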